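(* In $\mathrm{DH}_{\mathrm{cl}}$: for all $m,n\in\mathbb{Z}_{>0}$, $$b_m*b_{-n}-b_{-n}*b_m=\delta_{m,n}\frac{n}{q^n-1};$$ and for all $m,n\in\mathbb{Z}$ with $mn\ge0$, $b_m*b_n=b_n*b_m$.
   Context: $k=\mathbb{F}_q$; $\mathfrak{A}$ is the category of finite-dimensional $k$-vector spaces with a nilpotent endomorphism; $I_\lambda=(k^{|\lambda|},J_\lambda)$, $J_\lambda$ the direct sum of nilpotent Jordan blocks of sizes $\lambda_1,\lambda_2,\dots$; every object is isomorphic to a unique $I_\lambda$. $a_\lambda=|\mathrm{Aut}(I_\lambda)|$; $g^\lambda_{\mu,\nu}$ is the number of subobjects $N\subset I_\lambda$ with $N\simeq I_\nu$, $I_\lambda/N\simeq I_\mu$; for partitions $\lambda,\mu,\alpha,\beta$, $\gamma^{\alpha,\beta}_{\lambda,\mu}:=\frac{1}{a_\lambda a_\mu}\,\#\{(f,g,h)\ :\ 0\to I_\alpha\xrightarrow{f}I_\mu\xrightarrow{g}I_\lambda\xrightarrow{h}I_\beta\to0\ \text{exact in }\mathfrak{A}\}$. The derived classical Hall algebra $\mathrm{DH}_{\mathrm{cl}}$ (Toën's derived Hall algebra of $\mathfrak{A}$) is the unital associative $\mathbb{C}$-algebra with generators $Z^{[n]}_\lambda$ ($n\in\mathbb{Z}$, $\lambda$ a partition) and relations: $Z^{[n]}_\lambda*Z^{[n]}_\mu=\sum_\nu g^\nu_{\lambda,\mu}Z^{[n]}_\nu$; $Z^{[n]}_\lambda*Z^{[n+1]}_\mu=\sum_{\alpha,\beta}\gamma^{\alpha,\beta}_{\lambda,\mu}Z^{[n+1]}_\alpha*Z^{[n]}_\beta$;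 $Z^{[n]}_\lambda*Z^{[m]}_\mu=Z^{[m]}_\mu*Z^{[n]}_\lambda$ for $n-m<-1$; and $Z^{[n]}_\emptyset=1$. For $n\ge1$ set $b_n:=\sum_{|\lambda|=n}(q;q)_{\ell(\lambda)-1}Z^{[0]}_\lambda$, $b_{-n}:=\sum_{|\lambda|=n}(q;q)_{\ell(\lambda)-1}Z^{[1]}_\lambda$, and $b_0:=1$, where $\ell(\lambda)$ is the number of nonzero parts and $(q;q)_m=\prod_{i=1}^m(1-q^i)$, $(q;q)_0=1$. *)

theory Defs
  imports Complex_Main
begin

definition is_partition :: "nat list \<Rightarrow> bool" where
  "is_partition lam \<longleftrightarrow> sorted_wrt (\<ge>) lam \<and> (\<forall>x\<in>set lam. 0 < x)"

definition partitions_of :: "nat \<Rightarrow> nat list set" where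
  "partitions_of n = {lam. is_partition lam \<and> sum_list lam = n}"

definition vecs :: "nat \<Rightarrow> (nat \<Rightarrow> 'k::field) set" where
  "vecs n = {v. \<forall>i\<ge>n. v i = 0}"

definition mats :: "nat \<Rightarrow> nat \<Rightarrow> (nat \<Rightarrow> nat \<Rightarrow> 'k::field) set" where
  "mats b a = {M. \<forall>i j. (b \<le> i \<or> a \<le> j) \<longrightarrow> M i j = 0}"

definition mv :: "nat \<Rightarrow> (nat \<Rightarrow> nat \<Rightarrow> 'k::field) \<Rightarrow> (nat \<Rightarrow> 'k) \<Rightarrow> (nat \<Rightarrow> 'k)" where
  "mv a M v = (\<lambda>i. \<Sum>j<a. M i j * v j)"

definition is_subspace :: "nat \<Rightarrow> (nat \<Rightarrow> 'k::field) set \<Rightarrow> bool" where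
  "is_subspace n N \<longleftrightarrow> N \<subseteq> vecs n \<and> (\<lambda>_. 0) \<in> N \<and>
     (\<forall>u\<in>N. \<forall>v\<in>N. (\<lambda>i. u i + v i) \<in> N) \<and> (\<forall>c. \<forall>v\<in>N. (\<lambda>i. c * v i) \<in> N)"

definition block_starts :: "nat list \<Rightarrow> nat set" where
  "block_starts lam = {sum_list (take i lam) | i. i < length lam}"

text \<open>Direct sum of nilpotent Jordan blocks of sizes lam!0, lam!1, ...: on each block
  the basis vector e_j is sent to e_(j-1), the first basis vector of a block to 0.\<close>
definition Jmat :: "nat list \<Rightarrow> nat \<Rightarrow> nat \<Rightarrow> 'k::field" where
  "Jmat lam i j = (if j = Suc i \<and> j < sum_list lam \<and> j \<notin> block_starts lam then 1 else 0)"

definition homs :: "nat list \<Rightarrow> nat list \<Rightarrow> (nat \<Rightarrow> nat \<Rightarrow> 'k::field) set" where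
  "homs lam mu = {M \<in> mats (sum_list mu) (sum_list lam).
     \<forall>v\<in>vecs (sum_list lam).
       mv (sum_list mu) (Jmat mu) (mv (sum_list lam) M v) = mv (sum_list lam) M (mv (sum_list lam) (Jmat lam) v)}"

definition autos :: "nat list \<Rightarrow> (nat \<Rightarrow> nat \<Rightarrow> 'k::field) set" where
  "autos lam = {M \<in> homs lam lam. bij_betw (mv (sum_list lam) M) (vecs (sum_list lam)) (vecs (sum_list lam))}"

definition a_num :: "'k::field itself \<Rightarrow> nat list \<Rightarrow> nat" where
  "a_num _ lam = card (autos lam :: (nat \<Rightarrow> nat \<Rightarrow> 'k) set)"

definition subobj_iso :: "nat list \<Rightarrow> (nat \<Rightarrow> 'k::field) set \<Rightarrow> nat list \<Rightarrow> bool" where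
  "subobj_iso lam N nu \<longleftrightarrow> is_subspace (sum_list lam) N \<and>
     (\<forall>v\<in>N. mv (sum_list lam) (Jmat lam) v \<in> N) \<and>
     (\<exists>M \<in> homs nu lam. bij_betw (mv (sum_list nu) M) (vecs (sum_list nu)) N)"

definition quot_iso :: "nat list \<Rightarrow> (nat \<Rightarrow> 'k::field) set \<Rightarrow> nat list \<Rightarrow> bool" where
  "quot_iso lam N mu \<longleftrightarrow>
     (\<exists>P \<in> homs lam mu. mv (sum_list lam) P ` vecs (sum_list lam) = vecs (sum_list mu) \<and>
        {v \<in> vecs (sum_list lam). mv (sum_list lam) P v = (\<lambda>_. 0)} = N)"

definition hall_g :: "'k::field itself \<Rightarrow> nat list \<Rightarrow> nat list \<Rightarrow> nat list \<Rightarrow> nat" where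
  "hall_g _ lam mu nu = card {N :: (nat \<Rightarrow> 'k) set. subobj_iso lam N nu \<and> quot_iso lam N mu}"

definition exact4 :: "nat list \<Rightarrow> nat list \<Rightarrow> nat list \<Rightarrow> nat list \<Rightarrow>
    (nat \<Rightarrow> nat \<Rightarrow> 'k::field) \<Rightarrow> (nat \<Rightarrow> nat \<Rightarrow> 'k) \<Rightarrow> (nat \<Rightarrow> nat \<Rightarrow> 'k) \<Rightarrow> bool" where
  "exact4 al mu lam be f g h \<longleftrightarrow>
     inj_on (mv (sum_list al) f) (vecs (sum_list al)) \<and>
     mv (sum_list al) f ` vecs (sum_list al) =
        {v \<in> vecs (sum_list mu). mv (sum_list mu) g v = (\<lambda>_. 0)} \<and>
     mv (sum_list mu) g ` vecs (sum_list mu) =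
        {v \<in> vecs (sum_list lam). mv (sum_list lam) h v = (\<lambda>_. 0)} \<and>
     mv (sum_list lam) h ` vecs (sum_list lam) = vecs (sum_list be)"

definition hall_gamma :: "'k::field itself \<Rightarrow> nat list \<Rightarrow> nat list \<Rightarrow> nat list \<Rightarrow> nat list \<Rightarrow> real" where
  "hall_gamma K lam mu al be =
     real (card {(f, g, h). f \<in> (homs al mu :: (nat \<Rightarrow> nat \<Rightarrow> 'k) set) \<and> g \<in> homs mu lam \<and>
                 h \<in> homs lam be \<and> exact4 al mu lam be f g h})
     / (real (a_num K lam) * real (a_num K mu))"

text \<open>A (unital associative) C-algebra is represented as a ring 'a together with a
  unital ring homomorphism sc : complex -> 'a landing in the centre.  DH_rep K sc Z says
  that the family Z n lam (n integer, lam a partition) satisfies the defining relations of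
  DH_cl (for k = the finite field K).  An identity holds in DH_cl iff it holds for every
  such family in every C-algebra (universal property of a presented algebra).\<close>
definition DH_rep :: "'k::{field,finite} itself \<Rightarrow> (complex \<Rightarrow> 'a::ring_1) \<Rightarrow> (int \<Rightarrow> nat list \<Rightarrow> 'a) \<Rightarrow> bool" where
  "DH_rep K sc Z \<longleftrightarrow>
     (\<forall>c d. sc (c + d) = sc c + sc d) \<and> (\<forall>c d. sc (c * d) = sc c * sc d) \<and> sc 1 = 1 \<and>
     (\<forall>c x. sc c * x = x * sc c) \<and>
     (\<forall>n lam mu. is_partition lam \<longrightarrow> is_partition mu \<longrightarrow>
        Z n lam * Z n mu =
          (\<Sum>nu\<in>partitions_of (sum_list lam + sum_list mu).
              sc (of_nat (hall_g K nu lam mu)) * Z n nu)) \<and>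
     (\<forall>n lam mu. is_partition lam \<longrightarrow> is_partition mu \<longrightarrow>
        Z n lam * Z (n + 1) mu =
          (\<Sum>al\<in>(\<Union>i\<le>sum_list mu. partitions_of i).
             \<Sum>be\<in>(\<Union>j\<le>sum_list lam. partitions_of j).
               sc (of_real (hall_gamma K lam mu al be)) * (Z (n + 1) al * Z n be))) \<and>
     (\<forall>n m lam mu. is_partition lam \<longrightarrow> is_partition mu \<longrightarrow> n - m < -1 \<longrightarrow>
        Z n lam * Z m mu = Z m mu * Z n lam) \<and>
     (\<forall>n. Z n [] = 1)"

definition qpoch :: "complex \<Rightarrow> nat \<Rightarrow> complex" where
  "qpoch q m = (\<Prod>i=1..m. 1 - q ^ i)"

definition b_elt :: "'k::{field,finite} itself \<Rightarrow> (complex \<Rightarrow> 'a::ring_1) \<Rightarrow> (int \<Rightarrow> nat list \<Rightarrow> 'a) \<Rightarrow> int \<Rightarrow> 'a" where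
  "b_elt K sc Z n =
     (if n = 0 then 1
      else if n > 0 then
        (\<Sum>lam\<in>partitions_of (nat n). sc (qpoch (of_nat (card (UNIV :: 'k set))) (length lam - 1)) * Z 0 lam)
      else
        (\<Sum>lam\<in>partitions_of (nat (- n)). sc (qpoch (of_nat (card (UNIV :: 'k set))) (length lam - 1)) * Z 1 lam))"

end

theory Submission
  imports Defs "HOL-Library.Function_Algebras" "HOL-Library.FuncSet" "HOL-Library.Cardinality"
    "HOL-Library.Multiset" "HOL-Library.Product_Plus"
begin

text \<open>
  Write \<open>\<phi>(\<lambda>) = (q;q)\<close> with index \<open>\<ell>(\<lambda>) - 1\<close>.  Inside one degree the generators commute because
  transposition, followed by reversing each Jordan block, is a duality fixing every \<open>I\<^sub>\<lambda>\<close>, so the Hall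
  numbers are symmetric.  For the commutator, the coefficient of \<open>Z\<^sup>[\<^sup>1\<^sup>]\<^sub>\<alpha> Z\<^sup>[\<^sup>0\<^sup>]\<^sub>\<beta>\<close> counts four-term exact
  sequences weighted by \<open>\<phi>(\<lambda>) \<phi>(\<mu>) / (a\<^sub>\<lambda> a\<^sub>\<mu>)\<close>.  Fixing \<open>\<mu>\<close> and \<open>I\<^sub>\<alpha> \<rightarrow> I\<^sub>\<mu>\<close> with cokernel \<open>D\<close>, the
  sum over \<open>\<lambda>\<close> runs over extensions of \<open>I\<^sub>\<beta>\<close> by \<open>D\<close>, that is, over all off-diagonal blocks \<open>C\<close> of
  matrices with diagonal blocks \<open>D\<close> and \<open>J\<^sub>\<beta>\<close>.  The nullity of such a matrix depends only on
  \<open>ker J\<^sub>\<beta> \<rightarrow> coker D\<close>, and randomising \<open>C\<close> one column at a time multiplies the weighted sum by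
  \<open>1 - q\<^sup>r\<close>, where \<open>r\<close> is the number of columns already treated; the first factor vanishes.  By duality
  only \<open>\<alpha> = \<beta> = \<emptyset>\<close> and the reordered product survive.  The former contributes the sum of
  \<open>\<phi>(\<lambda>)\<^sup>2 / a\<^sub>\<lambda>\<close>, evaluated through the recursion for the mass of the partitions of given size and
  length that results from splitting off a simple submodule.
\<close>

section \<open>Matrices and short exact sequences\<close>

text \<open>The passage to matrices rests on a torsor count: an isomorphism from \<open>X\<close>
  onto a block matrix is the same as a short exact sequence together with a retraction, and every
  sequence has q^(de) retractions. A sum over extensions with weights \<open>1/a_num\<close> is
  therefore the mean over a uniformly random block \<open>C\<close>. The factor 1 - q^r is the mean
  of a two-point distribution. If the kernel found so far has dimension t, a random new column
  enlarges it with probability q^(r-t), and then the weight gains the factor 1 - q^t; otherwise it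
  stays the same. Since the weight has index length minus one, this needs t \<ge> 1 from the start,
  so the cokernel \<open>D\<close> must be nonzero: |\<alpha>| < |\<mu>|. Cancellation needs at
  least one column, so \<beta> must be nonempty. The dual statement covers |\<beta>| < |\<lambda>|
  with \<alpha> nonempty. What escapes both is \<alpha> and \<beta> empty, or both of full size; the
  latter terms form the reordered product.\<close>

type_synonym 'k mat = "nat \<Rightarrow> nat \<Rightarrow> 'k"
type_synonym 'k vec = "nat \<Rightarrow> 'k"

section \<open>Matrix and vector algebra with zero padding\<close>

definition mm :: "nat \<Rightarrow> 'k::field mat \<Rightarrow> 'k mat \<Rightarrow> 'k mat" where
  "mm n A B = (\<lambda>i j. \<Sum>k<n. A i k * B k j)"

text \<open>Zero padding makes \<open>idm d\<close> also the inclusion of the first d coordinates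
  into a larger space and the truncation onto them; block matrices use it in both roles.\<close>

definition idm :: "nat \<Rightarrow> 'k::field mat" where
  "idm n = (\<lambda>i j. if i = j \<and> i < n then 1 else 0)"

definition unitv :: "nat \<Rightarrow> 'k::field vec" where
  "unitv j = (\<lambda>i. if i = j then 1 else 0)"

lemma mm_assoc: "mm n (mm m A B) C = mm m A (mm n B C)"
  unfolding mm_def
  by (auto simp: fun_eq_iff sum_distrib_left sum_distrib_right mult.assoc intro: sum.swap)

lemma mv_mm: "mv n (mm m A B) v = mv m A (mv n B v)"
  unfolding mm_def mv_def
  by (auto simp: fun_eq_iff sum_distrib_left sum_distrib_right mult.assoc intro: sum.swap)

lemma mm_add_left: "mm n (A + B) C = mm n A C + mm n B C"
  by (auto simp: mm_def fun_eq_iff sum.distrib algebra_simps)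

lemma mm_add_right: "mm n A (B + C) = mm n A B + mm n A C"
  by (auto simp: mm_def fun_eq_iff sum.distrib algebra_simps)

lemma mm_diff_left: "mm n (A - B) C = mm n A C - mm n B C"
  by (auto simp: mm_def fun_eq_iff sum_subtractf algebra_simps)

lemma mm_diff_right: "mm n A (B - C) = mm n A B - mm n A C"
  by (auto simp: mm_def fun_eq_iff sum_subtractf algebra_simps)

lemma mm_zero_left [simp]: "mm n 0 C = 0"
  by (auto simp: mm_def fun_eq_iff)

lemma mm_zero_right [simp]: "mm n C 0 = 0"
  by (auto simp: mm_def fun_eq_iff)

lemma mv_add: "mv n A (u + v) = mv n A u + mv n A v"
  by (auto simp: mv_def fun_eq_iff sum.distrib algebra_simps)

lemma mv_diff: "mv n A (u - v) = mv n A u - mv n A v"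
  by (auto simp: mv_def fun_eq_iff sum_subtractf algebra_simps)

lemma mv_scale: "mv n A (\<lambda>i. c * v i) = (\<lambda>i. c * mv n A v i)"
  by (auto simp: mv_def fun_eq_iff sum_distrib_left algebra_simps)

lemma mv_zero [simp]: "mv n A 0 = 0"
  by (auto simp: mv_def fun_eq_iff)

lemma mv_zero_mat [simp]: "mv n 0 v = 0"
  by (auto simp: mv_def fun_eq_iff)

lemma mv_add_mat: "mv n (A + B) v = mv n A v + mv n B v"
  by (auto simp: mv_def fun_eq_iff sum.distrib algebra_simps)

lemma mv_diff_mat: "mv n (A - B) v = mv n A v - mv n B v"
  by (auto simp: mv_def fun_eq_iff sum_subtractf algebra_simps)

lemma lambda_zero [simp]: "(\<lambda>_. 0) = 0"
  by (simp add: zero_fun_def)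

lemma vecs_add [intro]: "u \<in> vecs n \<Longrightarrow> v \<in> vecs n \<Longrightarrow> u + v \<in> vecs n"
  by (auto simp: vecs_def)

lemma vecs_diff [intro]: "u \<in> vecs n \<Longrightarrow> v \<in> vecs n \<Longrightarrow> u - v \<in> vecs n"
  by (auto simp: vecs_def)

lemma vecs_scale [intro]: "v \<in> vecs n \<Longrightarrow> (\<lambda>i. c * v i) \<in> vecs n"
  by (auto simp: vecs_def)

lemma vecs_zero [simp]: "0 \<in> vecs n"
  by (auto simp: vecs_def)

lemma vecs_unitv [simp]: "j < n \<Longrightarrow> unitv j \<in> vecs n"
  by (auto simp: vecs_def unitv_def)

lemma vecs_mono: "m \<le> n \<Longrightarrow> vecs m \<subseteq> vecs n"
  by (auto simp: vecs_def)

lemma vecs_0: "vecs 0 = {0}"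
  by (auto simp: vecs_def fun_eq_iff)

lemma mats_add [intro]: "A \<in> mats b a \<Longrightarrow> B \<in> mats b a \<Longrightarrow> A + B \<in> mats b a"
  by (auto simp: mats_def)

lemma mats_diff [intro]: "A \<in> mats b a \<Longrightarrow> B \<in> mats b a \<Longrightarrow> A - B \<in> mats b a"
  by (auto simp: mats_def)

lemma mats_zero [simp]: "0 \<in> mats b a"
  by (auto simp: mats_def)

lemma mats_idm [simp, intro]: "idm n \<in> mats n n"
  by (auto simp: mats_def idm_def)

lemma mats_mm [intro]: "A \<in> mats b n \<Longrightarrow> B \<in> mats m a \<Longrightarrow> mm k A B \<in> mats b a"
  by (auto simp: mats_def mm_def)

lemma mats_0_left: "mats 0 n = {0}"
  by (auto simp: mats_def fun_eq_iff)

lemma mats_0_right: "mats n 0 = {0}"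
  by (auto simp: mats_def fun_eq_iff)

lemma mv_vecs [intro]: "A \<in> mats b a \<Longrightarrow> mv k A v \<in> vecs b"
  by (auto simp: mats_def mv_def vecs_def)

lemma mv_idm [simp]:
  assumes "v \<in> vecs n"
  shows "mv n (idm n) v = v"
proof
  fix i
  have "mv n (idm n) v i = (\<Sum>j<n. if j = i then v j else 0)"
    unfolding mv_def idm_def by (rule sum.cong) auto
  then show "mv n (idm n) v i = v i"
    using assms by (auto simp: vecs_def)
qed

lemma mm_idm_right [simp]: "A \<in> mats b a \<Longrightarrow> mm a A (idm a) = A"
proof (intro ext)
  fix i j assume A: "A \<in> mats b a"
  have "mm a A (idm a) i j = (\<Sum>k<a. if k = j then A i k else 0)"
    unfolding mm_def idm_def by (rule sum.cong) auto
  then show "mm a A (idm a) i j = A i j"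
    using A by (auto simp: mats_def)
qed

lemma mm_idm_left [simp]: "A \<in> mats b a \<Longrightarrow> mm b (idm b) A = A"
proof (intro ext)
  fix i j assume A: "A \<in> mats b a"
  have "mm b (idm b) A i j = (\<Sum>k<b. if k = i then A k j else 0)"
    unfolding mm_def idm_def by (rule sum.cong) auto
  then show "mm b (idm b) A i j = A i j"
    using A by (auto simp: mats_def)
qed

lemma mv_unitv: "j < a \<Longrightarrow> mv a A (unitv j) = (\<lambda>i. A i j)"
  by (auto simp: mv_def unitv_def fun_eq_iff if_distrib cong: if_cong)

lemma mats_eqI:
  assumes "A \<in> mats b a" "B \<in> mats b a" "\<And>v. v \<in> vecs a \<Longrightarrow> mv a A v = mv a B v"
  shows "A = B"
proof (intro ext)
  fix i j
  show "A i j = B i j"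
  proof (cases "j < a")
    case True
    then show ?thesis using assms(3)[of "unitv j"] by (simp add: mv_unitv fun_eq_iff)
  next
    case False
    then show ?thesis using assms(1,2) by (simp add: mats_def)
  qed
qed

lemma mats_eq_unitI:
  assumes "A \<in> mats b a" "B \<in> mats b a" "\<And>j. j < a \<Longrightarrow> mv a A (unitv j) = mv a B (unitv j)"
  shows "A = B"
proof (intro ext)
  fix i j
  show "A i j = B i j"
  proof (cases "j < a")
    case True
    then show ?thesis using assms(3)[of j] by (simp add: mv_unitv fun_eq_iff)
  next
    case False
    then show ?thesis using assms(1,2) by (simp add: mats_def)
  qed
qed

definition cols :: "nat \<Rightarrow> (nat \<Rightarrow> 'k::field vec) \<Rightarrow> 'k mat" where
  "cols a c = (\<lambda>i j. if j < a then c j i else 0)"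

lemma mats_cols: "(\<And>j. j < a \<Longrightarrow> c j \<in> vecs b) \<Longrightarrow> cols a c \<in> mats b a"
  by (auto simp: mats_def cols_def vecs_def)

lemma mv_cols_unitv: "j < a \<Longrightarrow> mv a (cols a c) (unitv j) = c j"
  by (simp add: mv_unitv cols_def)

section \<open>Cardinalities over the finite field\<close>

lemma finite_vecs [simp, intro]: "finite (vecs n :: 'k::{field,finite} vec set)"
  and card_vecs: "card (vecs n :: 'k vec set) = CARD('k) ^ n"
proof -
  have bij: "bij_betw (\<lambda>f i. if i < n then f i else 0) (PiE {..<n} (\<lambda>_. UNIV :: 'k set)) (vecs n)"
    by (rule bij_betw_byWitness[where f' = "\<lambda>f. restrict f {..<n}"])
       (auto simp: vecs_def fun_eq_iff PiE_def extensional_def)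
  show "finite (vecs n :: 'k vec set)"
    using bij_betw_finite[OF bij] by (simp add: finite_PiE)
  show "card (vecs n :: 'k vec set) = CARD('k) ^ n"
    using bij_betw_same_card[OF bij] by (simp add: card_PiE)
qed

lemma finite_mats [simp, intro]: "finite (mats b a :: 'k::{field,finite} mat set)"
  and card_mats: "card (mats b a :: 'k mat set) = CARD('k) ^ (b * a)"
proof -
  have bij: "bij_betw (\<lambda>c i j. if j < a then c j i else 0) (PiE {..<a} (\<lambda>_. vecs b :: 'k vec set)) (mats b a)"
    by (rule bij_betw_byWitness[where f' = "\<lambda>M. restrict (\<lambda>j i. M i j) {..<a}"])
       (auto simp: vecs_def mats_def fun_eq_iff PiE_def extensional_def Pi_def)
  show "finite (mats b a :: 'k mat set)"
    using bij_betw_finite[OF bij] by (simp add: finite_PiE)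
  show "card (mats b a :: 'k mat set) = CARD('k) ^ (b * a)"
    using bij_betw_same_card[OF bij] by (simp add: card_PiE card_vecs power_mult)
qed

lemma q_ge_2: "2 \<le> CARD('k::{field,finite})"
proof -
  have "card {0, 1 :: 'k} \<le> CARD('k)" by (rule card_mono) auto
  then show ?thesis by simp
qed

text \<open>
  Exactness of \<open>0 \<rightarrow> k\<^sup>d \<rightarrow> k\<^sup>n \<rightarrow> k\<^sup>e \<rightarrow> 0\<close> witnessed by a retraction \<open>p\<close> of \<open>f\<close> and a section \<open>s\<close> of
  \<open>h\<close>: in this form it consists of matrix identities and is visibly stable under transposition.
\<close>
definition splits :: "nat \<Rightarrow> nat \<Rightarrow> nat \<Rightarrow> 'k::field mat \<Rightarrow> 'k mat \<Rightarrow> 'k mat \<Rightarrow> 'k mat \<Rightarrow> bool" where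
  "splits d n e f h p s \<longleftrightarrow> f \<in> mats n d \<and> h \<in> mats e n \<and> p \<in> mats d n \<and> s \<in> mats n e \<and>
     mm n p f = idm d \<and> mm n h s = idm e \<and> mm d f p + mm e s h = idm n"

definition ses :: "nat \<Rightarrow> nat \<Rightarrow> nat \<Rightarrow> 'k::field mat \<Rightarrow> 'k mat \<Rightarrow> bool" where
  "ses d n e f h \<longleftrightarrow> f \<in> mats n d \<and> h \<in> mats e n \<and> inj_on (mv d f) (vecs d) \<and>
     mv d f ` vecs d = {v \<in> vecs n. mv n h v = 0} \<and> mv n h ` vecs n = vecs e"

lemma splitsD:
  assumes "splits d n e f h p s"
  shows "f \<in> mats n d" "h \<in> mats e n" "p \<in> mats d n" "s \<in> mats n e"
    "mm n p f = idm d" "mm n h s = idm e" "mm d f p + mm e s h = idm n"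
  using assms by (auto simp: splits_def)

lemma sesD:
  assumes "ses d n e f h"
  shows "f \<in> mats n d" "h \<in> mats e n" "inj_on (mv d f) (vecs d)"
    "mv d f ` vecs d = {v \<in> vecs n. mv n h v = 0}" "mv n h ` vecs n = vecs e"
  using assms by (auto simp: ses_def)

text \<open>Multiplying \<open>mm d f p + mm e s h = idm n\<close> by h on the left and f on the
  right, and using that p f and h s are identities, gives h f + h f = h f. The same sandwich between
  p and s kills p s.\<close>

lemma splits_zero:
  assumes "splits d n e f h p s"
  shows "mm n h f = 0" "mm n p s = 0"
proof -
  note S = splitsD[OF assms]
  have "mm n (mm n h (mm d f p) + mm n h (mm e s h)) f = mm n h f"
    using S by (simp flip: mm_add_right)
  moreover have "mm n h (mm d f p) = mm d (mm n h f) p" "mm n h (mm e s h) = h"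
    using S by (simp_all add: mm_assoc[symmetric])
  moreover have "mm n (mm d (mm n h f) p) f = mm n h f"
    using S by (metis mats_mm mm_assoc mm_idm_right)
  ultimately have "mm n h f + mm n h f = mm n h f" by (simp add: mm_add_left)
  then show "mm n h f = 0" by simp
  have "mm n (mm n p (mm d f p) + mm n p (mm e s h)) s = mm n p s"
    using S by (simp flip: mm_add_right)
  moreover have "mm n p (mm d f p) = p" "mm n p (mm e s h) = mm e (mm n p s) h"
    using S by (simp_all add: mm_assoc[symmetric])
  moreover have "mm n (mm e (mm n p s) h) s = mm n p s"
    using S by (metis mats_mm mm_assoc mm_idm_right)
  ultimately have "mm n p s + mm n p s = mm n p s" by (simp add: mm_add_left)
  then show "mm n p s = 0" by simp
qed

lemma splits_ses:
  assumes "splits d n e f h p s"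
  shows "ses d n e f h"
proof -
  note S = splitsD[OF assms]
  have hf: "mm n h f = 0" using splits_zero[OF assms] by simp
  have "mv n p (mv d f v) = v" if "v \<in> vecs d" for v
    using S that by (simp add: mv_mm[symmetric])
  then have "inj_on (mv d f) (vecs d)" by (intro inj_on_inverseI)
  moreover have "mv n h (mv e s v) = v" if "v \<in> vecs e" for v
    using S that by (simp add: mv_mm[symmetric])
  then have "vecs e \<subseteq> mv n h ` vecs n" by (metis S image_eqI mv_vecs subsetI)
  then have "mv n h ` vecs n = vecs e" using S by auto
  moreover have "mv d f v \<in> {v \<in> vecs n. mv n h v = 0}" for v
    using S hf by (auto simp: mv_mm[symmetric])
  moreover have "v \<in> mv d f ` vecs d" if "v \<in> vecs n" "mv n h v = 0" for v
  proof -
    have "v = mv n (mm d f p + mm e s h) v" using that S by simp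
    then have "v = mv d f (mv n p v)" using that by (simp add: mv_add_mat mv_mm)
    then show ?thesis using S by blast
  qed
  ultimately show ?thesis using S unfolding ses_def by blast
qed

lemma section_exists:
  assumes h: "h \<in> mats e n" and surj: "mv n h ` vecs n = vecs e"
  obtains s where "s \<in> mats n e" "mm n h s = idm e"
proof -
  have "\<forall>j. \<exists>v. j < e \<longrightarrow> v \<in> vecs n \<and> mv n h v = unitv j"
    by (metis surj imageE vecs_unitv)
  then obtain c where c: "\<And>j. j < e \<Longrightarrow> c j \<in> vecs n \<and> mv n h (c j) = unitv j" by metis
  let ?s = "cols e c"
  have s: "?s \<in> mats n e" using c by (intro mats_cols) auto
  have "mm n h ?s = idm e"
  proof (rule mats_eq_unitI)
    fix j assume "j < e"
    then show "mv e (mm n h ?s) (unitv j) = mv e (idm e) (unitv j)"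
      using c by (simp add: mv_mm mv_cols_unitv)
  qed (use h s in auto)
  then show ?thesis using that s by blast
qed

text \<open>Split h on unit vectors. Then \<open>idm n - mm e s h\<close> maps into the kernel of h,
  which is the image of f, so its columns lift through f and form the retraction.\<close>

lemma ses_splits:
  assumes "ses d n e f h"
  obtains p s where "splits d n e f h p s"
proof -
  note S = sesD[OF assms]
  obtain s where s: "s \<in> mats n e" "mm n h s = idm e" using section_exists S by metis
  have "\<forall>j. \<exists>w. j < n \<longrightarrow> w \<in> vecs d \<and> mv d f w = unitv j - mv n (mm e s h) (unitv j)"
  proof (intro allI)
    fix j
    show "\<exists>w. j < n \<longrightarrow> w \<in> vecs d \<and> mv d f w = unitv j - mv n (mm e s h) (unitv j)"
    proof (cases "j < n")
      case True
      let ?v = "unitv j - mv n (mm e s h) (unitv j)"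
      have "mv n h ?v = mv n h (unitv j) - mv e (mm n h s) (mv n h (unitv j))"
        by (simp add: mv_diff mv_mm)
      also have "\<dots> = 0" using s S by (simp add: mv_vecs)
      finally have "?v \<in> {v \<in> vecs n. mv n h v = 0}"
        using True mats_mm[OF s(1) S(2), of e] by auto
      then show ?thesis using S by (metis (no_types, lifting) imageE)
    qed simp
  qed
  then obtain c where c: "\<And>j. j < n \<Longrightarrow> c j \<in> vecs d \<and> mv d f (c j) = unitv j - mv n (mm e s h) (unitv j)"
    by metis
  let ?p = "cols n c"
  have p: "?p \<in> mats d n" using c by (intro mats_cols) auto
  have "mm d f ?p = idm n - mm e s h"
  proof (rule mats_eq_unitI)
    fix j assume "j < n"
    then show "mv n (mm d f ?p) (unitv j) = mv n (idm n - mm e s h) (unitv j)"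
      using c by (simp add: mv_mm mv_cols_unitv mv_diff_mat)
  qed (use S p s in auto)
  then have fp: "mm d f ?p + mm e s h = idm n" by simp
  have "mm n ?p f = idm d"
  proof (rule mats_eqI)
    fix v :: "'a vec" assume v: "v \<in> vecs d"
    have 1: "mv d f v \<in> {v \<in> vecs n. mv n h v = 0}" using S v by blast
    have "mv d f v = mv n (mm d f ?p + mm e s h) (mv d f v)" using 1 fp by simp
    also have "\<dots> = mv d f (mv n ?p (mv d f v))" using 1 by (simp add: mv_add_mat mv_mm)
    finally have "v = mv n ?p (mv d f v)"
      using S v p by (auto dest!: inj_onD[where y = "mv n ?p (mv d f v)"])
    then show "mv d (mm n ?p f) v = mv d (idm d) v" using v by (simp add: mv_mm)
  qed (use S p in auto)
  then have "splits d n e f h ?p s" using S s p fp unfolding splits_def by blast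
  then show ?thesis using that by blast
qed

text \<open>Every nonempty fibre of an additive map is a translate of the kernel. This plays the
  role of rank-nullity throughout: dimensions are read off from cardinalities.\<close>

lemma card_image_times_kernel:
  fixes F :: "'a::ab_group_add \<Rightarrow> 'b::ab_group_add"
  assumes "finite A" and add: "\<And>x y. x \<in> A \<Longrightarrow> y \<in> A \<Longrightarrow> x + y \<in> A"
    and diff: "\<And>x y. x \<in> A \<Longrightarrow> y \<in> A \<Longrightarrow> x - y \<in> A"
    and F: "\<And>x y. x \<in> A \<Longrightarrow> y \<in> A \<Longrightarrow> F (x + y) = F x + F y"
  shows "card A = card (F ` A) * card {x \<in> A. F x = 0}"
proof -
  have Fd: "F (x - y) = F x - F y" if "x \<in> A" "y \<in> A" for x y
    using F[of "x - y" y] diff that by (simp add: eq_diff_eq)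
  have fib: "card {x \<in> A. F x = z} = card {x \<in> A. F x = 0}" if z: "z \<in> F ` A" for z
  proof -
    obtain a where a: "a \<in> A" "F a = z" using z by auto
    have "bij_betw (\<lambda>x. x - a) {x \<in> A. F x = z} {x \<in> A. F x = 0}"
      by (rule bij_betw_byWitness[where f' = "\<lambda>x. x + a"]) (use a add diff F Fd in auto)
    then show ?thesis by (rule bij_betw_same_card)
  qed
  have "card A = card (\<Union>z\<in>F ` A. {x \<in> A. F x = z})"
    by (rule arg_cong[where f = card]) auto
  also have "\<dots> = (\<Sum>z\<in>F ` A. card {x \<in> A. F x = z})"
    using assms(1) by (intro card_UN_disjoint) auto
  also have "\<dots> = card (F ` A) * card {x \<in> A. F x = 0}"
    using fib by simp
  finally show ?thesis .
qed

section \<open>Invertible matrices and changes of splitting\<close>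

definition minv :: "nat \<Rightarrow> 'k::field mat \<Rightarrow> 'k mat \<Rightarrow> bool" where
  "minv n P Q \<longleftrightarrow> P \<in> mats n n \<and> Q \<in> mats n n \<and> mm n P Q = idm n \<and> mm n Q P = idm n"

lemma minvD:
  assumes "minv n P Q"
  shows "P \<in> mats n n" "Q \<in> mats n n" "mm n P Q = idm n" "mm n Q P = idm n"
  using assms by (auto simp: minv_def)

lemma minv_sym: "minv n P Q \<Longrightarrow> minv n Q P"
  by (auto simp: minv_def)

lemma idm_idm [simp]: "mm n (idm n) (idm n) = idm n"
  by (rule mm_idm_right) (rule mats_idm)

lemma minv_idm: "minv n (idm n) (idm n)"
  by (auto simp: minv_def)

lemma cancel_left:
  assumes "mm n P Q = idm m" "A \<in> mats m a"
  shows "mm n P (mm m Q A) = A"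
  using assms by (simp flip: mm_assoc)

lemma cancel_right:
  assumes "mm n P Q = idm m" "A \<in> mats a m"
  shows "mm n (mm m A P) Q = A"
  using assms by (simp add: mm_assoc)

lemma minv_unique: "minv n P Q \<Longrightarrow> minv n P Q' \<Longrightarrow> Q = Q'"
  by (metis minvD cancel_left mm_idm_right)

lemma minv_mult:
  assumes "minv n P Q" "minv n P' Q'"
  shows "minv n (mm n P P') (mm n Q' Q)"
proof -
  note A = minvD[OF assms(1)] and B = minvD[OF assms(2)]
  have "mm n (mm n P P') (mm n Q' Q) = mm n P (mm n (mm n P' Q') Q)" by (simp add: mm_assoc)
  moreover have "mm n (mm n Q' Q) (mm n P P') = mm n Q' (mm n (mm n Q P) P')" by (simp add: mm_assoc)
  ultimately show ?thesis using A B by (simp add: minv_def mats_mm)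
qed

lemma minv_bij:
  assumes "minv n P Q"
  shows "bij_betw (mv n P) (vecs n) (vecs n)"
proof -
  note A = minvD[OF assms]
  show ?thesis
  proof (rule bij_betw_byWitness[where f' = "mv n Q"])
    show "\<forall>a\<in>vecs n. mv n Q (mv n P a) = a" "\<forall>a\<in>vecs n. mv n P (mv n Q a) = a"
      using A by (simp_all flip: mv_mm)
  qed (use A in auto)
qed

text \<open>A bijection is a short exact sequence with zero quotient, and the retraction of its
  splitting is the inverse.\<close>

lemma bij_minv:
  assumes P: "P \<in> mats n n" and bij: "bij_betw (mv n P) (vecs n) (vecs n)"
  obtains Q where "minv n P Q"
proof -
  have "ses n n 0 P 0"
    using assms by (auto simp: ses_def vecs_0 bij_betw_def)
  then obtain p s where "splits n n 0 P 0 p s" by (rule ses_splits)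
  note S = splitsD[OF this]
  have "minv n P p" using S by (simp add: minv_def)
  then show ?thesis using that by blast
qed

lemma inj_minv:
  fixes P :: "'k::{field,finite} mat"
  assumes P: "P \<in> mats n n" and inj: "inj_on (mv n P) (vecs n)"
  obtains Q where "minv n P Q"
proof -
  have "mv n P ` vecs n \<subseteq> vecs n" using P by auto
  then have "mv n P ` vecs n = vecs n"
    using inj by (simp add: endo_inj_surj)
  then show ?thesis using bij_minv[OF P] inj that by (auto simp: bij_betw_def)
qed

lemma splits_transport:
  assumes "splits d n e f h p s" "minv n g k"
  shows "splits d n e (mm n g f) (mm n h k) (mm n p k) (mm n g s)"
proof -
  note S = splitsD[OF assms(1)] and G = minvD[OF assms(2)]
  have 1: "mm n (mm n p k) (mm n g f) = mm n p (mm n (mm n k g) f)" by (simp add: mm_assoc)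
  have 2: "mm n (mm n h k) (mm n g s) = mm n h (mm n (mm n k g) s)" by (simp add: mm_assoc)
  have "mm d (mm n g f) (mm n p k) + mm e (mm n g s) (mm n h k)
      = mm n g (mm n (mm d f p + mm e s h) k)"
    by (simp add: mm_assoc mm_add_left mm_add_right)
  with 1 2 show ?thesis using S G by (auto simp: splits_def mats_mm)
qed

definition inc :: "nat \<Rightarrow> nat \<Rightarrow> 'k::field mat" where
  "inc d e = (\<lambda>i j. if j < e \<and> i = d + j then 1 else 0)"

definition prj :: "nat \<Rightarrow> nat \<Rightarrow> 'k::field mat" where
  "prj d e = (\<lambda>i j. if i < e \<and> j = d + i then 1 else 0)"

lemma sum_if_conj:
  assumes "finite A"
  shows "(\<Sum>k\<in>A. (if P \<and> k = a then f k else 0)) = (if P \<and> a \<in> A then f a else (0::'a::comm_monoid_add))"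
  using assms by (cases P) auto

lemma std_splits: "splits d (d + e) e (idm d) (prj d e) (idm d) (inc d e :: 'k::field mat)"
proof -
  have m: "(idm d :: 'k mat) \<in> mats (d + e) d" "(idm d :: 'k mat) \<in> mats d (d + e)"
    "(prj d e :: 'k mat) \<in> mats e (d + e)" "(inc d e :: 'k mat) \<in> mats (d + e) e"
    by (auto simp: mats_def idm_def inc_def prj_def)
  have 1: "mm (d + e) (idm d) (idm d) = (idm d :: 'k mat)"
  proof (intro ext)
    fix i j
    have "mm (d + e) (idm d) (idm d) i j = (\<Sum>k<d+e. if (i = j \<and> i < d) \<and> k = i then 1 else (0::'k))"
      unfolding mm_def idm_def by (rule sum.cong) auto
    then show "mm (d + e) (idm d) (idm d) i j = (idm d :: 'k mat) i j"
      by (subst (asm) sum_if_conj) (auto simp: idm_def)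
  qed
  have 2: "mm (d + e) (prj d e) (inc d e) = (idm e :: 'k mat)"
  proof (intro ext)
    fix i j
    have "mm (d + e) (prj d e) (inc d e) i j = (\<Sum>k<d+e. if (i = j \<and> i < e) \<and> k = d + i then 1 else (0::'k))"
      unfolding mm_def prj_def inc_def by (rule sum.cong) auto
    then show "mm (d + e) (prj d e) (inc d e) i j = (idm e :: 'k mat) i j"
      by (subst (asm) sum_if_conj) (auto simp: idm_def)
  qed
  have 3: "mm e (inc d e) (prj d e) i j = (if i = j \<and> d \<le> i \<and> i < d + e then 1 else (0::'k))" for i j
  proof -
    have "mm e (inc d e) (prj d e) i j = (\<Sum>k<e. if (i = j \<and> d \<le> i \<and> i < d + e) \<and> k = i - d then 1 else (0::'k))"
      unfolding mm_def prj_def inc_def by (rule sum.cong) auto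
    then show ?thesis
      by (subst (asm) sum_if_conj) auto
  qed
  have "mm d (idm d) (idm d) = (idm d :: 'k mat)" by simp
  then have "mm d (idm d) (idm d) + mm e (inc d e) (prj d e) = (idm (d + e) :: 'k mat)"
    by (auto simp: fun_eq_iff 3 idm_def)
  then show ?thesis using m 1 2 by (simp add: splits_def)
qed

text \<open>Basis completion by induction on the codimension: while the image is proper, a vector
  outside it is appended as a further column; once the image is everything, counting gives d = n and
  f is itself invertible.\<close>

lemma extend_injective:
  fixes f :: "'k::{field,finite} mat"
  assumes "f \<in> mats n d" "inj_on (mv d f) (vecs d)"
  shows "d \<le> n \<and> (\<exists>g k. minv n g k \<and> (\<forall>j<d. mv n g (unitv j) = mv d f (unitv j)))"
  using assms
proof (induction "n - d" arbitrary: d f rule: less_induct)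
  case less
  have im: "mv d f ` vecs d \<subseteq> vecs n" using less.prems by auto
  have "CARD('k) ^ d \<le> CARD('k) ^ n"
    using card_mono[OF _ im] less.prems(2) by (simp add: card_image card_vecs)
  then have dn: "d \<le> n" using q_ge_2[where 'k = 'k] by simp
  show ?case
  proof (cases "mv d f ` vecs d = vecs n")
    case True
    then have "CARD('k) ^ d = CARD('k) ^ n"
      using less.prems(2) by (metis card_image card_vecs)
    then have "d = n" using q_ge_2[where 'k = 'k] by simp
    then show ?thesis using inj_minv less.prems by blast
  next
    case False
    then obtain v where v: "v \<in> vecs n" "v \<notin> mv d f ` vecs d" using im by blast
    define f' where "f' = (\<lambda>i j. if j = d then v i else f i j)"
    have f': "f' \<in> mats n (Suc d)"
      using less.prems(1) v(1) by (auto simp: f'_def mats_def vecs_def)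
    have mvf': "mv (Suc d) f' w = mv d f w + (\<lambda>i. w d * v i)" for w
      by (auto simp: mv_def f'_def fun_eq_iff)
    have inj: "inj_on (mv (Suc d) f') (vecs (Suc d))"
    proof (rule inj_onI)
      fix x y assume xy: "x \<in> vecs (Suc d)" "y \<in> vecs (Suc d)" "mv (Suc d) f' x = mv (Suc d) f' y"
      define z where "z = x - y"
      have z: "z \<in> vecs (Suc d)" "mv (Suc d) f' z = 0" using xy by (auto simp: z_def mv_diff)
      have zd: "z d = 0"
      proof (rule ccontr)
        assume nz: "z d \<noteq> 0"
        \<comment> \<open>Solving f' z = 0 for v gives the coefficients - z i / z d, which would put
          v into the image of f.\<close>
        let ?w = "\<lambda>i. if i < d then - z i / z d else 0"
        have "mv d f ?w = (\<lambda>i. - inverse (z d) * mv d f z i)"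
          by (auto simp: mv_def fun_eq_iff sum_distrib_left divide_inverse intro!: sum.cong)
        moreover have "mv d f z = (\<lambda>i. - z d * v i)"
          using z(2) by (simp add: mvf' fun_eq_iff add_eq_0_iff2)
        ultimately have "mv d f ?w = v" using nz by (simp add: fun_eq_iff)
        moreover have "?w \<in> vecs d" by (auto simp: vecs_def)
        ultimately show False using v by blast
      qed
      then have "z i = 0" if "d \<le> i" for i
        using z(1) that by (cases "i = d") (auto simp: vecs_def)
      then have "z \<in> vecs d" by (simp add: vecs_def)
      moreover have "mv d f z = mv d f 0" using z(2) zd by (simp add: mvf' fun_eq_iff)
      ultimately have "z = 0" using inj_onD[OF less.prems(2), of z 0] by simp
      then show "x = y" by (simp add: z_def)
    qed
    have "d < n"
    proof (rule ccontr)
      assume "\<not> d < n"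
      then have "d = n" using dn by simp
      then show False using False im endo_inj_surj[of "vecs n" "mv d f"] less.prems(2) by simp
    qed
    then obtain g k where g: "minv n g k" "\<forall>j<Suc d. mv n g (unitv j) = mv (Suc d) f' (unitv j)"
      using less.hyps[OF _ f' inj] by (metis diff_less_mono2 lessI)
    have "mv n g (unitv j) = mv d f (unitv j)" if "j < d" for j
      using g(2) that by (simp add: mvf' unitv_def fun_eq_iff)
    then show ?thesis using dn g(1) by blast
  qed
qed

lemma splits_of_injective:
  fixes f :: "'k::{field,finite} mat"
  assumes f: "f \<in> mats n d" and inj: "inj_on (mv d f) (vecs d)"
  obtains h p s where "d \<le> n" "splits d n (n - d) f h p s"
proof -
  obtain g k where g: "d \<le> n" "minv n g k" "\<forall>j<d. mv n g (unitv j) = mv d f (unitv j)"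
    using extend_injective[OF assms] by blast
  have "splits d n (n - d) (idm d) (prj d (n - d)) (idm d) (inc d (n - d) :: 'k mat)"
    using std_splits[of d "n - d"] g(1) by simp
  from splits_transport[OF this g(2)]
  have S: "splits d n (n - d) (mm n g (idm d)) (mm n (prj d (n - d)) k) (mm n (idm d) k) (mm n g (inc d (n - d)))" .
  have u: "mv d (idm d) (unitv j) = (unitv j :: 'k vec)" if "j < d" for j using that by simp
  have "mm n g (idm d) = f"
  proof (rule mats_eq_unitI)
    fix j assume "j < d"
    then show "mv d (mm n g (idm d)) (unitv j) = mv d f (unitv j)"
      using g(3) by (simp add: mv_mm)
  qed (use f splitsD[OF S] in auto)
  then show ?thesis using that S g(1) by simp
qed

text \<open>Subtracting f p' s from the section makes p' vanish on it, as the completeness relation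
  demands. A prescribed p' is wanted twice: to get a stable complement of a Jordan block, and to
  attach a given retraction to a sequence.\<close>

lemma splits_change_retraction:
  assumes "splits d n e f h p s" "p' \<in> mats d n" "mm n p' f = idm d"
  shows "splits d n e f h p' (s - mm d f (mm n p' s))"
proof -
  note S = splitsD[OF assms(1)] and Z = splits_zero[OF assms(1)]
  have sh: "mm e s h = idm n - mm d f p" using S(7) by (simp add: eq_diff_eq add.commute)
  have 1: "mm n h (s - mm d f (mm n p' s)) = idm e"
    using S Z by (simp add: mm_diff_right flip: mm_assoc)
  have "mm e (s - mm d f (mm n p' s)) h = mm e s h - mm d f (mm n p' (mm e s h))"
    by (simp add: mm_diff_left mm_assoc)
  also have "\<dots> = mm e s h - mm d f (mm n p' (idm n) - mm d (mm n p' f) p)"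
    unfolding sh by (simp add: mm_diff_right mm_assoc)
  also have "\<dots> = mm e s h - mm d f p' + mm d f p"
    using assms(2,3) S(3) by (simp add: mm_diff_right)
  finally have "mm d f p' + mm e (s - mm d f (mm n p' s)) h = mm d f p + mm e s h" by simp
  then show ?thesis using S assms 1 by (auto simp: splits_def)
qed

text \<open>The first matrix carries f' to f and s' to s, the second goes back: two decompositions
  of the same shape differ by an automorphism of the middle space.\<close>

lemma splits_minv:
  assumes "splits d n e f h p s" "splits d n e f' h' p' s'"
  shows "minv n (mm d f p' + mm e s h') (mm d f' p + mm e s' h)"
proof -
  note S = splitsD[OF assms(1)] splitsD[OF assms(2)]
  note Z = splits_zero[OF assms(1)] splits_zero[OF assms(2)]
  have *: "mm n (mm d f p' + mm e s h') (mm d f' p + mm e s' h) = mm d f p + mm e s h"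
    if "mm n p' f' = idm d" "mm n p' s' = 0" "mm n h' f' = 0" "mm n h' s' = idm e"
      "p \<in> mats d n" "h \<in> mats e n"
    for f p s h f' p' s' h' :: "'a mat"
  proof -
    have "mm n p' (mm d f' p) = p" "mm n p' (mm e s' h) = 0"
      "mm n h' (mm d f' p) = 0" "mm n h' (mm e s' h) = h"
      using that by (simp_all flip: mm_assoc)
    then show ?thesis by (simp add: mm_add_left mm_add_right mm_assoc)
  qed
  show ?thesis
    unfolding minv_def using S Z by (auto simp: * intro!: mats_add mats_mm)
qed

lemma splits_dim:
  fixes f :: "'k::{field,finite} mat"
  assumes "splits d n e f h p s"
  shows "n = d + e"
proof -
  note S = sesD[OF splits_ses[OF assms]]
  have "card (vecs n :: 'k vec set) = card (mv n h ` vecs n) * card {v \<in> vecs n. mv n h v = 0}"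
    by (rule card_image_times_kernel) (auto simp: mv_add)
  also have "\<dots> = CARD('k) ^ e * CARD('k) ^ d"
    using card_image[OF S(3)] by (simp add: S(4,5) card_vecs)
  finally have "CARD('k) ^ n = CARD('k) ^ (d + e)" by (simp add: card_vecs power_add)
  then show ?thesis using q_ge_2[where 'k = 'k] by simp
qed

section \<open>Nilpotent endomorphisms and their morphisms\<close>

fun mpow :: "nat \<Rightarrow> 'k::field mat \<Rightarrow> nat \<Rightarrow> 'k mat" where
  "mpow n X 0 = idm n"
| "mpow n X (Suc k) = mm n X (mpow n X k)"

lemma mpow_mats [intro]: "X \<in> mats n n \<Longrightarrow> mpow n X k \<in> mats n n"
  by (induction k) auto

lemma mpow_add: "X \<in> mats n n \<Longrightarrow> mpow n X (k + l) = mm n (mpow n X k) (mpow n X l)"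
proof (induction k)
  case 0
  then show ?case using mpow_mats[of X n l] by simp
next
  case (Suc k)
  then show ?case by (simp add: mm_assoc)
qed

definition Hom :: "nat \<Rightarrow> 'k::field mat \<Rightarrow> nat \<Rightarrow> 'k mat \<Rightarrow> 'k mat set" where
  "Hom a X b Y = {M \<in> mats b a. mm b Y M = mm a M X}"

lemma HomD:
  assumes "M \<in> Hom a X b Y"
  shows "M \<in> mats b a" "mm b Y M = mm a M X"
  using assms by (auto simp: Hom_def)

lemma HomI: "M \<in> mats b a \<Longrightarrow> mm b Y M = mm a M X \<Longrightarrow> M \<in> Hom a X b Y"
  by (auto simp: Hom_def)

lemma Hom_comp: "M \<in> Hom a X b Y \<Longrightarrow> N \<in> Hom b Y c Z \<Longrightarrow> mm b N M \<in> Hom a X c Z"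
  unfolding Hom_def by (auto simp: mm_assoc) (metis mm_assoc)

definition nilp :: "nat \<Rightarrow> 'k::field mat \<Rightarrow> bool" where
  "nilp n X \<longleftrightarrow> X \<in> mats n n \<and> (\<exists>k. mpow n X k = 0)"

lemma mpow_hom:
  assumes "M \<in> Hom a X b Y"
  shows "mm b (mpow b Y k) M = mm a M (mpow a X k)"
proof (induction k)
  case 0
  show ?case using HomD[OF assms] by simp
next
  case (Suc k)
  have "mm b (mpow b Y (Suc k)) M = mm a (mm b Y M) (mpow a X k)" by (simp add: mm_assoc Suc)
  also have "\<dots> = mm a M (mpow a X (Suc k))" using HomD[OF assms] by (simp add: mm_assoc)
  finally show ?case .
qed

lemma Hom_inv:
  assumes P: "P \<in> Hom n X n Y" and I: "minv n P Q" and X: "X \<in> mats n n" and Y: "Y \<in> mats n n"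
  shows "Q \<in> Hom n Y n X"
proof -
  note P = HomD[OF P] and I = minvD[OF I]
  have "mm n X Q = mm n Q (mm n P (mm n X Q))"
    using I X by (intro cancel_left[symmetric] mats_mm)
  also have "\<dots> = mm n Q (mm n Y (mm n P Q))"
    using P by (simp flip: mm_assoc)
  finally show ?thesis using I Y by (auto intro: HomI)
qed

lemma sub_nilp:
  assumes "nilp n X" "f \<in> Hom d D n X" "p \<in> mats d n" "mm n p f = idm d" "D \<in> mats d d"
  shows "nilp d D"
proof -
  obtain k where k: "mpow n X k = 0" using assms(1) by (auto simp: nilp_def)
  have "mpow d D k = mm n p (mm d f (mpow d D k))"
    by (rule cancel_left[symmetric, OF assms(4) mpow_mats[OF assms(5)]])
  also have "\<dots> = 0" using mpow_hom[OF assms(2), of k] k by simp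
  finally show ?thesis using assms(5) by (auto simp: nilp_def)
qed

lemma quot_nilp:
  assumes "nilp n X" "h \<in> Hom n X e E" "s \<in> mats n e" "mm n h s = idm e" "E \<in> mats e e"
  shows "nilp e E"
proof -
  obtain k where k: "mpow n X k = 0" using assms(1) by (auto simp: nilp_def)
  have "mpow e E k = mm n (mm e (mpow e E k) h) s"
    by (rule cancel_right[symmetric, OF assms(4) mpow_mats[OF assms(5)]])
  also have "\<dots> = 0" using mpow_hom[OF assms(2), of k] k by simp
  finally show ?thesis using assms(5) by (auto simp: nilp_def)
qed

text \<open>If E^l = 0, then h X^l = E^l h = 0, so X^l maps into the image of f. There X acts as D,
  and X^k finishes when D^k = 0.\<close>

lemma ext_nilp:
  assumes S: "splits d n e f h p s" and D: "nilp d D" and E: "nilp e E" and X: "X \<in> mats n n"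
    and f: "f \<in> Hom d D n X" and h: "h \<in> Hom n X e E"
  shows "nilp n X"
proof -
  note S = splitsD[OF S]
  obtain k l where k: "mpow d D k = 0" and l: "mpow e E l = 0" using D E by (auto simp: nilp_def)
  have "mm n h (mpow n X l) = 0" using mpow_hom[OF h, of l] l by simp
  moreover have "mpow n X l = mm n (mm d f p + mm e s h) (mpow n X l)"
    using S by (simp add: mm_idm_left[OF mpow_mats[OF X]])
  ultimately have "mpow n X l = mm d f (mm n p (mpow n X l))" by (simp add: mm_add_left mm_assoc)
  then have "mpow n X (k + l) = mm n (mpow n X k) (mm d f (mm n p (mpow n X l)))" by (simp add: mpow_add X)
  also have "\<dots> = mm d (mm n (mpow n X k) f) (mm n p (mpow n X l))" by (simp add: mm_assoc)
  also have "\<dots> = 0" using mpow_hom[OF f, of k] k by simp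
  finally show ?thesis using X by (auto simp: nilp_def)
qed

definition isos :: "nat \<Rightarrow> 'k::field mat \<Rightarrow> 'k mat \<Rightarrow> 'k mat set" where
  "isos n X Y = {P \<in> Hom n X n Y. \<exists>Q. minv n P Q}"

lemma finite_isos [simp, intro]: "finite (isos n X (Y :: 'k::{field,finite} mat))"
  by (rule finite_subset[of _ "mats n n"]) (auto simp: isos_def Hom_def)

lemma isos_inv:
  assumes "P \<in> isos n X Y" "X \<in> mats n n" "Y \<in> mats n n"
  obtains Q where "minv n P Q" "Q \<in> isos n Y X"
  using assms Hom_inv minv_sym unfolding isos_def by blast

lemma isos_comp:
  assumes "P \<in> isos n X Y" "P' \<in> isos n Y Z"
  shows "mm n P' P \<in> isos n X Z"
  using assms Hom_comp minv_mult unfolding isos_def by blast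

lemma card_isos_comp_left:
  assumes "P \<in> isos n Y Z" "Y \<in> mats n n" "Z \<in> mats n n"
  shows "card (isos n X Z) = card (isos n X Y)"
proof -
  obtain Q where Q: "minv n P Q" "Q \<in> isos n Z Y" using isos_inv[OF assms] .
  note I = minvD[OF Q(1)]
  have "bij_betw (\<lambda>R. mm n P R) (isos n X Y) (isos n X Z)"
  proof (rule bij_betw_byWitness[where f' = "\<lambda>R. mm n Q R"])
    show "\<forall>a\<in>isos n X Y. mm n Q (mm n P a) = a" "\<forall>a\<in>isos n X Z. mm n P (mm n Q a) = a"
      using I by (auto simp: isos_def Hom_def cancel_left)
  qed (use assms Q isos_comp in blast)+
  then show ?thesis by (simp add: bij_betw_same_card)
qed

text \<open>Composition makes both sets torsors under the automorphisms of X, unless both are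
  empty.\<close>

lemma card_isos_sym:
  assumes "X \<in> mats n n" "Y \<in> mats n n"
  shows "card (isos n X Y) = card (isos n Y X)"
proof (cases "isos n X Y = {}")
  case True
  then have "isos n Y X = {}" using isos_inv assms by (metis ex_in_conv)
  then show ?thesis using True by simp
next
  case False
  then obtain P where P: "P \<in> isos n X Y" by blast
  then obtain Q where Q: "Q \<in> isos n Y X" using isos_inv assms by metis
  have "card (isos n X Y) = card (isos n X X)" using card_isos_comp_left[OF P] assms by simp
  moreover have "bij_betw (\<lambda>R. mm n R Q) (isos n X X) (isos n Y X)"
  proof -
    obtain P' where P': "minv n Q P'" "P' \<in> isos n X Y" using isos_inv[OF Q] assms by blast
    note I = minvD[OF P'(1)]
    show ?thesis
    proof (rule bij_betw_byWitness[where f' = "\<lambda>R. mm n R P'"])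
      show "\<forall>a\<in>isos n X X. mm n (mm n a Q) P' = a" "\<forall>a\<in>isos n Y X. mm n (mm n a P') Q = a"
        using I by (auto simp: isos_def Hom_def cancel_right)
    qed (use Q P' isos_comp in blast)+
  qed
  ultimately show ?thesis by (simp add: bij_betw_same_card)
qed

text \<open>The dimension of the kernel, taken as the exponent of q in its cardinality. The
  description operator has a meaningful value once that cardinality is known to be a power of q,
  which is what \<open>nulI\<close> asks for.\<close>

definition nul :: "nat \<Rightarrow> 'k::{field,finite} mat \<Rightarrow> nat" where
  "nul n X = (THE l. card {v \<in> vecs n. mv n X v = 0} = CARD('k) ^ l)"

lemma nulI:
  fixes X :: "'k::{field,finite} mat"
  assumes "card {v \<in> vecs n. mv n X v = 0} = CARD('k) ^ l"
  shows "nul n X = l"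
  unfolding nul_def using assms q_ge_2[where 'k = 'k] by (intro the_equality) auto

lemma card_kernel_iso:
  assumes "P \<in> isos n X Y" "X \<in> mats n n" "Y \<in> mats n n"
  shows "card {v \<in> vecs n. mv n X v = 0} = card {v \<in> vecs n. mv n Y v = 0}"
proof -
  obtain Q where Q: "minv n P Q" "Q \<in> isos n Y X" using isos_inv[OF assms] .
  note I = minvD[OF Q(1)]
  have PH: "mm n Y P = mm n P X" "mm n X Q = mm n Q Y" using assms Q by (auto simp: isos_def Hom_def)
  have "bij_betw (mv n P) {v \<in> vecs n. mv n X v = 0} {v \<in> vecs n. mv n Y v = 0}"
  proof (rule bij_betw_byWitness[where f' = "mv n Q"])
    show "\<forall>a\<in>{v \<in> vecs n. mv n X v = 0}. mv n Q (mv n P a) = a"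
      "\<forall>a\<in>{v \<in> vecs n. mv n Y v = 0}. mv n P (mv n Q a) = a"
      using I by (auto simp flip: mv_mm)
    show "mv n P ` {v \<in> vecs n. mv n X v = 0} \<subseteq> {v \<in> vecs n. mv n Y v = 0}"
      using I PH by (auto simp flip: mv_mm simp: mv_vecs) (simp add: mv_mm)
    show "mv n Q ` {v \<in> vecs n. mv n Y v = 0} \<subseteq> {v \<in> vecs n. mv n X v = 0}"
      using I PH by (auto simp flip: mv_mm simp: mv_vecs) (simp add: mv_mm)
  qed
  then show ?thesis by (rule bij_betw_same_card)
qed

lemma nul_iso:
  assumes "P \<in> isos n X Y" "X \<in> mats n n" "Y \<in> mats n n"
  shows "nul n X = nul n Y"
  unfolding nul_def card_kernel_iso[OF assms] ..

section \<open>Jordan blocks\<close>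

definition suppv :: "nat set \<Rightarrow> 'k::field vec set" where
  "suppv S = {v. \<forall>i. i \<notin> S \<longrightarrow> v i = 0}"

lemma card_suppv:
  assumes "finite S"
  shows "card (suppv S :: 'k::{field,finite} vec set) = CARD('k) ^ card S"
proof -
  have bij: "bij_betw (\<lambda>f i. if i \<in> S then f i else 0) (PiE S (\<lambda>_. UNIV :: 'k set)) (suppv S)"
    by (rule bij_betw_byWitness[where f' = "\<lambda>f. restrict f S"])
       (auto simp: suppv_def fun_eq_iff PiE_def extensional_def)
  show ?thesis
    using bij_betw_same_card[OF bij] assms by (simp add: card_PiE)
qed

text \<open>The number of positions from \<open>p\<close> to the end of the Jordan block containing \<open>p\<close>.\<close>
fun rest :: "nat list \<Rightarrow> nat \<Rightarrow> nat" where
  "rest [] p = 0"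
| "rest (k # l) p = (if p < k then k - p else rest l (p - k))"

lemma block_starts_Cons: "block_starts (k # l) = insert 0 ((+) k ` block_starts l)"
proof -
  have "{i. i < length (k # l)} = insert 0 (Suc ` {i. i < length l})"
    by (auto simp: image_iff less_Suc_eq_0_disj)
  moreover have "block_starts m = (\<lambda>i. sum_list (take i m)) ` {i. i < length m}" for m
    by (auto simp: block_starts_def)
  ultimately show ?thesis by (simp add: image_image)
qed

text \<open>Links the block starts in the definition of \<open>Jmat\<close> to \<open>rest\<close>,
  which recurses along the list and so allows induction over the blocks.\<close>

lemma one_less_rest_iff: "1 < rest lam p \<longleftrightarrow> Suc p < sum_list lam \<and> Suc p \<notin> block_starts lam"
proof (induction lam arbitrary: p)
  case Nil
  then show ?case by simp
next
  case (Cons k l)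
  consider "Suc p < k" | "Suc p = k" | "k \<le> p" by linarith
  then show ?case
  proof cases
    case 1
    then show ?thesis by (auto simp: block_starts_Cons)
  next
    case 2
    have "0 \<in> block_starts l" if "0 < sum_list l"
      using that by (cases l) (auto simp: block_starts_Cons)
    then show ?thesis using 2 by (auto simp: block_starts_Cons image_iff)
  next
    case 3
    then have "Suc p \<in> (+) k ` block_starts l \<longleftrightarrow> Suc (p - k) \<in> block_starts l"
      using inj_image_mem_iff[of "(+) k" "Suc (p - k)" "block_starts l"] by simp
    then show ?thesis using 3 Cons[of "p - k"] by (auto simp: block_starts_Cons)
  qed
qed

lemma Jmat_rest: "Jmat lam i j = (if j = Suc i \<and> 1 < rest lam i then 1 else 0)"
  unfolding Jmat_def one_less_rest_iff by auto

lemma rest_bound: "p + rest lam p \<le> max p (sum_list lam)"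
proof (induction lam arbitrary: p)
  case (Cons k l)
  show ?case using Cons[of "p - k"] by auto
qed simp

lemma rest_zero: "sum_list lam \<le> p \<Longrightarrow> rest lam p = 0"
  using rest_bound[of p lam] by simp

lemma rest_pos: "p < sum_list lam \<Longrightarrow> 0 < rest lam p"
  by (induction lam arbitrary: p) auto

lemma rest_le: "rest lam p \<le> sum_list lam"
  using rest_bound[of p lam] rest_zero[of lam p] by (cases "sum_list lam \<le> p") auto

lemma rest_add_le: "0 < rest lam p \<Longrightarrow> p + rest lam p \<le> sum_list lam"
  using rest_bound[of p lam] rest_zero[of lam p] by (cases "sum_list lam \<le> p") auto

lemma rest_Suc: "1 < rest lam p \<Longrightarrow> rest lam (Suc p) = rest lam p - 1"
proof (induction lam arbitrary: p)
  case (Cons k l)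
  then show ?case using Cons(1)[of "p - k"] by (auto simp: Suc_diff_le)
qed simp

lemma Jmat_mats [simp, intro]: "Jmat lam \<in> mats (sum_list lam) (sum_list lam)"
  using rest_zero[of lam] by (auto simp: mats_def Jmat_def)

lemma mv_Jmat: "mv (sum_list lam) (Jmat lam) v p = (if 1 < rest lam p then v (Suc p) else 0)"
proof -
  have "mv (sum_list lam) (Jmat lam) v p
      = (\<Sum>j<sum_list lam. if 1 < rest lam p \<and> j = Suc p then v j else 0)"
    unfolding mv_def Jmat_rest by (rule sum.cong) auto
  then show ?thesis
    using one_less_rest_iff[of lam p] by (subst (asm) sum_if_conj) auto
qed

text \<open>The i-th power shifts by i positions inside a block, and \<open>i < rest lam p\<close>
  says that the shift starting at p stays inside.\<close>

lemma mv_mpow_Jmat: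
  assumes "v \<in> vecs (sum_list lam)"
  shows "mv (sum_list lam) (mpow (sum_list lam) (Jmat lam) i) v p = (if i < rest lam p then v (p + i) else 0)"
proof (induction i arbitrary: p)
  case 0
  then show ?case using assms rest_zero[of lam p] rest_pos[of p lam]
    by (cases "p < sum_list lam") (auto simp: vecs_def)
next
  case (Suc i)
  show ?case using Suc[of "Suc p"] rest_Suc[of lam p] by (auto simp: mv_mm mv_Jmat)
qed

lemma nilp_Jmat: "nilp (sum_list lam) (Jmat lam :: 'k::field mat)"
proof -
  have "mpow (sum_list lam) (Jmat lam) (sum_list lam) = (0 :: 'k mat)"
  proof (rule mats_eqI)
    fix v :: "'k vec" assume "v \<in> vecs (sum_list lam)"
    then show "mv (sum_list lam) (mpow (sum_list lam) (Jmat lam) (sum_list lam)) v = mv (sum_list lam) 0 v"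
      using rest_le[of lam] by (auto simp: fun_eq_iff mv_mpow_Jmat not_less[symmetric])
  qed auto
  then show ?thesis by (auto simp: nilp_def)
qed

lemma finite_rest: "finite {p. i < rest lam p}"
proof (rule finite_subset)
  show "{p. i < rest lam p} \<subseteq> {..<sum_list lam}"
    using rest_zero[of lam] by (metis (no_types, lifting) lessThan_iff mem_Collect_eq not_less not_less_zero subsetI)
qed simp

lemma card_rest: "card {p. i < rest lam p} = (\<Sum>k\<leftarrow>lam. k - i)"
proof (induction lam)
  case (Cons k l)
  have "{p. i < rest (k # l) p} = {..<k - i} \<union> (+) k ` {p. i < rest l p}"
  proof (intro set_eqI)
    fix p
    show "p \<in> {p. i < rest (k # l) p} \<longleftrightarrow> p \<in> {..<k - i} \<union> (+) k ` {p. i < rest l p}"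
      by (cases "p < k") (auto simp: image_iff intro: exI[of _ "p - k"])
  qed
  moreover have "card ({..<k - i} \<union> (+) k ` {p. i < rest l p}) = (k - i) + card {p. i < rest l p}"
    by (subst card_Un_disjoint) (auto simp: card_image finite_rest)
  ultimately show ?case using Cons by simp
qed simp

text \<open>The first i positions of each block, obtained as the complement of the positions reached
  by a shift of i inside a block. They span the kernel of the i-th power of
  \<open>Jmat lam\<close>.\<close>

definition heads :: "nat \<Rightarrow> nat list \<Rightarrow> nat set" where
  "heads i lam = {..<sum_list lam} - (\<lambda>p. p + i) ` {p. i < rest lam p}"

lemma heads_subset: "heads i lam \<subseteq> {..<sum_list lam}"
  by (auto simp: heads_def)

lemma rest_image_subset: "(\<lambda>p. p + i) ` {p. i < rest lam p} \<subseteq> {..<sum_list lam}"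
proof
  fix x assume "x \<in> (\<lambda>p. p + i) ` {p. i < rest lam p}"
  then obtain p where "x = p + i" "i < rest lam p" by auto
  then show "x \<in> {..<sum_list lam}" using rest_add_le[of lam p] by simp
qed

lemma card_heads: "card (heads i lam) = sum_list lam - (\<Sum>k\<leftarrow>lam. k - i)"
proof -
  have "card ((\<lambda>p. p + i) ` {p. i < rest lam p}) = (\<Sum>k\<leftarrow>lam. k - i)"
    by (simp add: card_image card_rest)
  then show ?thesis
    unfolding heads_def using rest_image_subset finite_rest by (subst card_Diff_subset) auto
qed

lemma kernel_mpow_Jmat:
  "{v \<in> vecs (sum_list lam). mv (sum_list lam) (mpow (sum_list lam) (Jmat lam) i) v = 0} = suppv (heads i lam)"
  (is "?L = ?R")
proof (intro set_eqI iffI)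
  fix v :: "'a vec" assume v: "v \<in> ?L"
  have "v (p + i) = 0" if "i < rest lam p" for p
    using v that mv_mpow_Jmat[of v lam i p] by simp
  then show "v \<in> ?R" using v by (auto simp: suppv_def heads_def vecs_def)
next
  fix v :: "'a vec" assume v: "v \<in> ?R"
  then have v': "v \<in> vecs (sum_list lam)" using heads_subset[of i lam] by (auto simp: suppv_def vecs_def)
  have "v (p + i) = 0" if "i < rest lam p" for p
    using v that by (auto simp: suppv_def heads_def)
  then show "v \<in> ?L" using v' by (auto simp: mv_mpow_Jmat fun_eq_iff)
qed

lemma kernel_Jmat:
  "{v \<in> vecs (sum_list lam). mv (sum_list lam) (Jmat lam) v = 0} = suppv (heads (Suc 0) lam)"
  using kernel_mpow_Jmat[of lam "Suc 0"] by (simp add: mm_idm_right[OF Jmat_mats])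

lemma sum_list_diff_le:
  fixes i :: nat and lam :: "nat list"
  shows "(\<Sum>k\<leftarrow>lam. k - i) \<le> sum_list lam"
  by (induction lam) auto

lemma card_heads_1: "is_partition lam \<Longrightarrow> card (heads (Suc 0) lam) = length lam"
proof -
  assume "is_partition lam"
  then have "\<forall>x\<in>set lam. 0 < x" by (simp add: is_partition_def)
  then have "sum_list lam = (\<Sum>k\<leftarrow>lam. k - Suc 0) + length lam"
    by (induction lam) auto
  then show ?thesis by (simp add: card_heads)
qed

lemma finite_heads [simp]: "finite (heads i lam)"
  by (auto simp: heads_def)

lemma card_kernel_Jmat:
  assumes "is_partition lam"
  shows "card {v \<in> vecs (sum_list lam). mv (sum_list lam) (Jmat lam :: 'k::{field,finite} mat) v = 0}
    = CARD('k) ^ length lam"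
  unfolding kernel_Jmat using assms by (simp add: card_suppv card_heads_1)

lemma nul_Jmat:
  assumes "is_partition lam"
  shows "nul (sum_list lam) (Jmat lam :: 'k::{field,finite} mat) = length lam"
  by (rule nulI[OF card_kernel_Jmat[OF assms]])

text \<open>The first difference in i of these sums counts the parts exceeding i, the second the
  parts equal to \<open>Suc i\<close>. So the sums determine the multiset of parts, and a sorted
  list is determined by its multiset.\<close>

lemma partition_eqI:
  assumes "is_partition lam" "is_partition mu"
    and eq: "\<And>i. (\<Sum>k\<leftarrow>lam. k - i) = (\<Sum>k\<leftarrow>mu. k - i)"
  shows "lam = mu"
proof -
  have diff: "(\<Sum>k\<leftarrow>l. k - i) = (\<Sum>k\<leftarrow>l. k - Suc i) + length (filter (\<lambda>k. i < k) l)" for i and l :: "nat list"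
    by (induction l) auto
  have gt: "length (filter (\<lambda>k. i < k) lam) = length (filter (\<lambda>k. i < k) mu)" for i
    using eq[of i] eq[of "Suc i"] diff[of i lam] diff[of i mu] by simp
  have cnt: "count (mset l) (Suc i) + length (filter (\<lambda>k. Suc i < k) l) = length (filter (\<lambda>k. i < k) l)"
    for i and l :: "nat list"
    by (induction l) auto
  have "mset lam = mset mu"
  proof (rule multiset_eqI)
    fix k
    show "count (mset lam) k = count (mset mu) k"
    proof (cases k)
      case 0
      then have "k \<notin> set lam" "k \<notin> set mu" using assms by (auto simp: is_partition_def)
      then show ?thesis by (metis count_eq_zero_iff set_mset_mset)
    next
      case (Suc i)
      then show ?thesis using cnt[of lam i] cnt[of mu i] gt[of i] gt[of "Suc i"] by simp
    qed
  qed
  moreover have "sorted (rev lam)" "sorted (rev mu)"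
    using assms by (simp_all add: is_partition_def sorted_wrt_rev)
  ultimately have "rev lam = rev mu"
    by (metis mset_rev properties_for_sort)
  then show ?thesis by simp
qed

section \<open>Uniqueness and existence of the Jordan type\<close>

lemma Hom_mpow:
  assumes "M \<in> Hom a X b Y"
  shows "M \<in> Hom a (mpow a X k) b (mpow b Y k)"
  using mpow_hom[OF assms] HomD(1)[OF assms] by (auto intro: HomI)

text \<open>An isomorphism intertwines all powers, so the kernels of the i-th powers have equal
  size; their dimensions determine the sums of \<open>k - i\<close> over the parts.\<close>

lemma jordan_unique:
  assumes "is_partition lam" "is_partition mu" "sum_list lam = n" "sum_list mu = n"
    and "P \<in> isos n (Jmat lam :: 'k::{field,finite} mat) (Jmat mu)"
  shows "lam = mu"
proof (rule partition_eqI[OF assms(1,2)])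
  fix i
  have "P \<in> isos n (mpow n (Jmat lam) i) (mpow n (Jmat mu) i)"
    using assms(5) Hom_mpow unfolding isos_def by blast
  then have "card (suppv (heads i lam) :: 'k vec set) = card (suppv (heads i mu) :: 'k vec set)"
    using card_kernel_iso[of P n "mpow n (Jmat lam) i" "mpow n (Jmat mu) i"]
      mpow_mats[OF Jmat_mats, of lam i] mpow_mats[OF Jmat_mats, of mu i]
    unfolding kernel_mpow_Jmat[symmetric] assms(3,4) by blast
  then have "card (heads i lam) = card (heads i mu)"
    using q_ge_2[where 'k = 'k] by (simp add: card_suppv)
  then show "(\<Sum>k\<leftarrow>lam. k - i) = (\<Sum>k\<leftarrow>mu. k - i)"
    using assms(3,4) sum_list_diff_le[of i lam] sum_list_diff_le[of i mu]
    by (simp add: card_heads)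
qed

lemma mv_idm_trunc: "mv (d + e) (idm d) v = (\<lambda>i. if i < d then v i else 0)"
proof
  fix i
  have "mv (d + e) (idm d) v i = (\<Sum>j<d+e. if i < d \<and> j = i then v j else 0)"
    unfolding mv_def idm_def by (rule sum.cong) auto
  then show "mv (d + e) (idm d) v i = (if i < d then v i else 0)"
    by (subst (asm) sum_if_conj) auto
qed

lemma mv_prj: "mv (d + e) (prj d e) v = (\<lambda>i. if i < e then v (d + i) else 0)"
proof
  fix i
  have "mv (d + e) (prj d e) v i = (\<Sum>j<d+e. if i < e \<and> j = d + i then v j else 0)"
    unfolding mv_def prj_def by (rule sum.cong) auto
  then show "mv (d + e) (prj d e) v i = (if i < e then v (d + i) else 0)"
    by (subst (asm) sum_if_conj) auto
qed

lemma Jmat_Cons_fst: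
  "mm (k + sum_list l) (idm k) (Jmat (k # l)) = mm k (Jmat [k]) (idm k :: 'k::field mat)"
proof (rule mats_eqI[where b = k])
  fix v :: "'k vec" assume "v \<in> vecs (k + sum_list l)"
  show "mv (k + sum_list l) (mm (k + sum_list l) (idm k) (Jmat (k # l))) v
      = mv (k + sum_list l) (mm k (Jmat [k]) (idm k)) v"
    using mv_Jmat[of "k # l" v] mv_Jmat[of "[k]", where 'a = 'k]
    by (auto simp: mv_mm mv_idm_trunc fun_eq_iff)
qed (use Jmat_mats[of "k # l"] Jmat_mats[of "[k]"] splitsD[OF std_splits[of k "sum_list l"]] in auto)

lemma Jmat_Cons_snd:
  "mm (k + sum_list l) (prj k (sum_list l)) (Jmat (k # l)) = mm (sum_list l) (Jmat l) (prj k (sum_list l) :: 'k::field mat)"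
proof (rule mats_eqI[where b = "sum_list l"])
  fix v :: "'k vec" assume v: "v \<in> vecs (k + sum_list l)"
  have r: "i < sum_list l" if "Suc 0 < rest l i" for i
    using that rest_zero[of l i] by (cases "sum_list l \<le> i") auto
  have s: "Suc i < sum_list l" if "Suc 0 < rest l i" for i
    using that rest_add_le[of l i] by auto
  show "mv (k + sum_list l) (mm (k + sum_list l) (prj k (sum_list l)) (Jmat (k # l))) v
      = mv (k + sum_list l) (mm (sum_list l) (Jmat l) (prj k (sum_list l))) v"
    using mv_Jmat[of "k # l" v] mv_Jmat[of l, where 'a = 'k] r s
    by (auto simp: mv_mm mv_prj fun_eq_iff)
qed (use Jmat_mats[of "k # l"] Jmat_mats[of l] splitsD[OF std_splits[of k "sum_list l"]] in auto)

lemma mpow_Suc_right: "X \<in> mats n n \<Longrightarrow> mpow n X (Suc k) = mm n (mpow n X k) X"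
  using mpow_add[of X n k 1] by simp

lemma splits_change_quotient:
  assumes "splits d n e f h p s" "minv e P Q"
  shows "splits d n e f (mm e Q h) p (mm e s P)"
proof -
  note S = splitsD[OF assms(1)] and I = minvD[OF assms(2)]
  have "mm n (mm e Q h) (mm e s P) = mm e Q (mm e (mm n h s) P)" by (simp add: mm_assoc)
  moreover have "mm e (mm e s P) (mm e Q h) = mm e s (mm e (mm e P Q) h)" by (simp add: mm_assoc)
  ultimately show ?thesis using S I by (auto simp: splits_def)
qed

text \<open>Splits off a Jordan block of maximal size k. A nonzero entry of X^(k-1) provides both a
  vector generating a chain of length k and a coordinate that detects the last member of the chain.
  The chain gives a morphism c from the block, the coordinate a morphism T to it, and T c is
  invertible. After normalisation the kernel of T is a stable complement, to which induction
  applies.\<close>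

lemma jordan_exists:
  fixes X :: "'k::{field,finite} mat"
  assumes "nilp n X"
  shows "\<exists>lam. is_partition lam \<and> sum_list lam = n \<and> isos n (Jmat lam) X \<noteq> {}"
  using assms
proof (induction n arbitrary: X rule: less_induct)
  case (less n)
  have X: "X \<in> mats n n" using less.prems by (simp add: nilp_def)
  show ?case
  proof (cases "n = 0")
    case True
    have "minv 0 0 (0 :: 'k mat)" by (auto simp: minv_def fun_eq_iff idm_def)
    then have "0 \<in> isos 0 (Jmat []) X" by (auto simp: isos_def Hom_def)
    then have "is_partition [] \<and> sum_list [] = n \<and> isos n (Jmat []) X \<noteq> {}"
      using True by (auto simp: is_partition_def)
    then show ?thesis by blast
  next
    case False
    define k where "k = (LEAST k. mpow n X k = 0)"
    have Xk: "mpow n X k = 0"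
      using less.prems LeastI_ex[of "\<lambda>k. mpow n X k = 0"] unfolding nilp_def k_def by blast
    have min: "mpow n X j \<noteq> 0" if "j < k" for j
      using that not_less_Least[of j "\<lambda>k. mpow n X k = 0"] unfolding k_def by blast
    have "idm n \<noteq> (0 :: 'k mat)" using False by (auto simp: idm_def fun_eq_iff)
    then have k0: "0 < k" using Xk by (cases k) auto
    have high: "mpow n X t = 0" if "k \<le> t" for t
      using mpow_add[OF X, of k "t - k"] Xk that by simp
    obtain i0 j0 where ij: "mpow n X (k - 1) i0 j0 \<noteq> 0"
      using min[of "k - 1"] k0 by (auto simp: fun_eq_iff)
    moreover have Xp: "mpow n X t \<in> mats n n" for t using X by (rule mpow_mats)
    ultimately have i0: "i0 < n" and j0: "j0 < n"
      using Xp[of "k - 1"] by (auto simp: mats_def intro: leI)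
    define pw where "pw t = mv n (mpow n X t) (unitv j0)" for t
    have pw: "pw t \<in> vecs n" for t using Xp by (auto simp: pw_def)
    have pw_nz: "pw (k - 1) i0 \<noteq> 0" using ij j0 by (simp add: pw_def mv_unitv)
    have pw_add: "mv n (mpow n X s) (pw t) = pw (s + t)" for s t
      by (simp add: pw_def mpow_add[OF X] mv_mm)
    have pw_zero: "pw t = 0" if "k \<le> t" for t using high[OF that] by (simp add: pw_def)
    \<comment> \<open>\<open>Jmat\<close> lowers indices, so the chain is listed backwards: the
      generator \<open>pw 0\<close> is the image of the last basis vector of the block.\<close>
    define c where "c = cols k (\<lambda>j. pw (k - 1 - j))"
    \<comment> \<open>Row t reads the coordinate i0 after t applications of X. Applying X beforehand
      shifts the rows by one, which is the action of J.\<close>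
    define T where "T = (\<lambda>t j. if t < k then mpow n X t i0 j else 0)"
    define J where "J = (Jmat [k] :: 'k mat)"
    have J: "J \<in> mats k k" using Jmat_mats[of "[k]"] by (simp add: J_def)
    have mvJ: "mv k J v p = (if Suc p < k then v (Suc p) else 0)" for v p
      using mv_Jmat[of "[k]" v p] by (auto simp: J_def)
    have c: "c \<in> mats n k" unfolding c_def using pw by (intro mats_cols)
    have T: "T \<in> mats k n" using Xp by (auto simp: T_def mats_def)
    have mvT: "mv n T w t = (if t < k then mv n (mpow n X t) w i0 else 0)" for w t
      by (auto simp: mv_def T_def)
    have T_hom: "T \<in> Hom n X k J"
    proof (rule HomI[OF T], rule mats_eqI)
      fix v :: "'k vec"
      show "mv n (mm k J T) v = mv n (mm n T X) v"
      proof
        fix t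
        have "mv n (mpow n X t) (mv n X v) = mv n (mpow n X (Suc t)) v"
          by (simp only: mpow_Suc_right[OF X] mv_mm)
        moreover have "mpow n X (Suc t) = 0" if "\<not> Suc t < k" using high[of "Suc t"] that by simp
        ultimately show "mv n (mm k J T) v t = mv n (mm n T X) v t"
          by (auto simp: mv_mm mvJ mvT simp del: mpow.simps)
      qed
    qed (use J T X in auto)
    have c_hom: "c \<in> Hom k J n X"
    proof (rule HomI[OF c], rule mats_eq_unitI)
      fix j assume j: "j < k"
      have "mv n X (pw t) = pw (Suc t)" for t
        using pw_add[of 1 t] X by (simp add: mm_idm_right[OF X])
      then have 1: "mv n X (mv k c (unitv j)) = pw (k - j)"
        using j by (simp add: c_def mv_cols_unitv Suc_diff_Suc)
      have "mv k J (unitv j) = (if j = 0 then 0 else unitv (j - 1))"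
        using j by (auto simp: fun_eq_iff mvJ unitv_def)
      then have 2: "mv k c (mv k J (unitv j)) = pw (k - j)"
        using j pw_zero[of k] by (auto simp: c_def mv_cols_unitv)
      show "mv k (mm n X c) (unitv j) = mv k (mm k c J) (unitv j)"
        using 1 2 by (simp add: mv_mm)
    qed (use c X J in auto)
    define A where "A = mm n T c"
    have A: "A \<in> mats k k" "A \<in> Hom k J k J"
      using Hom_comp[OF c_hom T_hom] T c by (auto simp: A_def)
    have A_ent: "A t j = pw (t + (k - 1 - j)) i0" if "t < k" "j < k" for t j
    proof -
      have "A t j = mv k A (unitv j) t" using that by (simp add: mv_unitv)
      also have "\<dots> = mv n T (pw (k - 1 - j)) t"
        using that by (simp add: A_def mv_mm c_def mv_cols_unitv)
      finally show ?thesis using that by (simp add: mvT pw_add)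
    qed
    have inj: "inj_on (mv k A) (vecs k)"
    proof (rule inj_onI, rule ccontr)
      fix x y assume xy: "x \<in> vecs k" "y \<in> vecs k" "mv k A x = mv k A y" "x \<noteq> y"
      define z where "z = x - y"
      have z: "z \<in> vecs k" "mv k A z = 0" "z \<noteq> 0" using xy by (auto simp: z_def mv_diff)
      \<comment> \<open>The matrix A is upper triangular, since \<open>pw t\<close> vanishes for t
        \<ge> k, and has the constant diagonal \<open>pw (k - 1) i0\<close>. In row r the last
        nonzero coordinate of z therefore stands alone.\<close>
      define r where "r = Max {i. z i \<noteq> 0}"
      have sub: "{i. z i \<noteq> 0} \<subseteq> {..<k}" using z(1) by (auto simp: vecs_def intro: ccontr)
      then have fin: "finite {i. z i \<noteq> 0}" by (rule finite_subset) simp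
      have ne: "{i. z i \<noteq> 0} \<noteq> {}" using z(3) by (auto simp: fun_eq_iff)
      have r: "z r \<noteq> 0" using Max_in[OF fin ne] by (simp add: r_def)
      have rk: "r < k" using r sub by auto
      have above: "z j = 0" if "r < j" for j
        using Max_ge[OF fin, of j] that by (auto simp: r_def)
      have "mv k A z r = (\<Sum>j<k. if j = r then A r r * z r else 0)"
        unfolding mv_def
      proof (rule sum.cong)
        fix j assume "j \<in> {..<k}"
        then have jk: "j < k" by simp
        show "A r j * z j = (if j = r then A r r * z r else 0)"
        proof (cases j r rule: linorder_cases)
          case less
          then have "k \<le> r + (k - 1 - j)" using jk by simp
          then have "A r j = 0" using pw_zero A_ent[OF rk jk] by simp
          then show ?thesis using less by simp
        qed (use above in auto)
      qed simp
      then have "mv k A z r = A r r * z r" using rk by simp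
      moreover have "A r r = pw (k - 1) i0" using A_ent[OF rk rk] rk by simp
      ultimately show False using z(2) r pw_nz by simp
    qed
    obtain B where B: "minv k A B" using inj_minv[OF A(1) inj] .
    \<comment> \<open>Normalising by the inverse of A turns T into a retraction of c'.\<close>
    define c' where "c' = mm k c B"
    have c': "c' \<in> mats n k" "c' \<in> Hom k J n X"
      using c minvD[OF B] Hom_comp[OF Hom_inv[OF A(2) B J J] c_hom] by (auto simp: c'_def)
    have Tc: "mm n T c' = idm k" using minvD[OF B] by (simp add: c'_def A_def mm_assoc)
    have "inj_on (mv k c') (vecs k)"
      by (rule inj_on_inverseI[where g = "mv n T"]) (simp add: Tc flip: mv_mm)
    then obtain h p s0 where kn: "k \<le> n" and "splits k n (n - k) c' h p s0"
      using splits_of_injective[OF c'(1)] by blast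
    \<comment> \<open>With T as the retraction, the section takes values in the kernel of T, which
      is stable under X because T is a morphism.\<close>
    from splits_change_retraction[OF this(2) T Tc]
    obtain s where S: "splits k n (n - k) c' h T s" by blast
    note D = splitsD[OF S] and Z = splits_zero[OF S]
    define e where "e = n - k"
    define X' where "X' = mm n h (mm n X s)"
    have X': "X' \<in> mats e e" using D X by (auto simp: X'_def e_def)
    have "mm e s X' = mm n (mm e s h) (mm n X s)" by (simp add: X'_def mm_assoc)
    also have "mm e s h = idm n - mm k c' T" using D(7) by (simp add: e_def eq_diff_eq add.commute)
    also have "mm n (idm n - mm k c' T) (mm n X s) = mm n X s - mm k c' (mm n (mm n T X) s)"
      using mm_idm_left[OF mats_mm[OF X D(4)]] by (simp add: mm_diff_left mm_assoc)
    also have "mm n (mm n T X) s = mm k J (mm n T s)"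
      using HomD(2)[OF T_hom] by (metis mm_assoc)
    finally have sX: "s \<in> Hom e X' n X" using Z D by (auto simp: e_def intro!: HomI)
    have nX': "nilp e X'"
      using sub_nilp[OF less.prems sX _ _ X'] D by (auto simp: e_def)
    obtain l P where l: "is_partition l" "sum_list l = e" and P: "P \<in> isos e (Jmat l) X'"
      using less.IH[OF _ nX'] False k0 by (auto simp: e_def)
    obtain Q where Q: "minv e P Q" "Q \<in> isos e X' (Jmat l)"
      using isos_inv[OF P] Jmat_mats[of l] X' l by metis
    have Jl: "Jmat l \<in> mats e e" using Jmat_mats[of l] l by simp
    \<comment> \<open>X^k = 0 passes to the complement, so no remaining block is longer than k and
      the new part may be put in front.\<close>
    have sorted: "\<forall>x\<in>set l. x \<le> k"
    proof (cases l)
      case (Cons a l')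
      have "a \<le> k"
      proof (rule ccontr)
        assume "\<not> a \<le> k"
        then have ka: "k < a" by simp
        have "mpow e X' k = mm n h (mm e s (mpow e X' k))"
          using cancel_left[OF D(6)[folded e_def] mpow_mats[OF X']] by simp
        also have "\<dots> = 0" using mpow_hom[OF sX, of k] Xk by (simp flip: e_def)
        finally have 0: "mpow e X' k = 0" .
        have "mpow e (Jmat l) k = mm e Q (mm e P (mpow e (Jmat l) k))"
          by (rule cancel_left[symmetric, OF minvD(4)[OF Q(1)] mpow_mats[OF Jl]])
        also have "\<dots> = 0" using mpow_hom[of P e "Jmat l" e X' k] P 0 by (simp add: isos_def)
        finally have "mpow e (Jmat l) k = (0 :: 'k mat)" .
        moreover have "mv (sum_list l) (mpow (sum_list l) (Jmat l) k) (unitv k) 0 = (1 :: 'k)"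
          using ka mv_mpow_Jmat[of "unitv k :: 'k vec" l k 0] Cons vecs_unitv[of k "sum_list l"] by (simp add: unitv_def)
        ultimately show False using l(2) by simp
      qed
      then show ?thesis using l Cons by (auto simp: is_partition_def)
    qed simp
    have n: "n = k + e" using kn by (simp add: e_def)
    have std: "splits k n e (idm k) (prj k e) (idm k) (inc k e :: 'k mat)"
      using std_splits n by simp
    have S': "splits k n e c' (mm e Q h) T (mm e s P)"
      using splits_change_quotient[OF S[folded e_def] Q(1)] .
    have "minv n (mm k c' (idm k) + mm e (mm e s P) (prj k e)) (mm k (idm k) T + mm e (inc k e) (mm e Q h))"
      (is "minv n ?R ?R'") by (rule splits_minv[OF S' std])
    moreover have "?R \<in> Hom n (Jmat (k # l)) n X"
    proof (rule HomI)
      have "mm n X ?R = mm k (mm n X c') (idm k) + mm e (mm e (mm n X s) P) (prj k e)"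
        by (simp add: mm_add_right mm_assoc)
      also have "\<dots> = mm k c' (mm k J (idm k)) + mm e s (mm e (mm e X' P) (prj k e))"
        using HomD(2)[OF c'(2)] HomD(2)[OF sX] by (simp add: mm_assoc)
      also have "\<dots> = mm k c' (mm n (idm k) (Jmat (k # l)))
          + mm e s (mm e P (mm n (prj k e) (Jmat (k # l))))"
      proof -
        have "mm e X' P = mm e P (Jmat l)" using P by (simp add: isos_def Hom_def)
        moreover have "mm k J (idm k) = mm n (idm k) (Jmat (k # l))"
          using Jmat_Cons_fst[of k l, where 'k = 'k] l(2) n by (simp add: J_def)
        moreover have "mm n (prj k e) (Jmat (k # l)) = mm e (Jmat l) (prj k e :: 'k mat)"
          using Jmat_Cons_snd[of k l, where 'k = 'k] l(2) n by simp
        ultimately show ?thesis by (simp only: mm_assoc)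
      qed
      finally show "mm n X ?R = mm n ?R (Jmat (k # l))"
        by (simp only: mm_add_left mm_assoc)
      show "?R \<in> mats n n"
        using minvD(1)[OF splits_minv[OF S' std]] .
    qed
    ultimately have "isos n (Jmat (k # l)) X \<noteq> {}" by (auto simp: isos_def)
    moreover have "is_partition (k # l)" "sum_list (k # l) = n"
      using l sorted k0 n by (auto simp: is_partition_def)
    ultimately show ?thesis by blast
  qed
qed

section \<open>Counting extensions\<close>

lemma finite_partitions_of [simp, intro]: "finite (partitions_of n)"
proof (rule finite_subset)
  have "length l \<le> sum_list l" if "\<forall>x\<in>set l. 0 < x" for l :: "nat list"
    using that by (induction l) auto
  then show "partitions_of n \<subseteq> {l. set l \<subseteq> {..n} \<and> length l \<le> n}"
    by (auto simp: partitions_of_def is_partition_def member_le_sum_list)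
  show "finite {l. set l \<subseteq> {..n} \<and> length l \<le> n}"
    by (rule finite_lists_length_le) simp
qed

lemma Jmat_partition: "mu \<in> partitions_of n \<Longrightarrow> Jmat mu \<in> mats n n"
  by (auto simp: partitions_of_def)

lemma homs_Hom: "homs lam mu = Hom (sum_list lam) (Jmat lam) (sum_list mu) (Jmat mu)"
proof (intro set_eqI iffI)
  fix M :: "'a mat" assume "M \<in> homs lam mu"
  then show "M \<in> Hom (sum_list lam) (Jmat lam) (sum_list mu) (Jmat mu)"
    unfolding homs_def by (auto intro!: HomI mats_eqI[where b = "sum_list mu"] simp: mv_mm)
next
  fix M :: "'a mat" assume M: "M \<in> Hom (sum_list lam) (Jmat lam) (sum_list mu) (Jmat mu)"
  show "M \<in> homs lam mu"
    using HomD[OF M] by (auto simp: homs_def simp flip: mv_mm)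
qed

lemma autos_isos: "autos lam = isos (sum_list lam) (Jmat lam) (Jmat lam)"
  unfolding autos_def isos_def homs_Hom
proof (intro Collect_cong conj_cong refl)
  fix M :: "'a mat" assume "M \<in> Hom (sum_list lam) (Jmat lam) (sum_list lam) (Jmat lam)"
  then show "bij_betw (mv (sum_list lam) M) (vecs (sum_list lam)) (vecs (sum_list lam))
      \<longleftrightarrow> (\<exists>Q. minv (sum_list lam) M Q)"
    using minv_bij bij_minv HomD(1) by metis
qed

lemma a_num_isos: "a_num (K :: 'k::{field,finite} itself) lam
    = card (isos (sum_list lam) (Jmat lam) (Jmat lam :: 'k mat))"
  by (simp add: a_num_def autos_isos)

lemma idm_isos: "X \<in> mats n n \<Longrightarrow> idm n \<in> isos n X X"
  using minv_idm by (auto simp: isos_def Hom_def)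

lemma a_num_pos: "0 < a_num (K :: 'k::{field,finite} itself) lam"
  unfolding a_num_isos using idm_isos[OF Jmat_mats] by (auto simp: card_gt_0_iff)

lemma jordan_type:
  fixes K :: "'k::{field,finite} itself" and X :: "'k mat"
  assumes "nilp n X"
  obtains lam where "lam \<in> partitions_of n" "isos n (Jmat lam) X \<noteq> {}"
    "\<And>mu. mu \<in> partitions_of n \<Longrightarrow> card (isos n (Jmat mu) X) = (if mu = lam then a_num K mu else 0)"
proof -
  have X: "X \<in> mats n n" using assms by (simp add: nilp_def)
  obtain lam P where lam: "is_partition lam" "sum_list lam = n" "P \<in> isos n (Jmat lam) X"
    using jordan_exists[OF assms] by blast
  have J: "(Jmat mu :: 'k mat) \<in> mats n n" if "sum_list mu = n" for mu
    using Jmat_mats[of mu] that by simp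
  obtain Q where Q: "Q \<in> isos n X (Jmat lam)" using isos_inv[OF lam(3) J X] lam by blast
  have "card (isos n (Jmat mu) X) = (if mu = lam then a_num K mu else 0)" if mu: "mu \<in> partitions_of n" for mu
  proof (cases "mu = lam")
    case True
    then show ?thesis
      using card_isos_comp_left[OF lam(3) J X] lam by (simp add: a_num_isos)
  next
    case False
    have "isos n (Jmat mu) X = {}"
    proof (rule ccontr)
      assume "isos n (Jmat mu) X \<noteq> {}"
      then obtain R where "R \<in> isos n (Jmat mu) X" by blast
      from isos_comp[OF this Q] show False
        using jordan_unique[of mu lam n] mu lam False by (auto simp: partitions_of_def)
    qed
    then show ?thesis using False by simp
  qed
  then show ?thesis using that lam by (auto simp: partitions_of_def)
qed

text \<open>Only the Jordan type of X contributes: its isomorphisms to X form a torsor under its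
  automorphisms, so the quotient of cardinalities is 1. This trades sums over partitions weighted by
  \<open>1/a_num\<close> for sums over matrices.\<close>

lemma sum_over_iso_class:
  fixes K :: "'k::{field,finite} itself" and X :: "'k mat" and F :: "nat \<Rightarrow> complex"
  assumes "nilp n X"
  shows "(\<Sum>mu\<in>partitions_of n. F (length mu) * of_nat (card (isos n (Jmat mu) X)) / of_nat (a_num K mu))
    = F (nul n X)"
proof -
  obtain lam where lam: "lam \<in> partitions_of n" "isos n (Jmat lam) X \<noteq> {}"
    "\<And>mu. mu \<in> partitions_of n \<Longrightarrow> card (isos n (Jmat mu) X) = (if mu = lam then a_num K mu else 0)"
    using jordan_type[OF assms] by metis
  have "(\<Sum>mu\<in>partitions_of n. F (length mu) * of_nat (card (isos n (Jmat mu) X)) / of_nat (a_num K mu))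
    = (\<Sum>mu\<in>partitions_of n. if mu = lam then F (length lam) else 0)"
    using lam(3) a_num_pos[of K] by (intro sum.cong) auto
  also have "\<dots> = F (length lam)" using lam(1) by simp
  also have "length lam = nul n X"
    using lam(1,2) nul_iso[of _ n "Jmat lam" X] nul_Jmat[of lam, where 'k = 'k] Jmat_mats[of lam, where 'a = 'k] assms
    by (force simp: partitions_of_def nilp_def)
  finally show ?thesis .
qed

section \<open>Short exact sequences as off-diagonal blocks\<close>

definition SES :: "nat \<Rightarrow> 'k::field mat \<Rightarrow> nat \<Rightarrow> 'k mat \<Rightarrow> nat \<Rightarrow> 'k mat \<Rightarrow> ('k mat \<times> 'k mat) set" where
  "SES d D n X e E = {(f, h). f \<in> Hom d D n X \<and> h \<in> Hom n X e E \<and> ses d n e f h}"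

lemma finite_SES [simp, intro]: "finite (SES d D n X e (E :: 'k::{field,finite} mat))"
  by (rule finite_subset[of _ "mats n d \<times> mats e n"]) (auto simp: SES_def Hom_def)

text \<open>The block matrix with rows \<open>(D, C)\<close> and \<open>(0, E)\<close>.\<close>
definition blk :: "nat \<Rightarrow> nat \<Rightarrow> 'k::field mat \<Rightarrow> 'k mat \<Rightarrow> 'k mat \<Rightarrow> 'k mat" where
  "blk d e D C E = mm d (idm d) (mm d D (idm d)) + mm d (idm d) (mm e C (prj d e))
     + mm e (inc d e) (mm e E (prj d e))"

lemma blk:
  fixes D C E :: "'k::field mat"
  assumes "D \<in> mats d d" "C \<in> mats d e" "E \<in> mats e e"
  shows "blk d e D C E \<in> mats (d + e) (d + e)"
    and "mm (d + e) (blk d e D C E) (idm d) = mm d (idm d) D"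
    and "mm (d + e) (prj d e) (blk d e D C E) = mm e E (prj d e)"
    and "mm (d + e) (mm (d + e) (idm d) (blk d e D C E)) (inc d e) = C"
    and "mm (d + e) (idm d) (blk d e D C E) = mm d D (idm d) + mm e C (prj d e)"
proof -
  note S = splitsD[OF std_splits[of d e, where 'k = 'k]] and Z = splits_zero[OF std_splits[of d e, where 'k = 'k]]
  show "blk d e D C E \<in> mats (d + e) (d + e)"
    unfolding blk_def using S assms by (intro mats_add mats_mm)
  show "mm (d + e) (blk d e D C E) (idm d) = mm d (idm d) D"
    unfolding blk_def mm_add_left mm_assoc S(5) Z(1) by (simp add: mm_idm_right[OF assms(1)])
  have l: "mm (d + e) (idm d) (mm d (idm d) A) = A" "mm (d + e) (prj d e) (mm d (idm d) A) = 0" if "A \<in> mats d b" for A :: "'k mat" and b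
    using that by (metis mm_assoc S(5) mm_idm_left) (metis mm_assoc Z(1) mm_zero_left)
  have r: "mm (d + e) (prj d e) (mm e (inc d e) A) = A" "mm (d + e) (idm d) (mm e (inc d e) A) = 0" if "A \<in> mats e b" for A :: "'k mat" and b
    using that by (metis mm_assoc S(6) mm_idm_left) (metis mm_assoc Z(2) mm_zero_left)
  have m: "mm d D (idm d) \<in> mats d (d + e)" "mm e C (prj d e) \<in> mats d (d + e)" "mm e E (prj d e) \<in> mats e (d + e)"
    by (rule mats_mm[OF assms(1) S(3)] mats_mm[OF assms(2) S(2)] mats_mm[OF assms(3) S(2)])+
  show "mm (d + e) (prj d e) (blk d e D C E) = mm e E (prj d e)"
    unfolding blk_def mm_add_right l(2)[OF m(1)] l(2)[OF m(2)] r(1)[OF m(3)] by simp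
  show "mm (d + e) (idm d) (blk d e D C E) = mm d D (idm d) + mm e C (prj d e)"
    unfolding blk_def mm_add_right l(1)[OF m(1)] l(1)[OF m(2)] r(2)[OF m(3)] by simp
  then show "mm (d + e) (mm (d + e) (idm d) (blk d e D C E)) (inc d e) = C"
    by (simp only: mm_add_left mm_assoc S(6) Z(2) mm_idm_right[OF assms(2)]) simp
qed

lemma blk_Hom:
  fixes D C E :: "'k::field mat"
  assumes "D \<in> mats d d" "C \<in> mats d e" "E \<in> mats e e"
  shows "idm d \<in> Hom d D (d + e) (blk d e D C E)" "prj d e \<in> Hom (d + e) (blk d e D C E) e E"
  using blk[OF assms] splitsD[OF std_splits[of d e, where 'k = 'k]] by (auto intro: HomI)

lemma nilp_blk:
  fixes D C E :: "'k::field mat"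
  assumes "nilp d D" "C \<in> mats d e" "nilp e E"
  shows "nilp (d + e) (blk d e D C E)"
proof -
  have m: "D \<in> mats d d" "E \<in> mats e e" using assms by (auto simp: nilp_def)
  show ?thesis
    using ext_nilp[OF std_splits assms(1,3) blk(1)[OF m(1) assms(2) m(2)] blk_Hom[OF m(1) assms(2) m(2)]] .
qed

text \<open>Two retractions of f differ by a map that kills f, that is, by \<open>mm e c h\<close>
  for a unique c.\<close>

lemma card_retractions:
  fixes f :: "'k::{field,finite} mat"
  assumes "splits d n e f h p s"
  shows "card {p'. p' \<in> mats d n \<and> mm n p' f = idm d} = CARD('k) ^ (d * e)"
proof -
  note S = splitsD[OF assms] and Z = splits_zero[OF assms]
  have "bij_betw (\<lambda>c. p + mm e c h) (mats d e) {p'. p' \<in> mats d n \<and> mm n p' f = idm d}"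
  proof (rule bij_betw_byWitness[where f' = "\<lambda>p'. mm n (p' - p) s"])
    show "\<forall>a\<in>mats d e. mm n (p + mm e a h - p) s = a"
      using S by (simp add: mm_assoc)
    show "\<forall>a\<in>{p'. p' \<in> mats d n \<and> mm n p' f = idm d}. p + mm e (mm n (a - p) s) h = a"
    proof
      fix a assume a: "a \<in> {p'. p' \<in> mats d n \<and> mm n p' f = idm d}"
      have "a - p = mm n (a - p) (mm d f p + mm e s h)" using a S mm_idm_right[OF mats_diff[OF _ S(3)], of a] by simp
      also have "\<dots> = mm d (mm n (a - p) f) p + mm e (mm n (a - p) s) h"
        by (simp add: mm_add_right mm_assoc)
      also have "\<dots> = mm e (mm n (a - p) s) h" using a S by (simp add: mm_diff_left)
      finally have eq: "a - p = mm e (mm n (a - p) s) h" .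
      show "p + mm e (mm n (a - p) s) h = a" unfolding eq[symmetric] by simp
    qed
    show "(\<lambda>c. p + mm e c h) ` mats d e \<subseteq> {p'. p' \<in> mats d n \<and> mm n p' f = idm d}"
      using S Z by (auto simp: mm_add_left mm_assoc)
    show "(\<lambda>p'. mm n (p' - p) s) ` {p'. p' \<in> mats d n \<and> mm n p' f = idm d} \<subseteq> mats d e"
      using S by auto
  qed
  from bij_betw_same_card[OF this] show ?thesis by (simp add: card_mats)
qed

text \<open>The two block rows of an isomorphism P onto a block matrix are a retraction and a
  quotient map, and the first d columns of its inverse form the matching inclusion. Conversely, a
  sequence with a chosen retraction determines P and the corner C. Counting such P by C gives the
  left side, counting by sequences gives the right.\<close>

lemma card_extensions:
  fixes D E X :: "'k::{field,finite} mat"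
  assumes D: "D \<in> mats d d" and E: "E \<in> mats e e" and X: "X \<in> mats (d + e) (d + e)"
  shows "(\<Sum>C\<in>mats d e. card (isos (d + e) X (blk d e D C E)))
    = CARD('k) ^ (d * e) * card (SES d D (d + e) X e E)"
proof -
  define n where "n = d + e"
  have ST: "splits d n e (idm d) (prj d e) (idm d) (inc d e :: 'k mat)"
    unfolding n_def by (rule std_splits)
  note S = splitsD[OF ST] and Z = splits_zero[OF ST]
  let ?i = "idm d :: 'k mat" and ?p = "prj d e :: 'k mat" and ?s = "inc d e :: 'k mat"
  define U where "U = (\<Union>C\<in>mats d e. isos n X (blk d e D C E))"
  define T where "T = (SIGMA fh:SES d D n X e E. {p'. p' \<in> mats d n \<and> mm n p' (fst fh) = idm d})"
  define iv where "iv P = (SOME Q. minv n P Q)" for P :: "'k mat"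
  have iv: "minv n P (iv P)" if "P \<in> isos n X Y" for P Y
    using that someI_ex[of "minv n P"] unfolding iv_def isos_def by blast
  have B: "blk d e D C E \<in> mats n n" "mm n (blk d e D C E) ?i = mm d ?i D"
    "mm n ?p (blk d e D C E) = mm e E ?p" "mm n (mm n ?i (blk d e D C E)) ?s = C"
    if "C \<in> mats d e" for C
    using blk[OF D that E] by (simp_all add: n_def)
  have "card U = (\<Sum>C\<in>mats d e. card (isos n X (blk d e D C E)))"
    unfolding U_def
  proof (rule card_UN_disjoint)
    \<comment> \<open>P determines its target P X P^(-1), and the corner of the target is C.\<close>
    show "\<forall>C\<in>mats d e. \<forall>C'\<in>mats d e. C \<noteq> C' \<longrightarrow> isos n X (blk d e D C E) \<inter> isos n X (blk d e D C' E) = {}"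
    proof (intro ballI impI equals0I)
      fix C C' P assume C: "C \<in> mats d e" "C' \<in> mats d e" "C \<noteq> C'"
        and P: "P \<in> isos n X (blk d e D C E) \<inter> isos n X (blk d e D C' E)"
      then obtain Q where Q: "minv n P Q" by (auto simp: isos_def)
      have "mm n (blk d e D C E) P = mm n (blk d e D C' E) P" using P by (auto simp: isos_def Hom_def)
      then have "mm n (mm n (blk d e D C E) P) Q = mm n (mm n (blk d e D C' E) P) Q" by simp
      then have "blk d e D C E = blk d e D C' E"
        using cancel_right[OF minvD(3)[OF Q] B(1)[OF C(1)]] cancel_right[OF minvD(3)[OF Q] B(1)[OF C(2)]] by simp
      then show False using B(4)[OF C(1)] B(4)[OF C(2)] C(3) by simp
    qed
  qed auto
  moreover have "bij_betw (\<lambda>P. ((mm n (iv P) ?i, mm n ?p P), mm n ?i P)) U T"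
    unfolding bij_betw_def
  proof
    show "inj_on (\<lambda>P. ((mm n (iv P) ?i, mm n ?p P), mm n ?i P)) U"
    proof (rule inj_on_inverseI[where g = "\<lambda>x :: ('k mat \<times> 'k mat) \<times> 'k mat. mm d ?i (snd x) + mm e ?s (snd (fst x))"])
      fix P assume "P \<in> U"
      then have "P \<in> mats n n" by (auto simp: U_def isos_def Hom_def)
      then have "mm n (mm d ?i ?i + mm e ?s ?p) P = P" unfolding S(7) by simp
      then show "mm d ?i (snd ((mm n (iv P) ?i, mm n ?p P), mm n ?i P))
          + mm e ?s (snd (fst ((mm n (iv P) ?i, mm n ?p P), mm n ?i P))) = P"
        by (simp only: prod.sel mm_add_left mm_assoc)
    qed
    show "(\<lambda>P. ((mm n (iv P) ?i, mm n ?p P), mm n ?i P)) ` U = T"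
    proof (intro equalityI subsetI)
      fix x assume "x \<in> (\<lambda>P. ((mm n (iv P) ?i, mm n ?p P), mm n ?i P)) ` U"
      then obtain P C where x: "x = ((mm n (iv P) ?i, mm n ?p P), mm n ?i P)" and C: "C \<in> mats d e"
        and P: "P \<in> isos n X (blk d e D C E)" by (auto simp: U_def)
      note I = iv[OF P]
      have nX: "X \<in> mats n n" using X by (simp add: n_def)
      have PH: "P \<in> Hom n X n (blk d e D C E)" using P by (simp add: isos_def)
      have QH: "iv P \<in> Hom n (blk d e D C E) n X" using Hom_inv[OF PH I nX B(1)[OF C]] .
      have iH: "?i \<in> Hom d D n (blk d e D C E)" "?p \<in> Hom n (blk d e D C E) e E"
        using S B[OF C] by (auto intro: HomI)
      have sp: "splits d n e (mm n (iv P) ?i) (mm n ?p P) (mm n ?i P) (mm n (iv P) ?s)"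
        by (rule splits_transport[OF ST minv_sym[OF I]])
      show "x \<in> T"
        using splitsD[OF sp] splits_ses[OF sp] Hom_comp[OF iH(1) QH] Hom_comp[OF PH iH(2)]
        by (auto simp: x T_def SES_def)
    next
      fix x assume "x \<in> T"
      then obtain f h p where x: "x = ((f, h), p)" and f: "f \<in> Hom d D n X" and h: "h \<in> Hom n X e E"
        and "ses d n e f h" and p: "p \<in> mats d n" "mm n p f = idm d"
        by (auto simp: T_def SES_def)
      then obtain p1 s1 where "splits d n e f h p1 s1" using ses_splits by blast
      from splits_change_retraction[OF this p] obtain s where sp: "splits d n e f h p s" by blast
      note D' = splitsD[OF sp] and Z' = splits_zero[OF sp]
      define P where "P = mm d ?i p + mm e ?s h"
      define Q where "Q = mm d f ?i + mm e s ?p"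
      have PQ: "minv n P Q" unfolding P_def Q_def by (rule splits_minv[OF ST sp])
      \<comment> \<open>In the coordinates given by p and h, the matrix of X has D and E on the
        diagonal and 0 below; the remaining corner is p X s.\<close>
      define C where "C = mm n (mm n p X) s"
      have C: "C \<in> mats d e" unfolding C_def by (rule mats_mm[OF mats_mm[OF D'(3) X] D'(4)])
      have pX: "mm n p X = mm d D p + mm e C h"
      proof -
        have "mm n p X = mm n (mm n p X) (mm d f p + mm e s h)"
          using D' X by (simp add: n_def mm_idm_right[OF mats_mm])
        also have "\<dots> = mm d (mm n p (mm n X f)) p + mm e C h"
          by (simp add: mm_add_right mm_assoc C_def)
        also have "\<dots> = mm d (mm d (mm n p f) D) p + mm e C h"
          using HomD(2)[OF f] by (simp only: mm_assoc)
        finally show ?thesis using D' D by simp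
      qed
      have bP: "mm n ?i P = p" "mm n ?p P = h"
      proof -
        have "mm n ?i P = mm d (mm n ?i ?i) p + mm e (mm n ?i ?s) h" by (simp only: P_def mm_add_right mm_assoc)
        also have "\<dots> = p" unfolding S(5) Z(2) using D' by simp
        finally show "mm n ?i P = p" .
        have "mm n ?p P = mm d (mm n ?p ?i) p + mm e (mm n ?p ?s) h" by (simp only: P_def mm_add_right mm_assoc)
        also have "\<dots> = h" unfolding S(6) Z(1) using D' by simp
        finally show "mm n ?p P = h" .
      qed
      have "mm n (blk d e D C E) P = mm d ?i (mm d D p) + mm d ?i (mm e C h) + mm e ?s (mm e E h)"
        by (simp only: blk_def mm_add_left mm_assoc bP)
      also have "\<dots> = mm d ?i (mm n p X) + mm e ?s (mm n h X)"
        using HomD(2)[OF h] by (simp add: pX mm_add_right)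
      also have "\<dots> = mm n P X" by (simp add: P_def mm_add_left mm_assoc)
      finally have "P \<in> Hom n X n (blk d e D C E)" using minvD(1)[OF PQ] by (auto intro: HomI)
      then have P: "P \<in> isos n X (blk d e D C E)" using PQ by (auto simp: isos_def)
      have "iv P = Q" using minv_unique[OF iv[OF P] PQ] .
      moreover have "mm n Q ?i = f"
      proof -
        have "mm n Q ?i = mm d f (mm n ?i ?i) + mm e s (mm n ?p ?i)" by (simp only: Q_def mm_add_left mm_assoc)
        also have "\<dots> = f" unfolding S(5) Z(1) using D' by simp
        finally show ?thesis .
      qed
      ultimately have "x = ((mm n (iv P) ?i, mm n ?p P), mm n ?i P)" using x bP by simp
      moreover have "P \<in> U" using P C by (auto simp: U_def)
      ultimately show "x \<in> (\<lambda>P. ((mm n (iv P) ?i, mm n ?p P), mm n ?i P)) ` U" by blast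
    qed
  qed
  then have "card U = card T" by (rule bij_betw_same_card)
  moreover have "card T = CARD('k) ^ (d * e) * card (SES d D n X e E)"
  proof -
    have "card {p'. p' \<in> mats d n \<and> mm n p' (fst fh) = idm d} = CARD('k) ^ (d * e)"
      if "fh \<in> SES d D n X e E" for fh
    proof -
      from that have "ses d n e (fst fh) (snd fh)" by (auto simp: SES_def)
      then obtain p s where "splits d n e (fst fh) (snd fh) p s" using ses_splits by blast
      then show ?thesis by (rule card_retractions)
    qed
    then show ?thesis unfolding T_def by (subst card_SigmaI) auto
  qed
  ultimately show ?thesis by (simp add: n_def)
qed

text \<open>The division by q^(de) makes the right side the mean of F over a uniformly random
  off-diagonal block. It combines the torsor count with the fact that every block matrix has exactly
  one Jordan type.\<close>

lemma extension_sum: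
  fixes K :: "'k::{field,finite} itself" and D E :: "'k mat" and F :: "nat \<Rightarrow> complex"
  assumes D: "nilp d D" and E: "nilp e E"
  shows "(\<Sum>mu\<in>partitions_of (d + e).
      F (length mu) * of_nat (card (SES d D (d + e) (Jmat mu) e E)) / of_nat (a_num K mu))
    = (\<Sum>C\<in>mats d e. F (nul (d + e) (blk d e D C E))) / of_nat CARD('k) ^ (d * e)"
proof -
  let ?n = "d + e" and ?q = "of_nat CARD('k) :: complex"
  have m: "D \<in> mats d d" "E \<in> mats e e" using D E by (auto simp: nilp_def)
  have q: "?q \<noteq> 0" by simp
  have "?q ^ (d * e) * of_nat (card (SES d D ?n (Jmat mu) e E))
      = (\<Sum>C\<in>mats d e. of_nat (card (isos ?n (Jmat mu) (blk d e D C E))))" if "mu \<in> partitions_of ?n" for mu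
  proof -
    have "(Jmat mu :: 'k mat) \<in> mats ?n ?n" using that by (rule Jmat_partition)
    from arg_cong[OF card_extensions[OF m this], of "of_nat :: nat \<Rightarrow> complex"] show ?thesis by simp
  qed
  then have "?q ^ (d * e) * (\<Sum>mu\<in>partitions_of ?n.
      F (length mu) * of_nat (card (SES d D ?n (Jmat mu) e E)) / of_nat (a_num K mu))
    = (\<Sum>mu\<in>partitions_of ?n. \<Sum>C\<in>mats d e.
        F (length mu) * of_nat (card (isos ?n (Jmat mu) (blk d e D C E))) / of_nat (a_num K mu))"
    unfolding sum_distrib_left sum_divide_distrib[symmetric]
    by (intro sum.cong refl) (simp add: mult.left_commute flip: sum_distrib_left)
  also have "\<dots> = (\<Sum>C\<in>mats d e. F (nul ?n (blk d e D C E)))"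
    by (subst sum.swap) (simp add: sum_over_iso_class nilp_blk[OF D _ E])
  finally show ?thesis using q by (simp add: field_simps)
qed

section \<open>Primitivity\<close>

lemma blk_kernel_iff:
  fixes D C E :: "'k::field mat"
  assumes m: "D \<in> mats d d" "C \<in> mats d e" "E \<in> mats e e"
  shows "mv (d + e) (blk d e D C E) v = 0 \<longleftrightarrow>
    mv d D (mv (d + e) (idm d) v) + mv e C (mv (d + e) (prj d e) v) = 0 \<and> mv e E (mv (d + e) (prj d e) v) = 0"
proof -
  note S = splitsD[OF std_splits[of d e, where 'k = 'k]]
  define w where "w = mv (d + e) (blk d e D C E) v"
  have w: "w \<in> vecs (d + e)" unfolding w_def by (rule mv_vecs[OF blk(1)[OF m]])
  have "w = mv (d + e) (mm d (idm d) (idm d) + mm e (inc d e) (prj d e)) w"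
    unfolding S(7) using w by simp
  then have "w = mv d (idm d) (mv (d + e) (idm d) w) + mv e (inc d e) (mv (d + e) (prj d e) w)"
    by (simp only: mv_add_mat mv_mm)
  then have "w = 0 \<longleftrightarrow> mv (d + e) (idm d) w = 0 \<and> mv (d + e) (prj d e) w = 0"
    by (metis add_0 mv_zero)
  also have "mv (d + e) (idm d) w = mv d D (mv (d + e) (idm d) v) + mv e C (mv (d + e) (prj d e) v)"
    unfolding w_def mv_mm[symmetric] blk(5)[OF m] by (simp only: mv_add_mat)
  also have "mv (d + e) (prj d e) w = mv e E (mv (d + e) (prj d e) v)"
    unfolding w_def mv_mm[symmetric] blk(3)[OF m] ..
  finally show ?thesis by (simp only: w_def)
qed

text \<open>Project the kernel to the last e coordinates. The fibre over 0 is the kernel of D, and y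
  in the kernel of E lifts exactly if D can compensate C y, that is, if C y lies in the image of
  D.\<close>

lemma card_kernel_blk:
  fixes D C E :: "'k::{field,finite} mat"
  assumes m: "D \<in> mats d d" "C \<in> mats d e" "E \<in> mats e e"
  shows "card {v \<in> vecs (d + e). mv (d + e) (blk d e D C E) v = 0}
    = card {y \<in> vecs e. mv e E y = 0 \<and> mv e C y \<in> mv d D ` vecs d} * card {x \<in> vecs d. mv d D x = 0}"
proof -
  let ?n = "d + e" and ?A = "{v \<in> vecs (d + e). mv (d + e) (blk d e D C E) v = 0}"
  note S = splitsD[OF std_splits[of d e, where 'k = 'k]] and Z = splits_zero[OF std_splits[of d e, where 'k = 'k]]
  have tr: "mv ?n (idm d) (mv d (idm d) x) = x" "mv ?n (prj d e) (mv d (idm d) x) = 0"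
    if "x \<in> vecs d" for x :: "'k vec"
    using that by (metis mv_mm mv_idm S(5)) (metis mv_mm mv_zero_mat Z(1))
  have pr: "mv ?n (prj d e) (mv e (inc d e) y) = y" "mv ?n (idm d) (mv e (inc d e) y) = 0"
    if "y \<in> vecs e" for y :: "'k vec"
    using that by (metis mv_mm mv_idm S(6)) (metis mv_mm mv_zero_mat Z(2))
  have "card ?A = card (mv ?n (prj d e) ` ?A) * card {v \<in> ?A. mv ?n (prj d e) v = 0}"
    by (rule card_image_times_kernel) (auto simp: mv_add mv_diff)
  also have "mv ?n (prj d e) ` ?A = {y \<in> vecs e. mv e E y = 0 \<and> mv e C y \<in> mv d D ` vecs d}"
  proof (intro equalityI subsetI)
    fix y assume "y \<in> mv ?n (prj d e) ` ?A"
    then obtain v where v: "v \<in> ?A" "y = mv ?n (prj d e) v" by blast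
    let ?x = "mv ?n (idm d) v"
    have 1: "mv d D ?x + mv e C y = 0" "mv e E y = 0" using v blk_kernel_iff[OF m] by auto
    then have "mv e C y = mv d D (0 - ?x)"
      unfolding mv_diff by (simp add: add_eq_0_iff)
    moreover have "0 - ?x \<in> vecs d" using S(3) by (intro vecs_diff mv_vecs vecs_zero)
    ultimately show "y \<in> {y \<in> vecs e. mv e E y = 0 \<and> mv e C y \<in> mv d D ` vecs d}"
      using 1 v S(2) by blast
  next
    fix y assume "y \<in> {y \<in> vecs e. mv e E y = 0 \<and> mv e C y \<in> mv d D ` vecs d}"
    then obtain z where y: "y \<in> vecs e" "mv e E y = 0" and z: "z \<in> vecs d" "mv e C y = mv d D z" by blast
    define v where "v = mv d (idm d) (0 - z) + mv e (inc d e) y"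
    have zz: "0 - z \<in> vecs d" using z by (intro vecs_diff vecs_zero)
    have v1: "mv ?n (idm d) v = 0 - z" "mv ?n (prj d e) v = y"
      unfolding v_def mv_add using tr[OF zz] pr[OF y(1)] by simp_all
    have "v \<in> vecs ?n" unfolding v_def using S by blast
    moreover have "mv ?n (blk d e D C E) v = 0"
      unfolding blk_kernel_iff[OF m] v1 mv_diff using y z by simp
    ultimately show "y \<in> mv ?n (prj d e) ` ?A" using v1 by blast
  qed
  also have "{v \<in> ?A. mv ?n (prj d e) v = 0} = {x \<in> vecs d. mv d D x = 0}"
  proof (intro equalityI subsetI)
    fix v assume v: "v \<in> {v \<in> ?A. mv ?n (prj d e) v = 0}"
    then have "v = mv ?n (mm d (idm d) (idm d) + mm e (inc d e) (prj d e)) v" unfolding S(7) by simp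
    then have v': "v = mv d (idm d) (mv ?n (idm d) v)" using v by (simp only: mv_add_mat mv_mm) simp
    then have vd: "v \<in> vecs d" by (metis mv_vecs mats_idm)
    then have "mv ?n (idm d) v = v" using tr(1)[of v] by simp
    moreover have "mv d D (mv ?n (idm d) v) + mv e C (mv ?n (prj d e) v) = 0" "mv ?n (prj d e) v = 0"
      using v blk_kernel_iff[OF m, of v] by auto
    ultimately show "v \<in> {x \<in> vecs d. mv d D x = 0}" using vd by simp
  next
    fix x assume x: "x \<in> {x \<in> vecs d. mv d D x = 0}"
    then have "mv ?n (idm d) x = x" "mv ?n (prj d e) x = 0" using tr[of x] by simp_all
    then show "x \<in> {v \<in> ?A. mv ?n (prj d e) v = 0}"
      using x vecs_mono[of d ?n] blk_kernel_iff[OF m, of x] by auto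
  qed
  finally show ?thesis .
qed

section \<open>Randomising the off-diagonal block column by column\<close>

definition solutions :: "nat set \<Rightarrow> nat \<Rightarrow> 'k::field mat \<Rightarrow> 'k vec set \<Rightarrow> 'k vec set" where
  "solutions S e C I = {y \<in> suppv S. mv e C y \<in> I}"

definition single_col :: "'k::field vec \<Rightarrow> nat \<Rightarrow> 'k mat" where
  "single_col w v = (\<lambda>i j. if j = v then w i else 0)"

lemma mv_single_col: "v < e \<Longrightarrow> mv e (single_col w v) y = (\<lambda>i. y v * w i)"
proof
  fix i assume v: "v < e"
  have "mv e (single_col w v) y i = (\<Sum>j<e. if j = v then w i * y j else 0)"
    unfolding mv_def single_col_def by (rule sum.cong) auto
  then show "mv e (single_col w v) y i = y v * w i" using v by simp
qed

lemma single_col_mats: "w \<in> vecs d \<Longrightarrow> v < e \<Longrightarrow> single_col w v \<in> mats d e"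
  by (auto simp: single_col_def mats_def vecs_def)

lemma suppv_add: "u \<in> suppv S \<Longrightarrow> v \<in> suppv S \<Longrightarrow> u + v \<in> suppv S"
  and suppv_diff: "u \<in> suppv S \<Longrightarrow> v \<in> suppv S \<Longrightarrow> u - v \<in> suppv S"
  and suppv_zero: "0 \<in> suppv S"
  by (auto simp: suppv_def)

lemma finite_suppv: "finite S \<Longrightarrow> finite (suppv S :: 'k::{field,finite} vec set)"
  using card_suppv[of S, where 'k = 'k] q_ge_2[where 'k = 'k] by (intro card_ge_0_finite) simp

text \<open>The subspace C(k^S) + I. The solution space grows with a new coordinate exactly when the
  corresponding column falls into this set.\<close>

definition reach :: "nat set \<Rightarrow> nat \<Rightarrow> 'k::field mat \<Rightarrow> 'k vec set \<Rightarrow> 'k vec set" where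
  "reach S e C I = (\<lambda>(y, z). mv e C y + z) ` (suppv S \<times> I)"

text \<open>Abstracts the image of D, through which D enters the condition on C.\<close>

locale subspace_target =
  fixes I :: "'k::{field,finite} vec set" and d :: nat
  assumes I_sub: "I \<subseteq> vecs d"
    and I_zero: "0 \<in> I"
    and I_add: "x \<in> I \<Longrightarrow> y \<in> I \<Longrightarrow> x + y \<in> I"
    and I_scale: "x \<in> I \<Longrightarrow> (\<lambda>i. c * x i) \<in> I"
begin

lemma I_diff: "x \<in> I \<Longrightarrow> y \<in> I \<Longrightarrow> x - y \<in> I"
proof -
  assume "x \<in> I" "y \<in> I"
  then have "x + (\<lambda>i. (-1) * y i) \<in> I" by (intro I_add I_scale)
  moreover have "x + (\<lambda>i. (-1) * y i) = x - y" by (auto simp: fun_eq_iff)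
  ultimately show ?thesis by simp
qed

lemma finite_I: "finite I"
  using I_sub finite_vecs finite_subset by blast

text \<open>Counts the pairs (y, z) by the fibres of C y + z. The kernel consists of the pairs (y, -
  C y), one for each solution y.\<close>

lemma card_reach:
  assumes "finite S"
  shows "card (reach S e C I) * card (solutions S e C I) = CARD('k) ^ card S * card I"
proof -
  let ?A = "(suppv S :: 'k vec set) \<times> I" and ?F = "\<lambda>(y :: 'k vec, z). mv e C y + z"
  have "card ?A = card (?F ` ?A) * card {x \<in> ?A. ?F x = 0}"
  proof (rule card_image_times_kernel[where A = ?A and F = ?F])
    show "finite ?A" by (rule finite_cartesian_product[OF finite_suppv[OF assms] finite_I])
  qed (auto simp: suppv_add suppv_diff I_add I_diff mv_add)
  moreover have "bij_betw (\<lambda>y. (y, 0 - mv e C y)) (solutions S e C I) {x \<in> ?A. ?F x = 0}"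
  proof (rule bij_betw_byWitness[where f' = fst])
    show "\<forall>a\<in>{x \<in> ?A. ?F x = 0}. (fst a, 0 - mv e C (fst a)) = a"
      by (auto simp: add_eq_0_iff2)
    show "(\<lambda>y. (y, 0 - mv e C y)) ` solutions S e C I \<subseteq> {x \<in> ?A. ?F x = 0}"
      using I_diff[OF I_zero] by (auto simp: solutions_def)
    have "mv e C y \<in> I" if "z \<in> I" "mv e C y + z = 0" for y z
    proof -
      have "mv e C y = 0 - z" using that(2) by (simp add: add_eq_0_iff2)
      then show ?thesis using I_diff[OF I_zero that(1)] by simp
    qed
    then show "fst ` {x \<in> ?A. ?F x = 0} \<subseteq> solutions S e C I"
      by (auto simp: solutions_def)
  qed auto
  note bij_betw_same_card[OF this]
  ultimately show ?thesis
    using card_suppv[OF assms, where 'k = 'k] unfolding reach_def card_cartesian_product by simp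
qed

lemma reach_sub: "C \<in> mats d e \<Longrightarrow> reach S e C I \<subseteq> vecs d"
  using I_sub by (auto simp: reach_def)

text \<open>Evaluate the solutions at coordinate v. Value 0 leaves the solutions for S. A nonzero
  value can be scaled to 1, and a solution with y v = 1 expresses the new column C e_v + w through
  \<open>reach\<close>.\<close>

lemma card_solutions_insert:
  assumes S: "finite S" "v \<notin> S" "v < e" and C: "C \<in> mats d e" and w: "w \<in> vecs d"
  shows "card (solutions (insert v S) e (C + single_col w v) I)
    = (if mv e C (unitv v) + w \<in> reach S e C I then CARD('k) else 1) * card (solutions S e C I)"
proof -
  let ?C = "C + single_col w v" and ?A = "solutions (insert v S) e (C + single_col w v) I"
  let ?x = "mv e C (unitv v) + w"
  have mvC: "mv e ?C y = mv e C y + (\<lambda>i. y v * w i)" for y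
    using S(3) by (simp add: mv_add_mat mv_single_col)
  have "card ?A = card ((\<lambda>y. y v) ` ?A) * card {y \<in> ?A. y v = 0}"
  proof (rule card_image_times_kernel)
    have "finite (suppv (insert v S) :: 'k vec set)" using S by (simp add: finite_suppv)
    then show "finite ?A" by (rule finite_subset[rotated]) (auto simp: solutions_def)
  qed (auto simp: solutions_def suppv_add suppv_diff mv_add mv_diff I_add I_diff)
  moreover have "{y \<in> ?A. y v = 0} = solutions S e C I"
  proof -
    have "(\<lambda>i. y v * w i) = 0" if "y v = 0" for y using that by (simp add: fun_eq_iff)
    then show ?thesis unfolding solutions_def mvC by (auto simp: suppv_def S)
  qed
  moreover have "(\<lambda>y. y v) ` ?A = (if ?x \<in> reach S e C I then UNIV else {0})"
  proof (cases "?x \<in> reach S e C I")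
    case True
    then obtain y0 z0 where y0: "y0 \<in> suppv S" and z0: "z0 \<in> I" and x: "?x = mv e C y0 + z0"
      by (auto simp: reach_def)
    have "t \<in> (\<lambda>y. y v) ` ?A" for t
    \<comment> \<open>If the new column equals C y0 + z0, then e_v - y0 is a solution with
      coordinate 1 at v, and its multiples attain every value t.\<close>
    proof (rule image_eqI[of _ _ "\<lambda>i. t * (unitv v - y0) i"])
      let ?y = "(\<lambda>i. t * (unitv v - y0) i)"
      show "t = ?y v" using y0 S by (simp add: unitv_def suppv_def)
      have "mv e ?C ?y = (\<lambda>i. t * (?x - mv e C y0) i)"
        unfolding mvC mv_scale mv_diff using y0 S
        by (auto simp: fun_eq_iff unitv_def suppv_def algebra_simps)
      also have "?x - mv e C y0 = z0" using x by simp
      finally have "mv e ?C ?y \<in> I" by (simp only: I_scale[OF z0])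
      moreover have "?y \<in> suppv (insert v S)" using y0 by (auto simp: suppv_def unitv_def)
      ultimately show "?y \<in> ?A" by (simp add: solutions_def)
    qed
    then show ?thesis using True by auto
  next
    case False
    have "y v = 0" if y: "y \<in> ?A" for y
    proof (rule ccontr)
      assume nz: "y v \<noteq> 0"
      define t where "t = inverse (y v)"
      let ?y = "\<lambda>i. t * y i"
      have t: "t * y v = 1" using nz by (simp add: t_def)
      have "(\<lambda>i. t * mv e ?C y i) \<in> I" using y I_scale by (auto simp: solutions_def)
      then have 1: "mv e ?C ?y \<in> I" by (simp add: mv_scale)
      have "mv e ?C ?y = ?x - mv e C (unitv v - ?y)"
        unfolding mvC mv_diff using t by (auto simp: fun_eq_iff)
      then have "?x = mv e C (unitv v - ?y) + mv e ?C ?y" by simp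
      moreover have "unitv v - ?y \<in> suppv S"
        using y t by (auto simp: solutions_def suppv_def unitv_def)
      ultimately have "?x \<in> reach S e C I"
        unfolding reach_def using 1 by (intro image_eqI[of _ _ "(unitv v - ?y, mv e ?C ?y)"]) simp_all
      then show False using False by simp
    qed
    moreover have "0 \<in> ?A" using I_zero by (simp add: solutions_def suppv_zero)
    ultimately show ?thesis using False by force
  qed
  ultimately show ?thesis by (simp only: if_distrib[of card] card.insert card.empty) simp
qed

lemma card_good_columns:
  assumes "C \<in> mats d e"
  shows "card {w \<in> vecs d. mv e C (unitv v) + w \<in> reach S e C I} = card (reach S e C I)"
proof -
  let ?c = "mv e C (unitv v)"
  have c: "?c \<in> vecs d" using assms by blast
  have "bij_betw (\<lambda>w. ?c + w) {w \<in> vecs d. ?c + w \<in> reach S e C I} (reach S e C I)"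
  proof (rule bij_betw_byWitness[where f' = "\<lambda>x. x - ?c"])
    have "x - ?c \<in> vecs d" if "x \<in> reach S e C I" for x
      using that reach_sub[OF assms] c by blast
    then show "(\<lambda>x. x - ?c) ` reach S e C I \<subseteq> {w \<in> vecs d. ?c + w \<in> reach S e C I}" by auto
  qed auto
  then show ?thesis by (rule bij_betw_same_card)
qed

text \<open>Translation by a matrix supported in column v permutes all matrices, so adding an
  independent uniform column does not change the mean of G.\<close>

lemma sum_mats_column:
  fixes G :: "'k mat \<Rightarrow> complex"
  assumes "v < e"
  shows "of_nat CARD('k) ^ d * (\<Sum>C\<in>mats d e. G C)
    = (\<Sum>C\<in>mats d e. \<Sum>w\<in>vecs d. G (C + single_col w v))"
proof -
  have "(\<Sum>C\<in>mats d e. G (C + single_col w v)) = (\<Sum>C\<in>mats d e. G C)" if "w \<in> vecs d" for w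
  proof (rule sum.reindex_bij_betw)
    note W = single_col_mats[OF that assms]
    show "bij_betw (\<lambda>C. C + single_col w v) (mats d e) (mats d e)"
      by (rule bij_betw_byWitness[where f' = "\<lambda>C. C - single_col w v"]) (use W in auto)
  qed
  then show ?thesis by (subst sum.swap) (simp add: card_vecs)
qed

text \<open>Each further coordinate multiplies the count by q or by 1. This makes the later use of
  \<open>qlog\<close> legitimate.\<close>

lemma card_solutions_power:
  assumes "S \<subseteq> {..<e}" "C \<in> mats d e"
  shows "\<exists>l. card (solutions S e C I) = CARD('k) ^ l"
proof -
  have "finite S" using assms(1) finite_subset by blast
  then show ?thesis using assms
  proof (induction S arbitrary: C)
    case empty
    have "solutions {} e C I = {0}"
      using I_zero by (auto simp: solutions_def suppv_def fun_eq_iff)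
    then show ?case by (intro exI[of _ 0]) simp
  next
    case (insert v S)
    obtain l where l: "card (solutions S e C I) = CARD('k) ^ l" using insert by auto
    have "card (solutions (insert v S) e C I)
        = (if mv e C (unitv v) + 0 \<in> reach S e C I then CARD('k) else 1) * card (solutions S e C I)"
    proof -
      have "C + single_col 0 v = C" by (auto simp: single_col_def fun_eq_iff)
      then show ?thesis using card_solutions_insert[of S v e C 0] insert by simp
    qed
    then show ?case using l by (auto intro: exI[of _ l] exI[of _ "Suc l"])
  qed
qed

end

definition qlog :: "nat \<Rightarrow> nat \<Rightarrow> nat" where
  "qlog q x = (THE l. x = q ^ l)"

lemma qlog_power: "2 \<le> q \<Longrightarrow> qlog q (q ^ l) = l"
  unfolding qlog_def by (rule the_equality) auto

lemma qpoch_Suc: "qpoch q (Suc m) = qpoch q m * (1 - q ^ Suc m)"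
  by (simp add: qpoch_def)

context subspace_target
begin

text \<open>For fixed C with q^l solutions on S, exactly q^(d + card S - s - l) columns w are
  favourable, by \<open>card_reach\<close> and the codimension s of I. They raise the index of
  \<open>qpoch\<close> from s + l - 1 to s + l, a genuine step because s > 0. The gained term q^(s +
  l) cancels against the proportion of favourable w, so the mean factor is the same for every
  l.\<close>

lemma sum_qpoch_solutions_insert:
  assumes S: "finite S" "v \<notin> S" "insert v S \<subseteq> {..<e}" and s: "0 < s"
    and Is: "card I * CARD('k) ^ s = CARD('k) ^ d"
  defines "q \<equiv> of_nat CARD('k) :: complex"
    and "\<nu> \<equiv> \<lambda>S C. qlog CARD('k) (card (solutions S e C I))"
  shows "(\<Sum>C\<in>mats d e. qpoch q (s + \<nu> (insert v S) C - 1))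
    = (1 - q ^ card S) * (\<Sum>C\<in>mats d e. qpoch q (s + \<nu> S C - 1))"
proof -
  have v: "v < e" "S \<subseteq> {..<e}" using S by auto
  have q: "q \<noteq> 0" by (simp add: q_def)
  note q2 = q_ge_2[where 'k = 'k]
  have inner: "(\<Sum>w\<in>vecs d. qpoch q (s + \<nu> (insert v S) (C + single_col w v) - 1))
      = q ^ d * ((1 - q ^ card S) * qpoch q (s + \<nu> S C - 1))" if C: "C \<in> mats d e" for C
  proof -
    obtain l where l: "card (solutions S e C I) = CARD('k) ^ l"
      using card_solutions_power[OF v(2) C] by blast
    then have nu: "\<nu> S C = l" using q2 by (simp add: \<nu>_def qlog_power)
    define W where "W = {w \<in> vecs d. mv e C (unitv v) + w \<in> reach S e C I}"
    have W: "W \<subseteq> vecs d" "card W = card (reach S e C I)"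
      using card_good_columns[OF C] by (auto simp: W_def)
    have nu': "\<nu> (insert v S) (C + single_col w v) = (if w \<in> W then Suc l else l)" if w: "w \<in> vecs d" for w
    proof -
      have "card (solutions (insert v S) e (C + single_col w v) I) = CARD('k) ^ (if w \<in> W then Suc l else l)"
        using card_solutions_insert[OF S(1,2) v(1) C w] w l by (simp add: W_def)
      then show ?thesis by (simp only: \<nu>_def qlog_power[OF q2])
    qed
    have Wc: "of_nat (card W) * q ^ (s + l) = q ^ d * q ^ card S"
    proof -
      have "card W * CARD('k) ^ (s + l) = CARD('k) ^ d * CARD('k) ^ card S"
      proof -
        have "card W * CARD('k) ^ (s + l) = (card W * CARD('k) ^ l) * CARD('k) ^ s"
          by (simp add: power_add)
        also have "card W * CARD('k) ^ l = CARD('k) ^ card S * card I"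
          using card_reach[OF S(1), of e C] l W(2) by simp
        also have "\<dots> * CARD('k) ^ s = CARD('k) ^ d * CARD('k) ^ card S"
          using Is by simp
        finally show ?thesis .
      qed
      from arg_cong[OF this, of "of_nat :: nat \<Rightarrow> complex"] show ?thesis by (simp add: q_def)
    qed
    have "(\<Sum>w\<in>vecs d. qpoch q (s + \<nu> (insert v S) (C + single_col w v) - 1))
        = (\<Sum>w\<in>vecs d. if w \<in> W then qpoch q (s + l) else qpoch q (s + l - 1))"
      by (intro sum.cong) (auto simp: nu')
    also have "\<dots> = of_nat (card W) * qpoch q (s + l) + (q ^ d - of_nat (card W)) * qpoch q (s + l - 1)"
    proof -
      have "vecs d \<inter> {w. w \<in> W} = W" "card (vecs d \<inter> - {w. w \<in> W}) = card (vecs d :: 'k vec set) - card W"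
        using W(1) card_Diff_subset[OF finite_subset[OF W(1)], of "vecs d"] by (auto simp: Diff_eq)
      moreover have "card W \<le> card (vecs d :: 'k vec set)" using W(1) by (simp add: card_mono)
      ultimately show ?thesis
        by (simp add: sum.If_cases of_nat_diff card_vecs q_def)
    qed
    also have "\<dots> = of_nat (card W) * (qpoch q (s + l - 1) * (1 - q ^ (s + l)))
        + (q ^ d - of_nat (card W)) * qpoch q (s + l - 1)"
      using qpoch_Suc[of q "s + l - 1"] s by simp
    finally have "(\<Sum>w\<in>vecs d. qpoch q (s + \<nu> (insert v S) (C + single_col w v) - 1))
        = qpoch q (s + l - 1) * (q ^ d - of_nat (card W) * q ^ (s + l))"
      by (simp add: algebra_simps)
    then show ?thesis unfolding Wc nu by (simp add: algebra_simps)
  qed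
  have "q ^ d * (\<Sum>C\<in>mats d e. qpoch q (s + \<nu> (insert v S) C - 1))
      = q ^ d * ((1 - q ^ card S) * (\<Sum>C\<in>mats d e. qpoch q (s + \<nu> S C - 1)))"
    unfolding q_def sum_mats_column[OF v(1)] using inner[unfolded q_def]
    by (simp add: sum_distrib_left mult.assoc)
  then show ?thesis using q by simp
qed

text \<open>The first coordinate contributes the factor 1 - q^0 = 0, and the further ones only
  multiply this zero.\<close>

lemma sum_qpoch_solutions:
  assumes "S \<subseteq> {..<e}" "S \<noteq> {}" "0 < s" "card I * CARD('k) ^ s = CARD('k) ^ d"
  shows "(\<Sum>C\<in>mats d e. qpoch (of_nat CARD('k)) (s + qlog CARD('k) (card (solutions S e C I)) - 1)) = 0"
proof -
  have "finite S" using assms(1) finite_subset by blast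
  then show ?thesis using assms(2,1)
  proof (induction S rule: finite_ne_induct)
    case (singleton v)
    then show ?case using sum_qpoch_solutions_insert[of "{}" v e s] assms by simp
  next
    case (insert v S)
    then show ?case using sum_qpoch_solutions_insert[of S v e s] assms by simp
  qed
qed

end

lemma subspace_target_image:
  assumes "D \<in> mats d d"
  shows "subspace_target (mv d D ` vecs d :: 'k::{field,finite} vec set) d"
proof
  show "mv d D ` vecs d \<subseteq> vecs d" using assms by auto
  show "0 \<in> mv d D ` vecs d" by (metis image_eqI mv_zero vecs_zero)
  show "x + y \<in> mv d D ` vecs d" if "x \<in> mv d D ` vecs d" "y \<in> mv d D ` vecs d" for x y
    using that by (auto simp flip: mv_add)
  show "(\<lambda>i. c * x i) \<in> mv d D ` vecs d" if "x \<in> mv d D ` vecs d" for x c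
    using that by (auto simp flip: mv_scale)
qed

text \<open>The Jordan type of a map on a nonzero space has at least one block; this supplies the s
  > 0 on which the cancellation depends.\<close>

lemma card_kernel_nilp:
  fixes X :: "'k::{field,finite} mat"
  assumes "nilp n X" "0 < n"
  obtains s where "0 < s" "card {v \<in> vecs n. mv n X v = 0} = CARD('k) ^ s"
proof -
  obtain lam P where lam: "is_partition lam" "sum_list lam = n" "P \<in> isos n (Jmat lam) X"
    using jordan_exists[OF assms(1)] by blast
  have "(Jmat lam :: 'k mat) \<in> mats n n" using lam(2) Jmat_mats by blast
  then have "card {v \<in> vecs n. mv n X v = 0} = CARD('k) ^ length lam"
    using card_kernel_iso[OF lam(3)] assms(1) card_kernel_Jmat[OF lam(1), where 'k = 'k] lam(2)
    by (simp add: nilp_def)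
  moreover have "0 < length lam" using lam(2) assms(2) by (cases lam) auto
  ultimately show ?thesis using that by blast
qed

lemma nul_blk:
  fixes D C :: "'k::{field,finite} mat"
  assumes D: "D \<in> mats d d" "card {v \<in> vecs d. mv d D v = 0} = CARD('k) ^ s"
    and C: "C \<in> mats d (sum_list be)"
  shows "nul (d + sum_list be) (blk d (sum_list be) D C (Jmat be))
    = s + qlog CARD('k) (card (solutions (heads (Suc 0) be) (sum_list be) C (mv d D ` vecs d)))"
proof -
  interpret subspace_target "mv d D ` vecs d" d by (rule subspace_target_image[OF D(1)])
  let ?S = "heads (Suc 0) be" and ?e = "sum_list be"
  obtain l where l: "card (solutions ?S ?e C (mv d D ` vecs d)) = CARD('k) ^ l"
    using card_solutions_power[OF heads_subset C] by blast
  have "{y \<in> vecs ?e. mv ?e (Jmat be) y = 0 \<and> mv ?e C y \<in> mv d D ` vecs d} = solutions ?S ?e C (mv d D ` vecs d)"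
    unfolding solutions_def kernel_Jmat[symmetric] by auto
  then have "card {v \<in> vecs (d + ?e). mv (d + ?e) (blk d ?e D C (Jmat be)) v = 0} = CARD('k) ^ (s + l)"
    using card_kernel_blk[OF D(1) C Jmat_mats] D(2) l by (simp add: power_add)
  then have "nul (d + ?e) (blk d ?e D C (Jmat be)) = s + l" by (rule nulI)
  then show ?thesis using l q_ge_2[where 'k = 'k] by (simp add: qlog_power)
qed

text \<open>Read through the Hall pairing, this says that the \<open>b\<^sub>n\<close> are primitive.\<close>
lemma sum_qpoch_SES_eq_0:
  fixes K :: "'k::{field,finite} itself" and D :: "'k mat"
  assumes D: "nilp d D" "0 < d" and be: "is_partition be" "be \<noteq> []"
  shows "(\<Sum>mu\<in>partitions_of (d + sum_list be). qpoch (of_nat CARD('k)) (length mu - 1) *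
      of_nat (card (SES d D (d + sum_list be) (Jmat mu) (sum_list be) (Jmat be))) / of_nat (a_num K mu)) = 0"
proof -
  have Dm: "D \<in> mats d d" using D by (simp add: nilp_def)
  interpret subspace_target "mv d D ` vecs d" d by (rule subspace_target_image[OF Dm])
  let ?S = "heads (Suc 0) be" and ?e = "sum_list be"
  obtain s where s: "0 < s" "card {v \<in> vecs d. mv d D v = 0} = CARD('k) ^ s"
    using card_kernel_nilp[OF D] by blast
  have I: "card (mv d D ` vecs d) * CARD('k) ^ s = CARD('k) ^ d"
  proof -
    have "card (vecs d :: 'k vec set) = card (mv d D ` vecs d) * card {v \<in> vecs d. mv d D v = 0}"
      by (rule card_image_times_kernel) (auto simp: mv_add)
    then show ?thesis using s by (simp add: card_vecs)
  qed
  have "card ?S = length be" using be by (simp add: card_heads_1)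
  then have "?S \<noteq> {}" using be by auto
  then have "(\<Sum>C\<in>mats d ?e. qpoch (of_nat CARD('k)) (nul (d + ?e) (blk d ?e D C (Jmat be)) - 1)) = 0"
    using sum_qpoch_solutions[OF heads_subset[of "Suc 0" be] _ s(1) I]
    by (simp add: nul_blk[OF Dm s(2)])
  then show ?thesis
    using extension_sum[OF D(1) nilp_Jmat, where F = "\<lambda>l. qpoch (of_nat CARD('k)) (l - 1)" and K = K and lam1 = be] by simp
qed

section \<open>Masses of isomorphism classes\<close>

text \<open>X maps the image of f into itself and therefore descends to the quotient; lifting by the
  section computes the induced map as h X s.\<close>

lemma quotient_matrix:
  fixes X :: "'k::field mat"
  assumes sp: "splits d n e f h p s" and f: "f \<in> Hom d D n X" and X: "X \<in> mats n n"
  shows "h \<in> Hom n X e (mm n h (mm n X s))" "mm n h (mm n X s) \<in> mats e e"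
proof -
  note S = splitsD[OF sp] and Z = splits_zero[OF sp]
  have "mm n h X = mm n (mm n h X) (mm d f p + mm e s h)" using S X by (simp add: mm_idm_right[OF mats_mm])
  also have "\<dots> = mm d (mm n h (mm n X f)) p + mm e (mm n h (mm n X s)) h"
    by (simp add: mm_add_right mm_assoc)
  also have "mm n h (mm n X f) = mm d (mm n h f) D" using HomD(2)[OF f] by (simp add: mm_assoc)
  finally show "h \<in> Hom n X e (mm n h (mm n X s))" using Z S(2) by (intro HomI) simp_all
  show "mm n h (mm n X s) \<in> mats e e" using S X by (intro mats_mm)
qed

text \<open>With f fixed, every admissible h factors through h0 by an invertible map, namely h s.
  That h is a morphism means that this map is an isomorphism from E0 to E.\<close>

lemma card_quotient_maps:
  fixes X :: "'k::{field,finite} mat"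
  assumes sp: "splits d n e f h0 p s" and f: "f \<in> Hom d D n X" and h0: "h0 \<in> Hom n X e E0"
    and m: "E0 \<in> mats e e"
  shows "card {h. h \<in> Hom n X e E \<and> ses d n e f h} = card (isos e E0 E)"
proof -
  note S = splitsD[OF sp] and Z = splits_zero[OF sp]
  have fac: "mm e (mm n h s) h0 = h" if "h \<in> mats e n" "mm n h f = 0" for h
  proof -
    have "h = mm n h (mm d f p + mm e s h0)" using S that by simp
    also have "\<dots> = mm d (mm n h f) p + mm e (mm n h s) h0" by (simp add: mm_add_right mm_assoc)
    finally show ?thesis using that by simp
  qed
  have zero: "mm n h f = 0" "h \<in> mats e n" if "ses d n e f h" for h
    using that ses_splits splits_zero(1) splitsD(2) by metis+
  have "bij_betw (\<lambda>P. mm e P h0) (isos e E0 E) {h. h \<in> Hom n X e E \<and> ses d n e f h}"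
  proof (rule bij_betw_byWitness[where f' = "\<lambda>h. mm n h s"])
    show "\<forall>a\<in>isos e E0 E. mm n (mm e a h0) s = a"
      using S by (auto simp: isos_def Hom_def cancel_right)
    show "\<forall>a\<in>{h. h \<in> Hom n X e E \<and> ses d n e f h}. mm e (mm n a s) h0 = a"
      using fac zero by blast
    show "(\<lambda>P. mm e P h0) ` isos e E0 E \<subseteq> {h. h \<in> Hom n X e E \<and> ses d n e f h}"
    proof (rule image_subsetI)
      fix P assume P: "P \<in> isos e E0 E"
      then obtain Q where "minv e P Q" by (auto simp: isos_def)
      then have "ses d n e f (mm e P h0)"
        using splits_change_quotient[OF sp minv_sym] splits_ses by blast
      then show "mm e P h0 \<in> {h. h \<in> Hom n X e E \<and> ses d n e f h}"
        using P Hom_comp[OF h0] by (auto simp: isos_def)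
    qed
    show "(\<lambda>h. mm n h s) ` {h. h \<in> Hom n X e E \<and> ses d n e f h} \<subseteq> isos e E0 E"
    proof (rule image_subsetI)
      fix h assume "h \<in> {h. h \<in> Hom n X e E \<and> ses d n e f h}"
      then have h: "h \<in> Hom n X e E" "ses d n e f h" by auto
      then obtain p' s' where sp': "splits d n e f h p' s'" using ses_splits by blast
      note S' = splitsD[OF sp'] and Z' = splits_zero[OF sp']
      have a: "mm e (mm n h s) h0 = h" using fac S' Z' by blast
      have b: "mm e (mm n h0 s') h = h0"
      proof -
        have "h0 = mm n h0 (mm d f p' + mm e s' h)" using S S' by simp
        also have "\<dots> = mm d (mm n h0 f) p' + mm e (mm n h0 s') h" by (simp add: mm_add_right mm_assoc)
        finally show ?thesis using Z by simp
      qed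
      have "mm e (mm n h s) (mm n h0 s') = mm n (mm e (mm n h s) h0) s'" by (simp only: mm_assoc)
      moreover have "mm e (mm n h0 s') (mm n h s) = mm n (mm e (mm n h0 s') h) s" by (simp only: mm_assoc)
      ultimately have inv: "minv e (mm n h s) (mm n h0 s')"
        using a b S S' by (auto simp: minv_def)
      have "mm e E (mm n h s) = mm n (mm n h X) s" using HomD(2)[OF h(1)] by (simp flip: mm_assoc)
      also have "\<dots> = mm n (mm n (mm e (mm n h s) h0) X) s" by (simp only: a)
      also have "\<dots> = mm n (mm e (mm n h s) (mm e E0 h0)) s" using HomD(2)[OF h0] by (simp add: mm_assoc)
      also have "\<dots> = mm e (mm n h s) (mm e E0 (mm n h0 s))" by (simp only: mm_assoc)
      also have "\<dots> = mm e (mm n h s) E0" using S m by simp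
      finally show "mm n h s \<in> isos e E0 E" using inv minvD(1)[OF inv] by (auto simp: isos_def intro: HomI)
    qed
  qed
  then show ?thesis by (simp add: bij_betw_same_card)
qed

text \<open>The quotient by f has a single Jordan type, and the quotient maps onto that type form a
  torsor under its automorphisms. Summing over all types thus counts each embedding f once.\<close>

lemma sum_quotient_maps:
  fixes K :: "'k::{field,finite} itself" and X :: "'k mat"
  assumes X: "nilp (d + e) X" and f: "f \<in> Hom d D (d + e) X" and inj: "inj_on (mv d f) (vecs d)"
  shows "(\<Sum>be\<in>partitions_of e.
      of_nat (card {h. h \<in> Hom (d + e) X e (Jmat be) \<and> ses d (d + e) e f h}) / of_nat (a_num K be)) = (1 :: complex)"
proof -
  let ?n = "d + e"
  have Xm: "X \<in> mats ?n ?n" using X by (simp add: nilp_def)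
  obtain h p s where sp: "splits d ?n e f h p s"
    using splits_of_injective[OF HomD(1)[OF f] inj] by auto
  define E0 where "E0 = mm ?n h (mm ?n X s)"
  have h: "h \<in> Hom ?n X e E0" and E0: "E0 \<in> mats e e"
    using quotient_matrix[OF sp f Xm] by (simp_all add: E0_def)
  have nE: "nilp e E0" using quot_nilp[OF X h _ _ E0] splitsD[OF sp] by blast
  have "card {h. h \<in> Hom ?n X e (Jmat be) \<and> ses d ?n e f h} = card (isos e (Jmat be) E0)"
    if "be \<in> partitions_of e" for be
    using card_quotient_maps[OF sp f h E0] card_isos_sym[OF E0 Jmat_partition[OF that]] by simp
  then have "(\<Sum>be\<in>partitions_of e.
      of_nat (card {h. h \<in> Hom ?n X e (Jmat be) \<and> ses d ?n e f h}) / of_nat (a_num K be))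
    = (\<Sum>be\<in>partitions_of e. 1 * of_nat (card (isos e (Jmat be) E0)) / of_nat (a_num K be) :: complex)"
    by simp
  also have "\<dots> = 1" using sum_over_iso_class[OF nE, of "\<lambda>_. 1"] .
  finally show ?thesis .
qed

section \<open>Simple submodules and the mass recursion\<close>

lemma card_socle_maps:
  fixes X :: "'k::{field,finite} mat"
  assumes X: "X \<in> mats n n"
  shows "card {f. f \<in> Hom 1 (0 :: 'k mat) n X \<and> inj_on (mv 1 f) (vecs 1)}
    = card {v \<in> vecs n. mv n X v = 0} - 1"
proof -
  have mv1: "mv 1 f x = (\<lambda>i. f i 0 * x 0)" "mv (Suc 0) f x = (\<lambda>i. f i 0 * x 0)" for f :: "'k mat" and x by (simp_all add: mv_def)
  have col: "mv n X (\<lambda>i. f i 0) = (\<lambda>i. mm n X f i 0)" for f :: "'k mat" by (simp add: mv_def mm_def)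
  have inj: "inj_on (mv 1 f) (vecs 1) \<longleftrightarrow> (\<lambda>i. f i 0) \<noteq> 0" for f :: "'k mat"
  proof
    assume i: "inj_on (mv 1 f) (vecs 1)"
    show "(\<lambda>i. f i 0) \<noteq> 0"
    proof
      assume "(\<lambda>i. f i 0) = 0"
      then have "mv 1 f (unitv 0) = mv 1 f 0" by (simp add: mv1 fun_eq_iff)
      then have "unitv 0 = (0 :: 'k vec)" using inj_onD[OF i, of "unitv 0" 0] by simp
      from fun_cong[OF this, of 0] show False by (simp add: unitv_def)
    qed
  next
    assume "(\<lambda>i. f i 0) \<noteq> 0"
    then obtain i where i: "f i 0 \<noteq> 0" by (auto simp: fun_eq_iff)
    show "inj_on (mv 1 f) (vecs 1)"
    proof (rule inj_onI)
      fix x y :: "'k vec" assume "x \<in> vecs 1" "y \<in> vecs 1" and eq: "mv 1 f x = mv 1 f y"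
      have "f i 0 * x 0 = f i 0 * y 0" using fun_cong[OF eq, of i] by (simp add: mv1)
      then have "x 0 = y 0" using i by simp
      moreover have "x j = y j" if "0 < j" for j
        using \<open>x \<in> vecs 1\<close> \<open>y \<in> vecs 1\<close> that by (simp add: vecs_def)
      ultimately show "x = y" by (metis ext gr0I)
    qed
  qed
  have "bij_betw (\<lambda>v i j. if j = 0 then v i else 0) ({v \<in> vecs n. mv n X v = 0} - {0})
      {f. f \<in> Hom 1 (0 :: 'k mat) n X \<and> inj_on (mv 1 f) (vecs 1)}"
  proof (rule bij_betw_byWitness[where f' = "\<lambda>f i. f i 0"])
    show "\<forall>a\<in>{f. f \<in> Hom 1 (0 :: 'k mat) n X \<and> inj_on (mv 1 f) (vecs 1)}. (\<lambda>i j. if j = 0 then a i 0 else 0) = a"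
      by (auto simp: Hom_def mats_def fun_eq_iff)
    show "(\<lambda>v i j. if j = 0 then v i else 0) ` ({v \<in> vecs n. mv n X v = 0} - {0})
        \<subseteq> {f. f \<in> Hom 1 (0 :: 'k mat) n X \<and> inj_on (mv 1 f) (vecs 1)}"
    proof (rule image_subsetI)
      fix v :: "'k vec" assume v: "v \<in> {v \<in> vecs n. mv n X v = 0} - {0}"
      let ?f = "\<lambda>i j. if j = 0 then v i else (0 :: 'k)"
      have "?f \<in> mats n 1" using v by (auto simp: mats_def vecs_def)
      moreover have "mm n X ?f = 0"
      proof -
        have "mm n X ?f = (\<lambda>i j. if j = 0 then mv n X v i else 0)"
          by (auto simp: mm_def mv_def fun_eq_iff)
        then show ?thesis using v by (simp add: fun_eq_iff)
      qed
      ultimately have "?f \<in> Hom 1 (0 :: 'k mat) n X" by (intro HomI) auto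
      moreover have "inj_on (mv 1 ?f) (vecs 1)" unfolding inj using v by auto
      ultimately show "?f \<in> {f. f \<in> Hom 1 (0 :: 'k mat) n X \<and> inj_on (mv 1 f) (vecs 1)}" by blast
    qed
    show "(\<lambda>f i. f i 0) ` {f. f \<in> Hom 1 (0 :: 'k mat) n X \<and> inj_on (mv 1 f) (vecs 1)}
        \<subseteq> {v \<in> vecs n. mv n X v = 0} - {0}"
    proof (rule image_subsetI)
      fix f :: "'k mat" assume f: "f \<in> {f. f \<in> Hom 1 (0 :: 'k mat) n X \<and> inj_on (mv 1 f) (vecs 1)}"
      then have "mm n X f = 0" "f \<in> mats n 1" by (auto simp: Hom_def)
      then have "mv n X (\<lambda>i. f i 0) = 0" "(\<lambda>i. f i 0) \<in> vecs n"
        by (auto simp: col fun_eq_iff mats_def vecs_def)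
      then show "(\<lambda>i. f i 0) \<in> {v \<in> vecs n. mv n X v = 0} - {0}" using f inj by auto
    qed
  qed auto
  then have "card {f. f \<in> Hom 1 (0 :: 'k mat) n X \<and> inj_on (mv 1 f) (vecs 1)}
      = card ({v \<in> vecs n. mv n X v = 0} - {0})"
    by (simp add: bij_betw_same_card)
  also have "\<dots> = card {v \<in> vecs n. mv n X v = 0} - 1"
    by (subst card_Diff_singleton) auto
  finally show ?thesis .
qed

text \<open>A row restricted to k^S is either zero, which happens for q^(e - card S) rows, or maps
  onto the field and loses one dimension. For empty S the second coefficient is 0, so the truncated
  \<open>card S - 1\<close> does no harm.\<close>

lemma sum_rows:
  fixes S :: "nat set" and F :: "nat \<Rightarrow> complex"
  assumes S: "S \<subseteq> {..<e}"
  defines "q \<equiv> of_nat CARD('k::{field,finite}) :: complex"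
  shows "(\<Sum>C\<in>mats 1 e. F (qlog CARD('k) (card (solutions S e C {0 :: 'k vec}))))
    = q ^ (e - card S) * F (card S) + (q ^ e - q ^ (e - card S)) * F (card S - 1)"
proof -
  note q2 = q_ge_2[where 'k = 'k]
  have fin: "finite S" using S finite_subset by blast
  define W where "W = {C \<in> mats 1 e. \<forall>j\<in>S. C 0 j = (0 :: 'k)}"
  have W: "W \<subseteq> mats 1 e" by (auto simp: W_def)
  have "bij_betw (\<lambda>C. C 0) W (suppv ({..<e} - S) :: 'k vec set)"
    by (rule bij_betw_byWitness[where f' = "\<lambda>v i j. if i = 0 then v j else 0"])
      (auto simp: W_def mats_def suppv_def fun_eq_iff)
  then have cW: "card W = CARD('k) ^ (e - card S)"
    using S fin by (simp add: bij_betw_same_card card_suppv card_Diff_subset)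
  have nuW: "qlog CARD('k) (card (solutions S e C {0})) = card S" if "C \<in> W" for C
  proof -
    have "mv e C y = 0" if y: "y \<in> suppv S" for y
    proof
      fix i
      have z: "C i j * y j = 0" for j
        using \<open>C \<in> W\<close> y by (cases "i = 0"; cases "j \<in> S") (auto simp: W_def mats_def suppv_def)
      show "mv e C y i = 0 i" unfolding mv_def z by simp
    qed
    then have "solutions S e C {0} = suppv S" by (auto simp: solutions_def)
    then show ?thesis using fin q2 by (simp add: card_suppv qlog_power)
  qed
  have nuN: "qlog CARD('k) (card (solutions S e C {0})) = card S - 1" if C: "C \<in> mats 1 e" "C \<notin> W" for C
  proof -
    obtain j where j: "j \<in> S" "C 0 j \<noteq> 0" using C by (auto simp: W_def)
    have je: "j < e" using j S by auto
    have "card (suppv S :: 'k vec set) = card ((\<lambda>y. mv e C y 0) ` suppv S) * card {y \<in> suppv S. mv e C y 0 = 0}"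
      using fin by (intro card_image_times_kernel) (auto simp: finite_suppv suppv_add suppv_diff mv_add)
    moreover have "{y \<in> suppv S. mv e C y 0 = 0} = solutions S e C {0}"
    proof -
      have "mv e C y = 0 \<longleftrightarrow> mv e C y 0 = 0" for y
        using mv_vecs[OF C(1), of e y] by (auto simp: vecs_def fun_eq_iff) (metis One_nat_def Suc_leI gr0I)
      then show ?thesis by (auto simp: solutions_def)
    qed
    moreover have "(\<lambda>y. mv e C y 0) ` suppv S = UNIV"
    proof -
      have "t \<in> (\<lambda>y. mv e C y 0) ` suppv S" for t
      proof (rule image_eqI[of _ _ "\<lambda>i. (t / C 0 j) * unitv j i"])
        show "t = mv e C (\<lambda>i. (t / C 0 j) * unitv j i) 0"
          unfolding mv_scale using j je by (simp add: mv_unitv)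
        show "(\<lambda>i. (t / C 0 j) * unitv j i) \<in> suppv S"
          using j by (auto simp: suppv_def unitv_def)
      qed
      then show ?thesis by auto
    qed
    ultimately have "CARD('k) ^ card S = CARD('k) * card (solutions S e C {0})"
      by (simp add: card_suppv fin)
    moreover have "0 < card S" using j fin by (auto simp: card_gt_0_iff)
    ultimately have "CARD('k) * CARD('k) ^ (card S - 1) = CARD('k) * card (solutions S e C {0})"
      by (simp flip: power_Suc)
    then have "card (solutions S e C {0}) = CARD('k) ^ (card S - 1)" using q2 by simp
    then show ?thesis using q2 by (simp add: qlog_power)
  qed
  have "(\<Sum>C\<in>mats 1 e. F (qlog CARD('k) (card (solutions S e C {0 :: 'k vec}))))
      = (\<Sum>C\<in>mats 1 e. if C \<in> W then F (card S) else F (card S - 1))"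
    by (intro sum.cong) (auto simp: nuW nuN)
  also have "\<dots> = q ^ (e - card S) * F (card S) + (q ^ e - q ^ (e - card S)) * F (card S - 1)"
  proof -
    have "mats 1 e \<inter> {C. C \<in> W} = W" "card (mats 1 e \<inter> - {C. C \<in> W}) = card (mats 1 e :: 'k mat set) - card W"
      using W card_Diff_subset[OF finite_subset[OF W], of "mats 1 e"] by (auto simp: Diff_eq)
    moreover have "card W \<le> card (mats 1 e :: 'k mat set)" using W by (simp add: card_mono)
    ultimately show ?thesis
      by (simp add: sum.If_cases of_nat_diff card_mats cW q_def)
  qed
  finally show ?thesis .
qed

text \<open>A groupoid mass: each isomorphism class counts with the inverse order of its
  automorphism group.\<close>

definition mass :: "'k::{field,finite} itself \<Rightarrow> nat \<Rightarrow> (nat \<Rightarrow> complex) \<Rightarrow> complex" where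
  "mass K n F = (\<Sum>lam\<in>partitions_of n. F (length lam) / of_nat (a_num K lam))"

lemma length_le_sum_list_partition: "is_partition lam \<Longrightarrow> length lam \<le> sum_list lam"
proof -
  have "length lam \<le> sum_list lam" if "\<forall>x\<in>set lam. 0 < x" using that by (induction lam) auto
  then show "is_partition lam \<Longrightarrow> length lam \<le> sum_list lam" by (simp add: is_partition_def)
qed

text \<open>Counts sequences with one-dimensional sub in two ways. Seen from a middle term of length
  l, embeddings of the simple object are nonzero kernel vectors, q^l - 1 in number. Seen from a
  quotient of length r, a random row kills the kernel with probability q^(-r) and then yields length
  r + 1; otherwise the length remains r.\<close>

lemma mass_recursion:
  fixes K :: "'k::{field,finite} itself" and F :: "nat \<Rightarrow> complex"
  defines "q \<equiv> of_nat CARD('k) :: complex"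
  shows "mass K (Suc e) (\<lambda>l. (q ^ l - 1) * F l)
    = mass K e (\<lambda>r. F (Suc r) / q ^ r + (1 - 1 / q ^ r) * F r)"
proof -
  let ?n = "1 + e" and ?D = "0 :: 'k mat"
  have q: "q \<noteq> 0" by (simp add: q_def)
  have D: "nilp 1 ?D" by (auto simp: nilp_def intro: exI[of _ 1])
  have kerD: "card {v \<in> vecs 1. mv 1 ?D v = 0} = CARD('k) ^ 1" by (simp add: card_vecs)
  have ID: "mv 1 ?D ` vecs 1 = {0 :: 'k vec}" using vecs_zero[of 1] by auto
  have socle: "(\<Sum>be\<in>partitions_of e. of_nat (card (SES 1 ?D ?n (Jmat lam) e (Jmat be))) / of_nat (a_num K be))
      = q ^ length lam - 1" if lam: "lam \<in> partitions_of ?n" for lam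
  proof -
    have s: "sum_list lam = ?n" and J: "nilp ?n (Jmat lam :: 'k mat)"
      using nilp_Jmat[of lam, where 'k = 'k] lam by (auto simp: partitions_of_def)
    define A where "A = {f. f \<in> Hom 1 ?D ?n (Jmat lam) \<and> inj_on (mv 1 f) (vecs 1)}"
    have fA: "finite A"
      by (rule finite_subset[of _ "mats ?n 1"]) (auto simp: A_def Hom_def)
    have "of_nat (card (SES 1 ?D ?n (Jmat lam) e (Jmat be)))
        = (\<Sum>f\<in>A. of_nat (card {h. h \<in> Hom ?n (Jmat lam) e (Jmat be) \<and> ses 1 ?n e f h}) :: complex)" for be
    proof -
      have "SES 1 ?D ?n (Jmat lam) e (Jmat be) = (SIGMA f:A. {h. h \<in> Hom ?n (Jmat lam) e (Jmat be) \<and> ses 1 ?n e f h})"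
        by (auto simp: SES_def A_def ses_def)
      moreover have "finite {h. h \<in> Hom ?n (Jmat lam) e (Jmat be :: 'k mat) \<and> ses 1 ?n e f h}" for f
        by (rule finite_subset[of _ "mats e ?n"]) (auto simp: Hom_def)
      ultimately show ?thesis by (simp add: fA flip: of_nat_sum)
    qed
    then have "(\<Sum>be\<in>partitions_of e. of_nat (card (SES 1 ?D ?n (Jmat lam) e (Jmat be))) / of_nat (a_num K be))
        = (\<Sum>f\<in>A. \<Sum>be\<in>partitions_of e.
             of_nat (card {h. h \<in> Hom ?n (Jmat lam) e (Jmat be) \<and> ses 1 ?n e f h}) / of_nat (a_num K be) :: complex)"
      by (subst sum.swap) (simp add: sum_divide_distrib)
    also have "\<dots> = (\<Sum>f\<in>A. 1)"
      by (intro sum.cong refl sum_quotient_maps[OF J]) (auto simp: A_def)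
    also have "\<dots> = of_nat (CARD('k) ^ length lam - 1)"
      using card_socle_maps[OF Jmat_mats, of lam, where 'k = 'k] card_kernel_Jmat[of lam, where 'k = 'k] lam
      by (simp add: A_def s partitions_of_def)
    finally show ?thesis by (simp add: of_nat_diff q_def)
  qed
  have "mass K (Suc e) (\<lambda>l. (q ^ l - 1) * F l)
      = (\<Sum>lam\<in>partitions_of ?n. \<Sum>be\<in>partitions_of e.
          F (length lam) * of_nat (card (SES 1 ?D ?n (Jmat lam) e (Jmat be))) / of_nat (a_num K lam) / of_nat (a_num K be))"
    unfolding mass_def
  proof (intro sum.cong)
    fix lam assume "lam \<in> partitions_of ?n"
    note so = socle[OF this, symmetric]
    show "(q ^ length lam - 1) * F (length lam) / of_nat (a_num K lam)
        = (\<Sum>be\<in>partitions_of e. F (length lam) * of_nat (card (SES 1 ?D ?n (Jmat lam) e (Jmat be)))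
            / of_nat (a_num K lam) / of_nat (a_num K be))"
      unfolding so by (simp add: sum_distrib_left sum_distrib_right sum_divide_distrib ac_simps)
  qed simp
  also have "\<dots> = (\<Sum>be\<in>partitions_of e. (\<Sum>lam\<in>partitions_of ?n.
          F (length lam) * of_nat (card (SES 1 ?D ?n (Jmat lam) e (Jmat be))) / of_nat (a_num K lam)) / of_nat (a_num K be))"
    by (subst sum.swap) (simp add: sum_divide_distrib)
  also have "\<dots> = mass K e (\<lambda>r. F (Suc r) / q ^ r + (1 - 1 / q ^ r) * F r)"
    unfolding mass_def
  proof (intro sum.cong refl)
    fix be assume be: "be \<in> partitions_of e"
    then have s: "sum_list be = e" and p: "is_partition be" by (auto simp: partitions_of_def)
    let ?r = "length be" and ?S = "heads (Suc 0) be"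
    have r: "card ?S = ?r" "?r \<le> e" using card_heads_1[OF p] length_le_sum_list_partition[OF p] s by auto
    have S: "?S \<subseteq> {..<e}" using heads_subset[of "Suc 0" be] s by simp
    have "(\<Sum>lam\<in>partitions_of ?n.
          F (length lam) * of_nat (card (SES 1 ?D ?n (Jmat lam) e (Jmat be))) / of_nat (a_num K lam))
        = (\<Sum>C\<in>mats 1 e. F (nul ?n (blk 1 e ?D C (Jmat be)))) / q ^ e"
      using extension_sum[OF D nilp_Jmat[of be], of F K] s by (simp add: q_def)
    also have "(\<Sum>C\<in>mats 1 e. F (nul ?n (blk 1 e ?D C (Jmat be))))
        = (\<Sum>C\<in>mats 1 e. F (Suc (qlog CARD('k) (card (solutions ?S e C {0 :: 'k vec})))))"
      using nul_blk[OF mats_zero kerD, of _ be, unfolded s ID] by (intro sum.cong) auto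
    also have "\<dots> = q ^ (e - ?r) * F (Suc ?r) + (q ^ e - q ^ (e - ?r)) * F (Suc (?r - 1))"
      unfolding q_def using sum_rows[OF S, of "\<lambda>l. F (Suc l)", where 'k = 'k] r by simp
    \<comment> \<open>\<open>Suc (?r - 1)\<close> differs from \<open>?r\<close> only at 0, where
      its coefficient vanishes.\<close>
    also have "\<dots> / q ^ e = F (Suc ?r) / q ^ ?r + (1 - 1 / q ^ ?r) * F ?r"
    proof -
      have eq: "q ^ (e - ?r) = q ^ e / q ^ ?r" using r q by (simp add: power_diff)
      show ?thesis unfolding eq using q by (cases ?r) (simp_all add: field_simps)
    qed
    finally show "(\<Sum>lam\<in>partitions_of ?n.
          F (length lam) * of_nat (card (SES 1 ?D ?n (Jmat lam) e (Jmat be))) / of_nat (a_num K lam)) / of_nat (a_num K be)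
        = (F (Suc ?r) / q ^ ?r + (1 - 1 / q ^ ?r) * F ?r) / of_nat (a_num K be)" by simp
  qed
  finally show ?thesis .
qed

lemma partitions_of_0: "partitions_of 0 = {[]}"
proof (intro equalityI subsetI)
  fix l assume "l \<in> partitions_of 0"
  then show "l \<in> {[]}" by (cases l) (auto simp: partitions_of_def is_partition_def)
qed (auto simp: partitions_of_def is_partition_def)

lemma a_num_Nil: "a_num (K :: 'k::{field,finite} itself) [] = 1"
proof -
  have "isos 0 (Jmat []) (Jmat [] :: 'k mat) \<subseteq> {0}"
    using mats_0_left[of 0] by (auto simp: isos_def Hom_def)
  moreover have "0 < card (isos 0 (Jmat []) (Jmat [] :: 'k mat))"
    using a_num_pos[of K "[]"] by (simp add: a_num_isos)
  ultimately show ?thesis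
    using card_mono[of "{0 :: 'k mat}" "isos 0 (Jmat []) (Jmat [])"] by (simp add: a_num_isos)
qed

section \<open>Masses at fixed length: closed form and summation\<close>

definition level_mass :: "'k::{field,finite} itself \<Rightarrow> nat \<Rightarrow> nat \<Rightarrow> complex" where
  "level_mass K n l = mass K n (\<lambda>l'. if l' = l then 1 else 0)"

lemma mass_level_mass: "mass K n F = (\<Sum>l\<le>n. F l * level_mass K n l)"
proof -
  have "(\<Sum>l\<le>n. F l * level_mass K n l)
      = (\<Sum>lam\<in>partitions_of n. \<Sum>l\<le>n. if l = length lam then F l / of_nat (a_num K lam) else 0)"
    unfolding level_mass_def mass_def sum_distrib_left by (subst sum.swap) (auto intro!: sum.cong)
  also have "\<dots> = mass K n F"
    unfolding mass_def using length_le_sum_list_partition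
    by (intro sum.cong) (auto simp: partitions_of_def)
  finally show ?thesis ..
qed

lemma level_mass_0: "level_mass K 0 l = (if l = 0 then 1 else 0)"
  by (simp add: level_mass_def mass_def partitions_of_0 a_num_Nil)

lemma level_mass_Suc_0: "level_mass K (Suc n) 0 = 0"
  unfolding level_mass_def mass_def by (intro sum.neutral) (auto simp: partitions_of_def)

lemma level_mass_Suc_Suc:
  fixes K :: "'k::{field,finite} itself"
  defines "q \<equiv> of_nat CARD('k) :: complex"
  shows "(q ^ Suc k - 1) * level_mass K (Suc n) (Suc k)
    = level_mass K n k / q ^ k + (1 - 1 / q ^ Suc k) * level_mass K n (Suc k)"
proof -
  let ?F = "\<lambda>l'. if l' = Suc k then 1 else 0 :: complex"
  have "(q ^ Suc k - 1) * level_mass K (Suc n) (Suc k) = mass K (Suc n) (\<lambda>l. (q ^ l - 1) * ?F l)"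
    unfolding level_mass_def mass_def sum_distrib_left by (intro sum.cong) auto
  also have "\<dots> = mass K n (\<lambda>r. ?F (Suc r) / q ^ r + (1 - 1 / q ^ r) * ?F r)"
    unfolding q_def by (rule mass_recursion)
  also have "\<dots> = level_mass K n k / q ^ k + (1 - 1 / q ^ Suc k) * level_mass K n (Suc k)"
    unfolding level_mass_def mass_def sum_distrib_left sum_divide_distrib sum.distrib[symmetric]
    by (intro sum.cong) auto
  finally show ?thesis .
qed

text \<open>A descending product in powers of 1/q. For k > n the factor at i = n is 1 - 1/q^0 = 0,
  so it vanishes where the masses do.\<close>

definition falling :: "complex \<Rightarrow> nat \<Rightarrow> nat \<Rightarrow> complex" where
  "falling q n k = (\<Prod>i<k. 1 - 1 / q ^ (n - i))"

lemma falling_0: "falling q n 0 = 1"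
  by (simp add: falling_def)

lemma falling_Suc: "falling q n (Suc k) = falling q n k * (1 - 1 / q ^ (n - k))"
  by (simp add: falling_def)

lemma falling_Suc_Suc: "falling q (Suc n) (Suc k) = (1 - 1 / q ^ Suc n) * falling q n k"
  unfolding falling_def prod.lessThan_Suc_shift by simp

lemma falling_eq_0: "n < k \<Longrightarrow> falling q n k = 0"
  unfolding falling_def by (rule prod_zero) auto

lemma q_power_neq_1: "0 < j \<Longrightarrow> (of_nat CARD('k::{field,finite}) :: complex) ^ j \<noteq> 1"
proof
  assume j: "0 < j" and "(of_nat CARD('k) :: complex) ^ j = 1"
  then have "of_nat (CARD('k) ^ j) = (of_nat 1 :: complex)" by simp
  then have "CARD('k) ^ j = 1" by (simp only: of_nat_eq_iff)
  then show False using j q_ge_2[where 'k = 'k] by simp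
qed

text \<open>\<open>level_mass\<close> is the number of nilpotent matrices of given corank divided by
  the order of the general linear group. Including the square of \<open>qpoch\<close> clears the
  denominators that the recursion accumulates, which leaves a single product.\<close>

lemma qpoch_level_mass:
  fixes K :: "'k::{field,finite} itself"
  defines "q \<equiv> of_nat CARD('k) :: complex"
  shows "(qpoch q k)\<^sup>2 * level_mass K (Suc n) (Suc k)
    = falling q n k / (q ^ Suc n * (1 - 1 / q ^ Suc k))"
proof (induction n arbitrary: k)
  have q: "q \<noteq> 0" by (simp add: q_def)
  have q1: "q ^ Suc k - 1 \<noteq> 0" for k using q_power_neq_1[of "Suc k", where 'k = 'k] unfolding q_def by simp
  have alg: "1 - 1 / q ^ Suc k = (q ^ Suc k - 1) / q ^ Suc k" for k
    using q by (simp add: field_simps)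
  {
    case 0
    have "(q ^ Suc k - 1) * level_mass K (Suc 0) (Suc k) = (if k = 0 then 1 else 0)"
      using level_mass_Suc_Suc[of k K 0] by (simp add: level_mass_0 q_def)
    then have "level_mass K (Suc 0) (Suc k) = (if k = 0 then 1 / (q ^ Suc k - 1) else 0)"
      using q1[of k] by (cases "k = 0") (auto simp: eq_divide_eq mult.commute)
    then show ?case
      using q falling_eq_0[of 0 k q] unfolding alg by (cases "k = 0") (simp_all add: falling_0 qpoch_def)
  next
    case (Suc n)
    have rec: "(q ^ Suc k - 1) * ((qpoch q k)\<^sup>2 * level_mass K (Suc (Suc n)) (Suc k))
        = (qpoch q k)\<^sup>2 * level_mass K (Suc n) k / q ^ k
          + (1 - 1 / q ^ Suc k) * ((qpoch q k)\<^sup>2 * level_mass K (Suc n) (Suc k))"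
      using arg_cong[OF level_mass_Suc_Suc[of k K "Suc n"], of "\<lambda>x. (qpoch q k)\<^sup>2 * x"]
      by (simp add: q_def algebra_simps)
    have "(1 - 1 / q ^ Suc k) * ((qpoch q k)\<^sup>2 * level_mass K (Suc n) (Suc k)) = falling q n k / q ^ Suc n"
      unfolding Suc using q1[of k] alg[of k] q by (simp add: field_simps)
    \<comment> \<open>For k = \<open>Suc k'\<close> both terms contain
      \<open>falling q n k'\<close>: the first by the induction hypothesis at k', the second by
      splitting off the last factor. Their coefficients add up to q^k (1 - 1/q^(n+1)) / q^(n+1),
      which supplies the first factor of \<open>falling q (Suc n) k\<close>.\<close>
    moreover have "(qpoch q k)\<^sup>2 * level_mass K (Suc n) k / q ^ k + falling q n k / q ^ Suc n
        = q ^ k * falling q (Suc n) k / q ^ Suc n"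
    proof (cases k)
      case 0
      then show ?thesis by (simp add: level_mass_Suc_0 falling_0)
    next
      case (Suc k')
      have "(qpoch q k)\<^sup>2 * level_mass K (Suc n) k
          = (1 - q ^ k)\<^sup>2 * ((qpoch q k')\<^sup>2 * level_mass K (Suc n) (Suc k'))"
        using Suc by (simp add: qpoch_Suc power_mult_distrib del: power_Suc)
      also have "\<dots> = (q ^ k - 1)\<^sup>2 * (falling q n k' / (q ^ Suc n * ((q ^ k - 1) / q ^ k)))"
        unfolding Suc.IH[of k'] alg using Suc by (simp add: power2_commute)
      also have "\<dots> / q ^ k = (q ^ k - 1) * falling q n k' / q ^ Suc n"
        using q1[of k'] q Suc by (simp add: power2_eq_square del: power_Suc)
      finally have 1: "(qpoch q k)\<^sup>2 * level_mass K (Suc n) k / q ^ k = (q ^ k - 1) * falling q n k' / q ^ Suc n" .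
      have 2: "falling q n k = falling q n k' * (1 - q ^ k / q ^ Suc n)"
      proof (cases "k' \<le> n")
        case True
        then have "q ^ Suc n = q ^ (n - k') * q ^ k" using Suc by (simp flip: power_add)
        then show ?thesis using q Suc by (simp add: falling_Suc del: power_Suc)
      next
        case False
        then show ?thesis using Suc by (simp add: falling_Suc falling_eq_0)
      qed
      have 3: "falling q (Suc n) k = (1 - 1 / q ^ Suc n) * falling q n k'"
        using Suc by (simp add: falling_Suc_Suc del: power_Suc)
      have "(q ^ k - 1) * falling q n k' / q ^ Suc n + falling q n k' * (1 - q ^ k / q ^ Suc n) / q ^ Suc n
          = q ^ k * ((1 - 1 / q ^ Suc n) * falling q n k') / q ^ Suc n"
        using q by (simp add: field_simps del: power_Suc)
      then show ?thesis unfolding 1 2 3 .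
    qed
    ultimately have "(q ^ Suc k - 1) * ((qpoch q k)\<^sup>2 * level_mass K (Suc (Suc n)) (Suc k))
        = q ^ k * falling q (Suc n) k / q ^ Suc n"
      using rec by simp
    then have "(qpoch q k)\<^sup>2 * level_mass K (Suc (Suc n)) (Suc k)
        = q ^ k * falling q (Suc n) k / q ^ Suc n / (q ^ Suc k - 1)"
      by (subst nonzero_eq_divide_eq[OF q1]) (simp only: mult.commute)
    also have "\<dots> = falling q (Suc n) k / (q ^ Suc (Suc n) * (1 - 1 / q ^ Suc k))"
      unfolding alg using q q1[of k] by (simp add: mult_ac)
    finally show ?case .
  }
qed

text \<open>Raising the size from N to N + 1 adds \<open>falling q N k - falling q N (Suc k)\<close>
  to the k-th summand, and these differences telescope from 1 to 0. So each step adds 1, which is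
  the origin of the numerator n in the commutator.\<close>

lemma sum_falling:
  assumes q: "q \<noteq> 0" and q1: "\<And>j. 0 < j \<Longrightarrow> q ^ j \<noteq> 1"
  shows "(\<Sum>k\<le>n. falling q (Suc n) (Suc k) / (1 - 1 / q ^ Suc k)) = of_nat (Suc n)"
proof (induction n)
  case 0
  then show ?case using q q1[of 1] by (simp add: falling_Suc falling_0 field_simps)
next
  case (Suc n)
  let ?n = "Suc n"
  have step: "falling q (Suc ?n) (Suc k) / (1 - 1 / q ^ Suc k)
      = falling q ?n (Suc k) / (1 - 1 / q ^ Suc k) + (falling q ?n k - falling q ?n (Suc k))"
    if k: "k \<le> ?n" for k
  proof -
    have e: "1 / q ^ Suc ?n = 1 / q ^ (?n - k) * (1 / q ^ Suc k)"
      using k by (simp flip: power_add del: power_Suc)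
    have nz: "1 - 1 / q ^ Suc k \<noteq> 0" using q1[of "Suc k"] q by (simp add: field_simps)
    have "falling q (Suc ?n) (Suc k) = falling q ?n (Suc k) + (falling q ?n k - falling q ?n (Suc k)) * (1 - 1 / q ^ Suc k)"
      unfolding falling_Suc_Suc[of q ?n k] falling_Suc[of q ?n k] e
      by (simp add: algebra_simps diff_divide_distrib del: power_Suc)
    then show ?thesis using nz by (simp add: add_divide_distrib)
  qed
  have tel: "(\<Sum>k\<le>m. f k - f (Suc k)) = f 0 - f (Suc m)" for f :: "nat \<Rightarrow> complex" and m
    by (induction m) auto
  have "(\<Sum>k\<le>?n. falling q (Suc ?n) (Suc k) / (1 - 1 / q ^ Suc k))
      = (\<Sum>k\<le>?n. falling q ?n (Suc k) / (1 - 1 / q ^ Suc k)) + (falling q ?n 0 - falling q ?n (Suc ?n))"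
    using step by (simp add: sum.distrib flip: tel)
  then show ?case using Suc by (simp add: falling_0 falling_eq_0)
qed

text \<open>Length 0 does not occur in positive size. Absorbing 1 - 1/q^n into
  \<open>falling\<close> leaves the denominator q^n - 1 outside the sum.\<close>

lemma sum_qpoch_square:
  fixes K :: "'k::{field,finite} itself"
  defines "q \<equiv> of_nat CARD('k) :: complex"
  assumes "0 < n"
  shows "mass K n (\<lambda>l. (qpoch q (l - 1))\<^sup>2) = of_nat n / (q ^ n - 1)"
proof -
  obtain n' where n: "n = Suc n'" using assms by (cases n) auto
  have q: "q \<noteq> 0" by (simp add: q_def)
  have q1: "q ^ j \<noteq> 1" if "0 < j" for j using q_power_neq_1[OF that, where 'k = 'k] by (simp add: q_def)
  have nz: "q ^ Suc n' - 1 \<noteq> 0" using q1[of "Suc n'"] by simp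
  have "mass K n (\<lambda>l. (qpoch q (l - 1))\<^sup>2) = (\<Sum>k\<le>n'. (qpoch q k)\<^sup>2 * level_mass K (Suc n') (Suc k))"
    unfolding mass_level_mass n sum.atMost_Suc_shift by (simp add: level_mass_Suc_0)
  also have "\<dots> = (\<Sum>k\<le>n'. falling q n' k / (q ^ Suc n' * (1 - 1 / q ^ Suc k)))"
    unfolding q_def qpoch_level_mass ..
  also have "\<dots> = (\<Sum>k\<le>n'. falling q (Suc n') (Suc k) / (1 - 1 / q ^ Suc k)) / (q ^ Suc n' - 1)"
  proof -
    have "(1 - 1 / q ^ Suc n') = (q ^ Suc n' - 1) / q ^ Suc n'" using q by (simp add: field_simps)
    then have "falling q n' k / (q ^ Suc n' * x) = falling q (Suc n') (Suc k) / x / (q ^ Suc n' - 1)" for k x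
      unfolding falling_Suc_Suc using nz q by simp
    then show ?thesis by (simp add: sum_divide_distrib del: power_Suc)
  qed
  finally show ?thesis using sum_falling[OF q q1] n by simp
qed

section \<open>Duality\<close>

text \<open>Reversing each Jordan block turns the transpose of \<open>Jmat lam\<close> back into \<open>Jmat lam\<close>.\<close>
fun brev :: "nat list \<Rightarrow> nat \<Rightarrow> nat" where
  "brev [] p = p"
| "brev (k # l) p = (if p < k then k - 1 - p else k + brev l (p - k))"

lemma brev_brev [simp]: "brev l (brev l p) = p"
  by (induction l arbitrary: p) auto

lemma brev_eq_iff: "brev l i = brev l j \<longleftrightarrow> i = j"
  using inj_on_inverseI[of UNIV "brev l" "brev l"] by (simp add: inj_eq)

lemma brev_less: "p < sum_list l \<Longrightarrow> brev l p < sum_list l"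
  by (induction l arbitrary: p) auto

lemma brev_less_iff: "brev l p < sum_list l \<longleftrightarrow> p < sum_list l"
  using brev_less[of p l] brev_less[of "brev l p" l] by auto

lemma Jmat_Cons: "Jmat (k # l) i j =
  (if i < k then (if j = Suc i \<and> j < k then 1 else 0) else if j < k then 0 else Jmat l (i - k) (j - k))"
  unfolding Jmat_rest by auto

lemma Jmat_brev: "Jmat l (brev l i) (brev l j) = Jmat l j i"
proof (induction l arbitrary: i j)
  case Nil
  then show ?case by (simp add: Jmat_def)
next
  case (Cons k l)
  show ?case using Cons[of "i - k" "j - k"] by (auto simp: Jmat_Cons)
qed

text \<open>Transposition conjugated by block reversal: a contravariant involution on morphisms that
  fixes every \<open>Jmat\<close>.\<close>

definition dual :: "nat list \<Rightarrow> nat list \<Rightarrow> 'k::field mat \<Rightarrow> 'k mat" where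
  "dual lam mu M = (\<lambda>i j. M (brev mu j) (brev lam i))"

lemma dual_mats: "M \<in> mats (sum_list mu) (sum_list lam) \<Longrightarrow> dual lam mu M \<in> mats (sum_list lam) (sum_list mu)"
  using brev_less_iff by (auto simp: mats_def dual_def simp flip: not_less)

lemma dual_dual [simp]: "dual mu lam (dual lam mu M) = M"
  by (simp add: dual_def)

lemma dual_add: "dual lam mu (A + B) = dual lam mu A + dual lam mu B"
  by (auto simp: dual_def fun_eq_iff)

lemma dual_idm: "sum_list lam = n \<Longrightarrow> dual lam lam (idm n) = idm n"
  by (auto simp: dual_def idm_def fun_eq_iff brev_less_iff brev_eq_iff)

lemma dual_mm: "dual lam nu (mm (sum_list mu) A B) = mm (sum_list mu) (dual lam mu B) (dual mu nu A)"
proof (intro ext)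
  fix i j
  have "bij_betw (brev mu) {..<sum_list mu} {..<sum_list mu}"
    by (rule bij_betw_byWitness[where f' = "brev mu"]) (auto simp: brev_less)
  from sum.reindex_bij_betw[OF this, of "\<lambda>k. A (brev nu j) k * B k (brev lam i)"]
  show "dual lam nu (mm (sum_list mu) A B) i j = mm (sum_list mu) (dual lam mu B) (dual mu nu A) i j"
    by (simp add: dual_def mm_def mult.commute)
qed

lemma dual_Jmat: "dual lam lam (Jmat lam) = Jmat lam"
  by (simp add: dual_def Jmat_brev)

lemma dual_homs:
  assumes "M \<in> homs lam mu"
  shows "dual lam mu M \<in> homs mu lam"
proof -
  note M = HomD[OF assms[unfolded homs_Hom]]
  have "dual lam mu (mm (sum_list mu) (Jmat mu) M) = dual lam mu (mm (sum_list lam) M (Jmat lam))"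
    unfolding M(2) ..
  then have "mm (sum_list mu) (dual lam mu M) (Jmat mu) = mm (sum_list lam) (Jmat lam) (dual lam mu M)"
    unfolding dual_mm dual_Jmat .
  then show ?thesis unfolding homs_Hom using dual_mats[OF M(1)] by (intro HomI) simp_all
qed

text \<open>The section of h becomes the retraction of the dual inclusion, and the retraction of f
  becomes the dual section.\<close>

lemma dual_splits:
  assumes "splits (sum_list mu) (sum_list nu) (sum_list lam) f h p s"
  shows "splits (sum_list lam) (sum_list nu) (sum_list mu)
    (dual nu lam h) (dual mu nu f) (dual lam nu s) (dual nu mu p)"
proof -
  note S = splitsD[OF assms]
  have "mm (sum_list nu) (dual lam nu s) (dual nu lam h) = idm (sum_list lam)"
    "mm (sum_list nu) (dual mu nu f) (dual nu mu p) = idm (sum_list mu)"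
    using S by (simp_all add: dual_idm flip: dual_mm)
  moreover have "mm (sum_list lam) (dual nu lam h) (dual lam nu s) + mm (sum_list mu) (dual nu mu p) (dual mu nu f)
      = idm (sum_list nu)"
  proof -
    have "dual nu nu (mm (sum_list mu) f p + mm (sum_list lam) s h) = idm (sum_list nu)"
      unfolding S(7) by (simp add: dual_idm)
    then show ?thesis by (simp only: dual_add dual_mm add.commute)
  qed
  ultimately show ?thesis using S by (auto simp: splits_def dual_mats)
qed

lemma dual_ses:
  assumes "ses (sum_list mu) (sum_list nu) (sum_list lam) f h"
  shows "ses (sum_list lam) (sum_list nu) (sum_list mu) (dual nu lam h) (dual mu nu f)"
proof -
  obtain p s where "splits (sum_list mu) (sum_list nu) (sum_list lam) f h p s"
    using assms ses_splits by blast
  from splits_ses[OF dual_splits[OF this]] show ?thesis .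
qed

section \<open>Symmetry of the Hall numbers\<close>

abbreviation JSES :: "nat list \<Rightarrow> nat list \<Rightarrow> nat list \<Rightarrow> ('k::field mat \<times> 'k mat) set" where
  "JSES mu nu lam \<equiv> SES (sum_list mu) (Jmat mu) (sum_list nu) (Jmat nu) (sum_list lam) (Jmat lam)"

lemma card_JSES_dual: "card (JSES mu nu lam :: ('k::field mat \<times> 'k mat) set) = card (JSES lam nu mu :: ('k mat \<times> 'k mat) set)"
proof (rule bij_betw_same_card)
  have *: "(\<lambda>(f, h). (dual nu lam h, dual mu nu f)) ` JSES mu nu lam \<subseteq> (JSES lam nu mu :: ('k mat \<times> 'k mat) set)"
    for mu lam
    using dual_homs dual_ses unfolding homs_Hom SES_def by fastforce
  show "bij_betw (\<lambda>(f, h). (dual nu lam h, dual mu nu f)) (JSES mu nu lam) (JSES lam nu mu :: ('k mat \<times> 'k mat) set)"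
    by (rule bij_betw_byWitness[where f' = "\<lambda>(f, h). (dual nu mu h, dual lam nu f)"]) (use * in auto)
qed

text \<open>Dual to \<open>card_quotient_maps\<close>: transposition turns inclusions with a fixed
  quotient map into quotient maps with a fixed inclusion.\<close>

lemma card_sub_maps:
  fixes h0 :: "'k::{field,finite} mat"
  assumes "h0 \<in> homs nu lam" "f0 \<in> homs mu nu" "ses (sum_list mu) (sum_list nu) (sum_list lam) f0 h0"
  shows "card {f. f \<in> homs mu nu \<and> ses (sum_list mu) (sum_list nu) (sum_list lam) f h0}
    = card (isos (sum_list mu) (Jmat mu) (Jmat mu :: 'k mat))"
proof -
  obtain p s where "splits (sum_list mu) (sum_list nu) (sum_list lam) f0 h0 p s"
    using assms(3) ses_splits by blast
  note sp = dual_splits[OF this]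
  have "bij_betw (dual mu nu) {f. f \<in> homs mu nu \<and> ses (sum_list mu) (sum_list nu) (sum_list lam) f h0}
      {h. h \<in> homs nu mu \<and> ses (sum_list lam) (sum_list nu) (sum_list mu) (dual nu lam h0) h}"
  proof (rule bij_betw_byWitness[where f' = "dual nu mu"])
    show "dual nu mu ` {h. h \<in> homs nu mu \<and> ses (sum_list lam) (sum_list nu) (sum_list mu) (dual nu lam h0) h}
      \<subseteq> {f. f \<in> homs mu nu \<and> ses (sum_list mu) (sum_list nu) (sum_list lam) f h0}"
      using dual_homs dual_ses[of lam nu mu "dual nu lam h0"] by auto
  qed (use dual_homs dual_ses in auto)
  then have "card {f. f \<in> homs mu nu \<and> ses (sum_list mu) (sum_list nu) (sum_list lam) f h0}
      = card {h. h \<in> homs nu mu \<and> ses (sum_list lam) (sum_list nu) (sum_list mu) (dual nu lam h0) h}"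
    by (rule bij_betw_same_card)
  also have "\<dots> = card (isos (sum_list mu) (Jmat mu) (Jmat mu :: 'k mat))"
    unfolding homs_Hom
    using card_quotient_maps[OF sp dual_homs[OF assms(1), unfolded homs_Hom] dual_homs[OF assms(2), unfolded homs_Hom] Jmat_mats]
    by simp
  finally show ?thesis .
qed

text \<open>Choosing parametrisations of N and of the quotient turns N into a short exact sequence
  whose first map has image N.\<close>

lemma hall_set_eq:
  "{N :: 'k::{field,finite} vec set. subobj_iso nu N mu \<and> quot_iso nu N lam}
    = (\<lambda>(f, h). mv (sum_list mu) f ` vecs (sum_list mu)) ` JSES mu nu lam"
proof (intro equalityI subsetI)
  fix N :: "'k vec set" assume "N \<in> {N. subobj_iso nu N mu \<and> quot_iso nu N lam}"
  then obtain f h where f: "f \<in> homs mu nu" "bij_betw (mv (sum_list mu) f) (vecs (sum_list mu)) N"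
    and h: "h \<in> homs nu lam" "mv (sum_list nu) h ` vecs (sum_list nu) = vecs (sum_list lam)"
      "{v \<in> vecs (sum_list nu). mv (sum_list nu) h v = (\<lambda>_. 0)} = N"
    by (auto simp: subobj_iso_def quot_iso_def)
  then have "(f, h) \<in> JSES mu nu lam"
    unfolding SES_def ses_def homs_Hom[symmetric] using HomD(1)
    by (auto simp: bij_betw_def homs_Hom)
  then show "N \<in> (\<lambda>(f, h). mv (sum_list mu) f ` vecs (sum_list mu)) ` JSES mu nu lam"
    using f(2) by (auto simp: bij_betw_def intro!: image_eqI[of _ _ "(f, h)"])
next
  fix N assume "N \<in> (\<lambda>(f, h). mv (sum_list mu) f ` vecs (sum_list mu)) ` (JSES mu nu lam :: ('k mat \<times> 'k mat) set)"
  then obtain f h where N: "N = mv (sum_list mu) f ` vecs (sum_list mu)" and fh: "(f, h) \<in> (JSES mu nu lam :: ('k mat \<times> 'k mat) set)"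
    by auto
  then have f: "f \<in> homs mu nu" and h: "h \<in> homs nu lam" and s: "ses (sum_list mu) (sum_list nu) (sum_list lam) f h"
    by (auto simp: SES_def homs_Hom)
  note S = sesD[OF s]
  have N2: "N = {v \<in> vecs (sum_list nu). mv (sum_list nu) h v = 0}" using S N by simp
  have "is_subspace (sum_list nu) N"
    unfolding is_subspace_def N2
    using mv_add[of "sum_list nu" h] mv_scale[of "sum_list nu" h]
    by (auto simp: vecs_def plus_fun_def fun_eq_iff)
  moreover have "mv (sum_list nu) (Jmat nu) v \<in> N" if v: "v \<in> N" for v
  proof -
    obtain w where w: "w \<in> vecs (sum_list mu)" "v = mv (sum_list mu) f w" using v N by auto
    then have "mv (sum_list nu) (Jmat nu) v = mv (sum_list mu) f (mv (sum_list mu) (Jmat mu) w)"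
      using f by (auto simp: homs_def)
    then show ?thesis using N by (metis Jmat_mats image_eqI mv_vecs)
  qed
  moreover have "bij_betw (mv (sum_list mu) f) (vecs (sum_list mu)) N"
    using S N by (auto simp: bij_betw_def)
  ultimately show "N \<in> {N. subobj_iso nu N mu \<and> quot_iso nu N lam}"
    using f h S N2 by (auto simp: subobj_iso_def quot_iso_def)
qed

text \<open>Over a fixed subobject the inclusion and the quotient map vary independently, each in a
  torsor under the automorphisms of its own object.\<close>

lemma card_JSES_hall_g:
  fixes K :: "'k::{field,finite} itself"
  shows "card (JSES mu nu lam :: ('k mat \<times> 'k mat) set) = hall_g K nu lam mu * (a_num K mu * a_num K lam)"
proof -
  let ?I = "\<lambda>(f, h). mv (sum_list mu) f ` vecs (sum_list mu)"
  let ?T = "JSES mu nu lam :: ('k mat \<times> 'k mat) set"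
  have fib: "card {x \<in> ?T. ?I x = N} = a_num K mu * a_num K lam" if N: "N \<in> ?I ` ?T" for N
  proof -
    obtain f0 h0 where N: "N = mv (sum_list mu) f0 ` vecs (sum_list mu)" and fh: "(f0, h0) \<in> ?T" using N by auto
    then have f0: "f0 \<in> homs mu nu" and h0: "h0 \<in> homs nu lam" and s: "ses (sum_list mu) (sum_list nu) (sum_list lam) f0 h0"
      by (auto simp: SES_def homs_Hom)
    obtain p s' where sp: "splits (sum_list mu) (sum_list nu) (sum_list lam) f0 h0 p s'"
      using s ses_splits by blast
    have "{x \<in> ?T. ?I x = N} = {f. f \<in> homs mu nu \<and> ses (sum_list mu) (sum_list nu) (sum_list lam) f h0}
        \<times> {h. h \<in> homs nu lam \<and> ses (sum_list mu) (sum_list nu) (sum_list lam) f0 h}"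
      using s unfolding SES_def homs_Hom[symmetric] N by (auto simp: ses_def)
    moreover have "card {h. h \<in> homs nu lam \<and> ses (sum_list mu) (sum_list nu) (sum_list lam) f0 h} = a_num K lam"
      unfolding homs_Hom a_num_isos
      by (rule card_quotient_maps[OF sp f0[unfolded homs_Hom] h0[unfolded homs_Hom] Jmat_mats])
    ultimately show ?thesis
      using card_sub_maps[OF h0 f0 s] by (simp add: card_cartesian_product a_num_isos)
  qed
  have fT: "finite ?T" by (rule finite_SES)
  have "card ?T = card (\<Union>N\<in>?I ` ?T. {x \<in> ?T. ?I x = N})" by (rule arg_cong[where f = card]) auto
  also have "\<dots> = (\<Sum>N\<in>?I ` ?T. card {x \<in> ?T. ?I x = N})"
    by (rule card_UN_disjoint) (use fT in auto)
  also have "\<dots> = card (?I ` ?T) * (a_num K mu * a_num K lam)" using fib by simp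
  also have "card (?I ` ?T) = hall_g K nu lam mu" by (simp add: hall_g_def hall_set_eq)
  finally show ?thesis .
qed

text \<open>Duality swaps sub and quotient in the count of sequences, while the automorphism factor
  is symmetric and nonzero.\<close>

lemma hall_g_commute:
  fixes K :: "'k::{field,finite} itself"
  shows "hall_g K nu lam mu = hall_g K nu mu lam"
  using card_JSES_hall_g[of mu nu lam K] card_JSES_hall_g[of lam nu mu K] card_JSES_dual[of mu nu lam, where 'k = 'k]
    a_num_pos[of K mu] a_num_pos[of K lam]
  by (simp add: mult.commute)

section \<open>The commutator\<close>

definition Exact4 :: "nat list \<Rightarrow> nat list \<Rightarrow> nat list \<Rightarrow> nat list \<Rightarrow> ('k::field mat \<times> 'k mat \<times> 'k mat) set" where
  "Exact4 al mu lam be = {(f, g, h). f \<in> homs al mu \<and> g \<in> homs mu lam \<and> h \<in> homs lam be \<and> exact4 al mu lam be f g h}"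

lemma hall_gamma_Exact4:
  "hall_gamma (K :: 'k::{field,finite} itself) lam mu al be
    = real (card (Exact4 al mu lam be :: ('k mat \<times> 'k mat \<times> 'k mat) set)) / (real (a_num K lam) * real (a_num K mu))"
  by (simp add: hall_gamma_def Exact4_def)

lemma finite_Exact4 [simp, intro]: "finite (Exact4 al mu lam be :: ('k::{field,finite} mat \<times> 'k mat \<times> 'k mat) set)"
  by (rule finite_subset[of _ "mats (sum_list mu) (sum_list al) \<times> mats (sum_list lam) (sum_list mu) \<times> mats (sum_list be) (sum_list lam)"])
    (auto simp: Exact4_def homs_def)

text \<open>With \<pi> a cokernel of f, exactness at the second term says that g is an injection
  after \<pi>. A section s of \<pi> recovers the injection as g s, and exactness at the third term
  makes it a kernel of h.\<close>

lemma exact4_factor: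
  assumes sp: "splits i n d f \<pi> p s" and f: "f \<in> mats n i" and g: "g \<in> mats m n" and h: "h \<in> mats j m"
  shows "mv i f ` vecs i = {v \<in> vecs n. mv n g v = 0} \<and> mv n g ` vecs n = {v \<in> vecs m. mv m h v = 0}
      \<and> mv m h ` vecs m = vecs j
    \<longleftrightarrow> ses d m j (mm n g s) h \<and> mm d (mm n g s) \<pi> = g" (is "?L \<longleftrightarrow> ?R")
proof
  note S = splitsD[OF sp] and Z = splits_zero[OF sp] and E = sesD[OF splits_ses[OF sp]]
  assume L: ?L
  have gf: "mm n g f = 0"
  proof (rule mats_eqI)
    fix v :: "'a vec" assume "v \<in> vecs i"
    then have "mv i f v \<in> {v \<in> vecs n. mv n g v = 0}" using L by blast
    then show "mv i (mm n g f) v = mv i 0 v" by (simp add: mv_mm)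
  qed (use g S in auto)
  have fac: "mm d (mm n g s) \<pi> = g"
  proof -
    have "g = mm n g (mm i f p + mm d s \<pi>)" using S g by simp
    also have "\<dots> = mm i (mm n g f) p + mm d (mm n g s) \<pi>" by (simp add: mm_add_right mm_assoc)
    finally show ?thesis using gf by simp
  qed
  have gsm: "mm n g s \<in> mats m d" using g S by blast
  have gs: "mv d (mm n g s) (mv n \<pi> v) = mv n g v" for v by (subst fac[symmetric]) (simp only: mv_mm)
  have "inj_on (mv d (mm n g s)) (vecs d)"
  proof (rule inj_onI)
    fix x y assume xy: "x \<in> vecs d" "y \<in> vecs d" "mv d (mm n g s) x = mv d (mm n g s) y"
    have "mv n g (mv d s (x - y)) = 0" using xy by (simp add: mv_mm mv_diff)
    moreover have "mv d s (x - y) \<in> vecs n" using S by blast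
    ultimately obtain z where "mv d s (x - y) = mv i f z" using L by blast
    then have "mv n \<pi> (mv d s (x - y)) = mv i (mm n \<pi> f) z" by (simp add: mv_mm)
    moreover have "mv n \<pi> (mv d s (x - y)) = x - y"
      using S xy by (simp add: vecs_diff flip: mv_mm)
    ultimately show "x = y" using Z by simp
  qed
  moreover have "mv d (mm n g s) ` vecs d = mv n g ` vecs n"
  proof -
    have "mv d (mm n g s) ` (mv n \<pi> ` vecs n) = mv n g ` vecs n"
      unfolding image_image gs ..
    then show ?thesis using E(5) by simp
  qed
  ultimately show ?R using L h gsm fac by (auto simp: ses_def)
next
  note S = splitsD[OF sp] and Z = splits_zero[OF sp] and E = sesD[OF splits_ses[OF sp]]
  assume R: ?R
  then have s: "ses d m j (mm n g s) h" and fac: "mm d (mm n g s) \<pi> = g" by auto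
  note F = sesD[OF s]
  have gs: "mv d (mm n g s) (mv n \<pi> v) = mv n g v" for v by (subst (2) fac[symmetric]) (simp only: mv_mm)
  have "mv n g v = 0 \<longleftrightarrow> mv n \<pi> v = 0" if "v \<in> vecs n" for v
  proof
    assume "mv n g v = 0"
    then have "mv d (mm n g s) (mv n \<pi> v) = mv d (mm n g s) 0" by (simp add: gs)
    then show "mv n \<pi> v = 0" using inj_onD[OF F(3)] S(2) by (metis mv_vecs vecs_zero)
  next
    assume "mv n \<pi> v = 0"
    then show "mv n g v = 0" using gs[of v] by simp
  qed
  then have "{v \<in> vecs n. mv n g v = 0} = {v \<in> vecs n. mv n \<pi> v = 0}" by auto
  moreover have "mv n g ` vecs n = mv d (mm n g s) ` (mv n \<pi> ` vecs n)"
    unfolding image_image gs ..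
  ultimately show ?L using E F by simp
qed

text \<open>Cutting at the image of g turns exactness into two short exact sequences, a form that
  can be dualised. The image is represented by a coordinate space of dimension d.\<close>

lemma exact4_algebraic:
  fixes f g h :: "'k::{field,finite} mat"
  assumes m: "f \<in> mats (sum_list mu) (sum_list al)" "g \<in> mats (sum_list lam) (sum_list mu)" "h \<in> mats (sum_list be) (sum_list lam)"
  shows "exact4 al mu lam be f g h \<longleftrightarrow> (\<exists>d \<pi> \<iota>. ses (sum_list al) (sum_list mu) d f \<pi>
    \<and> ses d (sum_list lam) (sum_list be) \<iota> h \<and> mm d \<iota> \<pi> = g)" (is "_ \<longleftrightarrow> ?R")
proof
  assume e: "exact4 al mu lam be f g h"
  then have "inj_on (mv (sum_list al) f) (vecs (sum_list al))" by (simp add: exact4_def)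
  then obtain \<pi> p s where sp: "splits (sum_list al) (sum_list mu) (sum_list mu - sum_list al) f \<pi> p s"
    using splits_of_injective[OF m(1)] by blast
  from e exact4_factor[OF sp m] splits_ses[OF sp] show ?R unfolding exact4_def by auto
next
  assume ?R
  then obtain d \<pi> \<iota> where s: "ses (sum_list al) (sum_list mu) d f \<pi>"
    "ses d (sum_list lam) (sum_list be) \<iota> h" "mm d \<iota> \<pi> = g" by blast
  obtain p s where sp: "splits (sum_list al) (sum_list mu) d f \<pi> p s" using s(1) ses_splits by blast
  have "mm (sum_list mu) g s = \<iota>"
    unfolding s(3)[symmetric] using cancel_right[OF splitsD(6)[OF sp] sesD(1)[OF s(2)]] .
  then show "exact4 al mu lam be f g h"
    using exact4_factor[OF sp m] s sesD(3)[OF s(1)] unfolding exact4_def by simp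
qed

lemma card_Exact4_dual:
  "card (Exact4 al mu lam be :: ('k::{field,finite} mat \<times> 'k mat \<times> 'k mat) set)
    = card (Exact4 be lam mu al :: ('k mat \<times> 'k mat \<times> 'k mat) set)"
proof (rule bij_betw_same_card)
  let ?D = "\<lambda>al mu lam be (f :: 'k mat, g, h). (dual lam be h, dual mu lam g, dual al mu f)"
  have *: "?D al mu lam be ` Exact4 al mu lam be \<subseteq> Exact4 be lam mu al" for al mu lam be
  proof (rule image_subsetI, clarify)
    fix f g h :: "'k mat" assume A: "(f, g, h) \<in> Exact4 al mu lam be"
    then have H: "f \<in> homs al mu" "g \<in> homs mu lam" "h \<in> homs lam be" and e: "exact4 al mu lam be f g h"
      by (auto simp: Exact4_def)
    note m = HomD(1)[OF H(1)[unfolded homs_Hom]] HomD(1)[OF H(2)[unfolded homs_Hom]] HomD(1)[OF H(3)[unfolded homs_Hom]]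
    note H' = dual_homs[OF H(1)] dual_homs[OF H(2)] dual_homs[OF H(3)]
    note m' = HomD(1)[OF H'(3)[unfolded homs_Hom]] HomD(1)[OF H'(2)[unfolded homs_Hom]] HomD(1)[OF H'(1)[unfolded homs_Hom]]
    obtain d \<pi> \<iota> where s: "ses (sum_list al) (sum_list mu) d f \<pi>" "ses d (sum_list lam) (sum_list be) \<iota> h"
      and g: "mm d \<iota> \<pi> = g"
      using e exact4_algebraic[OF m] by blast
    \<comment> \<open>\<open>dual_ses\<close> expects lists as indices. The list \<open>[d]\<close>
      stands for the bare space of dimension d, and the reversal of its coordinates cancels in the
      product.\<close>
    have "ses (sum_list al) (sum_list mu) (sum_list [d]) f \<pi>" "ses (sum_list [d]) (sum_list lam) (sum_list be) \<iota> h"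
      using s by simp_all
    note s' = dual_ses[OF this(1)] dual_ses[OF this(2)]
    have "mm (sum_list [d]) (dual mu [d] \<pi>) (dual [d] lam \<iota>) = dual mu lam g"
      using g dual_mm[of mu lam "[d]" \<iota> \<pi>] by simp
    then have "exact4 be lam mu al (dual lam be h) (dual mu lam g) (dual al mu f)"
      unfolding exact4_algebraic[OF m'] using s' by blast
    then show "(dual lam be h, dual mu lam g, dual al mu f) \<in> Exact4 be lam mu al"
      using H' by (simp add: Exact4_def)
  qed
  show "bij_betw (?D al mu lam be) (Exact4 al mu lam be) (Exact4 be lam mu al)"
    by (rule bij_betw_byWitness[where f' = "?D be lam mu al"]) (use * in auto)
qed

lemma hall_gamma_dual: "hall_gamma K lam mu al be = hall_gamma K mu lam be al"
  for K :: "'k::{field,finite} itself"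
  unfolding hall_gamma_Exact4 card_Exact4_dual[of al mu lam be] by (simp add: mult.commute)

text \<open>Sorts the exact sequences by f. For fixed f with cokernel D, a pair (g, h) amounts to a
  short exact sequence with sub D and quotient I_\<beta>, so the sum vanishes by
  \<open>sum_qpoch_SES_eq_0\<close> for each f separately. The size hypothesis makes D
  nonzero.\<close>

lemma sum_qpoch_Exact4_eq_0:
  fixes K :: "'k::{field,finite} itself"
  assumes less: "sum_list al < sum_list mu" and be: "is_partition be" "be \<noteq> []"
  shows "(\<Sum>lam\<in>partitions_of m. qpoch (of_nat CARD('k)) (length lam - 1) *
      of_nat (card (Exact4 al mu lam be :: ('k mat \<times> 'k mat \<times> 'k mat) set)) / of_nat (a_num K lam)) = 0"
proof -
  let ?i = "sum_list al" and ?n = "sum_list mu" and ?j = "sum_list be"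
  define d where "d = ?n - ?i"
  have d: "0 < d" using less by (simp add: d_def)
  define A where "A = {f :: 'k mat. f \<in> homs al mu \<and> inj_on (mv ?i f) (vecs ?i)}"
  have fA: "finite A"
    by (rule finite_subset[of _ "mats ?n ?i"]) (auto simp: A_def homs_def)
  define G where "G f lam = {gh :: 'k mat \<times> 'k mat. (f, gh) \<in> Exact4 al mu lam be}" for f lam
  have fG: "finite (G f lam)" for f lam
    using finite_vimageI[OF finite_Exact4, of "Pair f"] by (auto simp: G_def vimage_def inj_on_def)
  have card_E: "card (Exact4 al mu lam be :: ('k mat \<times> 'k mat \<times> 'k mat) set) = (\<Sum>f\<in>A. card (G f lam))" for lam
  proof -
    have "Exact4 al mu lam be = (SIGMA f:A. G f lam)"
      by (auto simp: Exact4_def A_def G_def exact4_def)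
    then show ?thesis using fA fG by simp
  qed
  have zero: "(\<Sum>lam\<in>partitions_of m. qpoch (of_nat CARD('k)) (length lam - 1) * of_nat (card (G f lam)) / of_nat (a_num K lam)) = 0"
    if f: "f \<in> A" for f
  proof -
    have fH: "f \<in> Hom ?i (Jmat al) ?n (Jmat mu)" and inj: "inj_on (mv ?i f) (vecs ?i)"
      using f by (auto simp: A_def homs_Hom)
    obtain \<pi> p s where sp: "splits ?i ?n d f \<pi> p s"
      using splits_of_injective[OF HomD(1)[OF fH] inj] unfolding d_def by blast
    note S = splitsD[OF sp]
    define D where "D = mm ?n \<pi> (mm ?n (Jmat mu) s)"
    have \<pi>: "\<pi> \<in> Hom ?n (Jmat mu) d D" and D: "D \<in> mats d d"
      using quotient_matrix[OF sp fH Jmat_mats] by (simp_all add: D_def)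
    have nD: "nilp d D" by (rule quot_nilp[OF nilp_Jmat \<pi> S(4,6) D])
    have cG: "card (G f lam) = card (SES d D (sum_list lam) (Jmat lam) ?j (Jmat be))" for lam
    proof (rule bij_betw_same_card)
      let ?m = "sum_list lam"
      have iff: "(g, h) \<in> G f lam \<longleftrightarrow> g \<in> homs mu lam \<and> h \<in> homs lam be \<and>
          ses d ?m ?j (mm ?n g s) h \<and> mm d (mm ?n g s) \<pi> = g" for g h
      proof -
        have "exact4 al mu lam be f g h \<longleftrightarrow> ses d ?m ?j (mm ?n g s) h \<and> mm d (mm ?n g s) \<pi> = g"
          if "g \<in> homs mu lam" "h \<in> homs lam be"
          using exact4_factor[OF sp S(1), of g ?m h ?j] that inj
          by (simp add: exact4_def homs_Hom Hom_def)
        then show ?thesis using f by (auto simp: G_def Exact4_def A_def)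
      qed
      show "bij_betw (\<lambda>(g, h). (mm ?n g s, h)) (G f lam) (SES d D ?m (Jmat lam) ?j (Jmat be))"
      proof (rule bij_betw_byWitness[where f' = "\<lambda>(g', h). (mm d g' \<pi>, h)"])
        show "\<forall>a\<in>G f lam. (case (case a of (g, h) \<Rightarrow> (mm ?n g s, h)) of (g', h) \<Rightarrow> (mm d g' \<pi>, h)) = a"
          using iff by auto
        have c: "mm ?n (mm d g' \<pi>) s = g'" if "g' \<in> mats ?m d" for g'
          using cancel_right[OF S(6) that] .
        show "\<forall>a\<in>SES d D ?m (Jmat lam) ?j (Jmat be). (case (case a of (g', h) \<Rightarrow> (mm d g' \<pi>, h)) of (g, h) \<Rightarrow> (mm ?n g s, h)) = a"
          using c by (auto simp: SES_def Hom_def)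
        show "(\<lambda>(g, h). (mm ?n g s, h)) ` G f lam \<subseteq> SES d D ?m (Jmat lam) ?j (Jmat be)"
        proof (rule image_subsetI, clarify)
          fix g h assume "(g, h) \<in> G f lam"
          then have g: "g \<in> Hom ?n (Jmat mu) ?m (Jmat lam)" and h: "h \<in> Hom ?m (Jmat lam) ?j (Jmat be)"
            and e: "ses d ?m ?j (mm ?n g s) h" "mm d (mm ?n g s) \<pi> = g" using iff by (auto simp: homs_Hom)
          have "mm d (mm ?n g s) D = mm ?n (mm d (mm ?n g s) \<pi>) (mm ?n (Jmat mu) s)"
            by (simp only: D_def mm_assoc)
          also have "\<dots> = mm ?n (mm ?n g (Jmat mu)) s" unfolding e(2) by (simp only: mm_assoc)
          also have "\<dots> = mm ?m (Jmat lam) (mm ?n g s)" using HomD(2)[OF g] by (simp flip: mm_assoc)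
          finally have "mm ?n g s \<in> Hom d D ?m (Jmat lam)" using sesD(1)[OF e(1)] by (intro HomI) simp_all
          then show "(mm ?n g s, h) \<in> SES d D ?m (Jmat lam) ?j (Jmat be)" using h e by (simp add: SES_def)
        qed
        show "(\<lambda>(g', h). (mm d g' \<pi>, h)) ` SES d D ?m (Jmat lam) ?j (Jmat be) \<subseteq> G f lam"
        proof (rule image_subsetI, clarify)
          fix g' h assume "(g', h) \<in> SES d D ?m (Jmat lam) ?j (Jmat be)"
          then have g': "g' \<in> Hom d D ?m (Jmat lam)" and h: "h \<in> homs lam be" and e: "ses d ?m ?j g' h"
            by (auto simp: SES_def homs_Hom)
          show "(mm d g' \<pi>, h) \<in> G f lam"
            unfolding iff using c[OF HomD(1)[OF g']] Hom_comp[OF \<pi> g'] h e by (simp add: homs_Hom)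
        qed
      qed
    qed
    show ?thesis
    proof (cases "m = d + ?j")
      case True
      then show ?thesis
        using sum_qpoch_SES_eq_0[OF nD d be, of K] by (simp add: cG partitions_of_def)
    next
      \<comment> \<open>Exactness forces |\<lambda>| = d + |\<beta>|, so for any other m there are
        no sequences.\<close>
      case False
      have "card (G f lam) = 0" if "lam \<in> partitions_of m" for lam
      proof -
        have "SES d D (sum_list lam) (Jmat lam) ?j (Jmat be) = {}"
        proof (rule ccontr)
          assume "SES d D (sum_list lam) (Jmat lam) ?j (Jmat be) \<noteq> {}"
          then obtain f h where "ses d (sum_list lam) ?j f (h :: 'k mat)" by (auto simp: SES_def)
          then show False using ses_splits splits_dim that False by (metis (mono_tags, lifting) mem_Collect_eq partitions_of_def)
        qed
        then show ?thesis by (simp add: cG)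
      qed
      then show ?thesis by simp
    qed
  qed
  have "(\<Sum>lam\<in>partitions_of m. qpoch (of_nat CARD('k)) (length lam - 1) *
      of_nat (card (Exact4 al mu lam be :: ('k mat \<times> 'k mat \<times> 'k mat) set)) / of_nat (a_num K lam))
    = (\<Sum>f\<in>A. \<Sum>lam\<in>partitions_of m. qpoch (of_nat CARD('k)) (length lam - 1) * of_nat (card (G f lam)) / of_nat (a_num K lam))"
    unfolding card_E by (subst sum.swap) (simp add: sum_distrib_left sum_divide_distrib)
  also have "\<dots> = 0" using zero by simp
  finally show ?thesis .
qed

section \<open>The surviving coefficients\<close>

lemma card_iso_partitions:
  fixes K :: "'k::{field,finite} itself"
  assumes "lam \<in> partitions_of n" "mu \<in> partitions_of n"
  shows "card (isos n (Jmat lam) (Jmat mu :: 'k mat)) = (if lam = mu then a_num K lam else 0)"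
proof (cases "lam = mu")
  case True
  then show ?thesis using assms by (simp add: a_num_isos partitions_of_def)
next
  case False
  then have "isos n (Jmat lam) (Jmat mu :: 'k mat) = {}"
    using jordan_unique[of lam mu n] assms by (auto simp: partitions_of_def)
  then show ?thesis using False by simp
qed

text \<open>Equal sizes make f and h bijective and hence g zero. By uniqueness of the Jordan type
  this requires equal partitions, and then the automorphism counts cancel.\<close>

lemma gamma_full:
  fixes K :: "'k::{field,finite} itself"
  assumes "lam \<in> partitions_of m" "be \<in> partitions_of m" "mu \<in> partitions_of n" "al \<in> partitions_of n"
  shows "hall_gamma K lam mu al be = (if al = mu \<and> be = lam then 1 else 0)"
proof -
  have sums: "sum_list lam = m" "sum_list be = m" "sum_list mu = n" "sum_list al = n"
    using assms by (auto simp: partitions_of_def)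
  have "Exact4 al mu lam be = (\<lambda>(f, h). (f, 0, h)) ` (isos n (Jmat al) (Jmat mu) \<times> isos m (Jmat lam) (Jmat be :: 'k mat))"
  proof (intro equalityI subsetI)
    fix x :: "'k mat \<times> 'k mat \<times> 'k mat" assume x: "x \<in> Exact4 al mu lam be"
    obtain f g h where fgh: "x = (f, g, h)" by (cases x)
    have f: "f \<in> Hom n (Jmat al) n (Jmat mu)" and g: "g \<in> Hom n (Jmat mu) m (Jmat lam)"
      and h: "h \<in> Hom m (Jmat lam) m (Jmat be)"
      and e: "inj_on (mv n f) (vecs n)" "mv n f ` vecs n = {v \<in> vecs n. mv n g v = 0}"
      "mv n g ` vecs n = {v \<in> vecs m. mv m h v = 0}" "mv m h ` vecs m = vecs m"
      using x sums by (auto simp: fgh Exact4_def exact4_def homs_Hom)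
    have "mv n f ` vecs n = vecs n"
      using endo_inj_surj[of "vecs n" "mv n f"] e(1) HomD(1)[OF f] by blast
    then have "mv n g v = 0" if "v \<in> vecs n" for v using e(2) that by blast
    then have g0: "g = 0" using HomD(1)[OF g] by (intro mats_eqI) auto
    have "inj_on (mv m h) (vecs m)" using e(4) by (simp add: eq_card_imp_inj_on)
    then obtain Q where "minv m h Q" using inj_minv[OF HomD(1)[OF h]] by blast
    moreover obtain R where "minv n f R" using inj_minv[OF HomD(1)[OF f] e(1)] .
    ultimately have "f \<in> isos n (Jmat al) (Jmat mu)" "h \<in> isos m (Jmat lam) (Jmat be)"
      using f h by (auto simp: isos_def)
    then show "x \<in> (\<lambda>(f, h). (f, 0, h)) ` (isos n (Jmat al) (Jmat mu) \<times> isos m (Jmat lam) (Jmat be))"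
      using fgh g0 by (auto intro!: image_eqI[of _ _ "(f, h)"])
  next
    fix x :: "'k mat \<times> 'k mat \<times> 'k mat" assume "x \<in> (\<lambda>(f, h). (f, 0, h)) ` (isos n (Jmat al) (Jmat mu) \<times> isos m (Jmat lam) (Jmat be :: 'k mat))"
    then obtain f h where x: "x = (f, 0, h)" and f: "f \<in> isos n (Jmat al) (Jmat mu)"
      and h: "h \<in> isos m (Jmat lam) (Jmat be)" by auto
    have bf: "bij_betw (mv n f) (vecs n) (vecs n)" and bh: "bij_betw (mv m h) (vecs m) (vecs m)"
      using f h minv_bij by (auto simp: isos_def)
    have "{v \<in> vecs m. mv m h v = 0} = {0}"
      using inj_onD[OF bij_betw_imp_inj_on[OF bh], of _ 0] by auto
    then show "x \<in> Exact4 al mu lam be"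
      using bf bh f h sums vecs_zero[of n] by (auto simp: x Exact4_def exact4_def homs_Hom isos_def bij_betw_def Hom_def)
  qed
  moreover have "inj_on (\<lambda>(f, h). (f, 0 :: 'k mat, h)) (isos n (Jmat al) (Jmat mu) \<times> isos m (Jmat lam) (Jmat be :: 'k mat))"
    by (auto simp: inj_on_def)
  note card_image[OF this]
  ultimately have "card (Exact4 al mu lam be :: ('k mat \<times> 'k mat \<times> 'k mat) set)
      = card (isos n (Jmat al) (Jmat mu :: 'k mat)) * card (isos m (Jmat lam) (Jmat be :: 'k mat))"
    by (simp only: card_cartesian_product)
  then show ?thesis
    using card_iso_partitions[OF assms(4,3), of K] card_iso_partitions[OF assms(1,2), of K]
      a_num_pos[of K lam] a_num_pos[of K mu]
    by (auto simp: hall_gamma_Exact4)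
qed

text \<open>With both ends zero, g is an isomorphism. Their number a_\<lambda>, divided by the
  product of the two automorphism counts, leaves one such count in the denominator.\<close>

lemma gamma_Nil:
  fixes K :: "'k::{field,finite} itself"
  assumes "is_partition lam" "is_partition mu"
  shows "hall_gamma K lam mu [] [] = (if lam = mu then 1 / real (a_num K lam) else 0)"
proof -
  let ?m = "sum_list lam" and ?n = "sum_list mu"
  have bij: "bij_betw (mv ?n g) (vecs ?n) (vecs ?m)" if "exact4 [] mu lam [] f g h" "g \<in> mats ?m ?n" "f \<in> mats ?n 0" "h \<in> mats 0 ?m" for f g h :: "'k mat"
  proof -
    have "f = 0" "h = 0" using that(3,4) by (simp_all add: mats_0_left mats_0_right)
    then have k: "{v \<in> vecs ?n. mv ?n g v = 0} = {0}" and s: "mv ?n g ` vecs ?n = vecs ?m"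
      using that(1) by (simp_all add: exact4_def vecs_0)
    have "inj_on (mv ?n g) (vecs ?n)"
    proof (rule inj_onI)
      fix x y assume "x \<in> vecs ?n" "y \<in> vecs ?n" "mv ?n g x = mv ?n g y"
      then have "x - y \<in> {v \<in> vecs ?n. mv ?n g v = 0}" by (auto simp: mv_diff)
      then have "x - y = 0" unfolding k by simp
      then show "x = y" by simp
    qed
    then show ?thesis using s by (simp add: bij_betw_def)
  qed
  show ?thesis
  proof (cases "?m = ?n")
    case False
    have "(Exact4 [] mu lam [] :: ('k mat \<times> 'k mat \<times> 'k mat) set) = {}"
    proof (rule equals0I)
      fix x :: "'k mat \<times> 'k mat \<times> 'k mat" assume x: "x \<in> Exact4 [] mu lam []"
      obtain f g h where "x = (f, g, h)" by (cases x)
      then have "bij_betw (mv ?n g) (vecs ?n) (vecs ?m)"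
        using x by (intro bij) (auto simp: Exact4_def homs_Hom Hom_def)
      then have "CARD('k) ^ ?n = CARD('k) ^ ?m"
        using bij_betw_same_card[of "mv ?n g" "vecs ?n" "vecs ?m"] by (simp add: card_vecs)
      then show False using False q_ge_2[where 'k = 'k] by simp
    qed
    then show ?thesis using False by (auto simp: hall_gamma_Exact4)
  next
    case True
    have "Exact4 [] mu lam [] = (\<lambda>g. (0, g, 0)) ` isos ?n (Jmat mu) (Jmat lam :: 'k mat)"
    proof (intro equalityI subsetI)
      fix x :: "'k mat \<times> 'k mat \<times> 'k mat" assume x: "x \<in> Exact4 [] mu lam []"
      obtain f g h where fgh: "x = (f, g, h)" by (cases x)
      then have b: "bij_betw (mv ?n g) (vecs ?n) (vecs ?n)" and g: "g \<in> Hom ?n (Jmat mu) ?n (Jmat lam)"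
        and "f = 0" "h = 0"
        using x bij[of f g h] True by (auto simp: Exact4_def homs_Hom Hom_def mats_0_left mats_0_right)
      then obtain Q where "minv ?n g Q" using bij_minv[OF HomD(1)[OF g]] by blast
      then have "g \<in> isos ?n (Jmat mu) (Jmat lam)" using g by (auto simp: isos_def)
      then show "x \<in> (\<lambda>g. (0, g, 0)) ` isos ?n (Jmat mu) (Jmat lam)"
        using fgh \<open>f = 0\<close> \<open>h = 0\<close> by blast
    next
      fix x :: "'k mat \<times> 'k mat \<times> 'k mat" assume "x \<in> (\<lambda>g. (0, g, 0)) ` isos ?n (Jmat mu) (Jmat lam)"
      then obtain g where x: "x = (0, g, 0)" and g: "g \<in> isos ?n (Jmat mu) (Jmat lam)" by auto
      then have b: "bij_betw (mv ?n g) (vecs ?n) (vecs ?n)" using minv_bij by (auto simp: isos_def)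
      have "{v \<in> vecs ?n. mv ?n g v = 0} = {0}"
        using inj_onD[OF bij_betw_imp_inj_on[OF b], of _ 0] by auto
      then show "x \<in> Exact4 [] mu lam []"
        using b g True by (auto simp: x Exact4_def exact4_def homs_Hom isos_def bij_betw_def Hom_def vecs_0)
    qed
    then have "card (Exact4 [] mu lam [] :: ('k mat \<times> 'k mat \<times> 'k mat) set) = card (isos ?n (Jmat mu) (Jmat lam :: 'k mat))"
      by (simp add: card_image inj_on_def)
    then show ?thesis
      using card_iso_partitions[of mu ?n lam K] assms True a_num_pos[of K lam]
      by (auto simp: hall_gamma_Exact4 partitions_of_def)
  qed
qed

text \<open>The vanishing lemma applies if \<beta> is nonempty and \<alpha> is not of full size, its
  dual with the roles exchanged. The first summand on the right becomes the scalar in the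
  commutator, the second the product in opposite order.\<close>

lemma commutator_coefficient:
  fixes K :: "'k::{field,finite} itself"
  defines "\<phi> \<equiv> \<lambda>lam. qpoch (of_nat CARD('k)) (length (lam :: nat list) - 1)"
  assumes m: "0 < m" and n: "0 < n" and al: "is_partition al" "sum_list al \<le> n" and be: "is_partition be" "sum_list be \<le> m"
  shows "(\<Sum>lam\<in>partitions_of m. \<Sum>mu\<in>partitions_of n. \<phi> lam * \<phi> mu * of_real (hall_gamma K lam mu al be))
    = (if al = [] \<and> be = [] then (if m = n then of_nat n / (of_nat CARD('k) ^ n - 1) else 0) else 0)
      + (if sum_list al = n \<and> sum_list be = m then \<phi> al * \<phi> be else 0)"
proof -
  have vanish: "(\<Sum>lam\<in>partitions_of m. \<Sum>mu\<in>partitions_of n. \<phi> lam * \<phi> mu * of_real (hall_gamma K lam mu al be)) = 0"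
    if "sum_list al < n" "is_partition be" "be \<noteq> []" for al be m n
  proof (subst sum.swap, rule sum.neutral, rule ballI)
    fix mu assume mu: "mu \<in> partitions_of n"
    have "(\<Sum>lam\<in>partitions_of m. \<phi> lam * \<phi> mu * of_real (hall_gamma K lam mu al be))
        = \<phi> mu / of_nat (a_num K mu) * (\<Sum>lam\<in>partitions_of m. qpoch (of_nat CARD('k)) (length lam - 1) *
      of_nat (card (Exact4 al mu lam be :: ('k mat \<times> 'k mat \<times> 'k mat) set)) / of_nat (a_num K lam))"
      by (simp add: hall_gamma_Exact4 sum_distrib_left \<phi>_def mult_ac)
    also have "\<dots> = 0"
      using sum_qpoch_Exact4_eq_0[of al mu be K m] that mu by (simp add: partitions_of_def)
    finally show "(\<Sum>lam\<in>partitions_of m. \<phi> lam * \<phi> mu * of_real (hall_gamma K lam mu al be)) = 0" .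
  qed
  have nil: "l = []" if "is_partition l" "sum_list l = 0" for l
    using that partitions_of_0 by (auto simp: partitions_of_def)
  \<comment> \<open>As m and n are positive, the empty partition is never of full size, so these
    cases are exhaustive.\<close>
  consider "sum_list al < n" "be \<noteq> []" | "sum_list be < m" "al \<noteq> []"
    | "sum_list al = n" "sum_list be = m" | "al = []" "be = []"
    using al be m n
    by (cases "al = []"; cases "be = []"; cases "sum_list al = n"; cases "sum_list be = m") auto
  then show ?thesis
  proof cases
    case 1
    then show ?thesis using vanish[of al n be m] be by auto
  next
    case 2
    \<comment> \<open>Duality exchanges \<lambda> with \<mu> and \<alpha> with \<beta>, which brings
      the sum into the form of \<open>vanish\<close>.\<close>
    have "(\<Sum>lam\<in>partitions_of m. \<Sum>mu\<in>partitions_of n. \<phi> lam * \<phi> mu * of_real (hall_gamma K lam mu al be))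
        = (\<Sum>mu\<in>partitions_of n. \<Sum>lam\<in>partitions_of m. \<phi> mu * \<phi> lam * of_real (hall_gamma K mu lam be al))"
      by (subst sum.swap) (simp add: hall_gamma_dual[of K _ _ al be] mult.commute)
    also have "\<dots> = 0" using vanish[of be m al n] 2 al by simp
    finally show ?thesis using 2 by auto
  next
    case 3
    have alp: "al \<in> partitions_of n" and bep: "be \<in> partitions_of m" using 3 al be by (auto simp: partitions_of_def)
    have "(\<Sum>lam\<in>partitions_of m. \<Sum>mu\<in>partitions_of n. \<phi> lam * \<phi> mu * of_real (hall_gamma K lam mu al be))
        = (\<Sum>lam\<in>partitions_of m. \<Sum>mu\<in>partitions_of n. if mu = al then (if lam = be then \<phi> be * \<phi> al else 0) else 0)"
      by (intro sum.cong refl) (auto simp: gamma_full[OF _ bep _ alp])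
    also have "\<dots> = \<phi> al * \<phi> be" using alp bep by (simp add: mult.commute)
    finally show ?thesis using 3 m n by auto
  next
    case 4
    have "(\<Sum>lam\<in>partitions_of m. \<Sum>mu\<in>partitions_of n. \<phi> lam * \<phi> mu * of_real (hall_gamma K lam mu al be))
        = (\<Sum>lam\<in>partitions_of m. \<Sum>mu\<in>partitions_of n. if mu = lam then (\<phi> lam)\<^sup>2 / of_nat (a_num K lam) else 0)"
      using 4 by (intro sum.cong refl) (auto simp: gamma_Nil partitions_of_def power2_eq_square)
    also have "\<dots> = (\<Sum>lam\<in>partitions_of m. if lam \<in> partitions_of n then (\<phi> lam)\<^sup>2 / of_nat (a_num K lam) else 0)"
      by simp
    also have "\<dots> = (if m = n then mass K n (\<lambda>l. (qpoch (of_nat CARD('k)) (l - 1))\<^sup>2) else 0)"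
    proof (cases "m = n")
      case True
      then show ?thesis by (simp add: mass_def \<phi>_def)
    next
      case False
      then show ?thesis by (auto simp: partitions_of_def intro!: sum.neutral)
    qed
    finally show ?thesis using 4 m n sum_qpoch_square[OF n, of K] by auto
  qed
qed

section \<open>Assembly in an arbitrary algebra satisfying the relations\<close>

theorem theorem4p2:
  fixes K :: "'k::{field,finite} itself"
    and sc :: "complex \<Rightarrow> 'a::ring_1"
    and Z :: "int \<Rightarrow> nat list \<Rightarrow> 'a"
  assumes "DH_rep K sc Z"
  shows "(\<forall>m n :: int. 0 < m \<longrightarrow> 0 < n \<longrightarrow>
            b_elt K sc Z m * b_elt K sc Z (- n) - b_elt K sc Z (- n) * b_elt K sc Z m =
            (if m = n then sc (of_int n / (of_nat (card (UNIV :: 'k set)) ^ nat n - 1)) else 0))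
       \<and> (\<forall>m n :: int. 0 \<le> m * n \<longrightarrow> b_elt K sc Z m * b_elt K sc Z n = b_elt K sc Z n * b_elt K sc Z m)"
proof -
  let ?q = "of_nat CARD('k) :: complex"
  define \<phi> where "\<phi> lam = qpoch ?q (length lam - 1)" for lam :: "nat list"
  define B where "B i n = (\<Sum>lam\<in>partitions_of n. sc (\<phi> lam) * Z i lam)" for i n
  have sc_add: "sc (c + d) = sc c + sc d" and sc_mult: "sc (c * d) = sc c * sc d"
    and sc_1: "sc 1 = 1" and central: "sc c * x = x * sc c" for c d x
    using assms unfolding DH_rep_def by blast+
  have same: "Z i lam * Z i mu =
      (\<Sum>nu\<in>partitions_of (sum_list lam + sum_list mu). sc (of_nat (hall_g K nu lam mu)) * Z i nu)"
    if "is_partition lam" "is_partition mu" for i lam mu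
    using assms that unfolding DH_rep_def by blast
  \<comment> \<open>The relation at degree 0, left with \<open>0 + 1\<close> so that it matches
    \<open>DH_rep\<close> literally.\<close>
  have adjacent: "Z 0 lam * Z (0 + 1) mu =
      (\<Sum>al\<in>(\<Union>i\<le>sum_list mu. partitions_of i). \<Sum>be\<in>(\<Union>j\<le>sum_list lam. partitions_of j).
         sc (of_real (hall_gamma K lam mu al be)) * (Z (0 + 1) al * Z 0 be))"
    if "is_partition lam" "is_partition mu" for lam mu
    using assms that unfolding DH_rep_def by blast
  have Z_Nil: "Z i [] = 1" for i using assms unfolding DH_rep_def by blast
  have sc_0: "sc 0 = 0" using sc_add[of 0 0] by simp
  have sc_sum: "sc (sum f A) = (\<Sum>x\<in>A. sc (f x))" for f :: "nat list \<Rightarrow> complex" and A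
    by (induction A rule: infinite_finite_induct) (simp_all add: sc_0 sc_add)
  have pull: "(sc c * x) * (sc d * y) = sc (c * d) * (x * y)" for c d x y
    by (metis central mult.assoc sc_mult)
  have prod: "B i m * B j n = (\<Sum>lam\<in>partitions_of m. \<Sum>mu\<in>partitions_of n.
      sc (\<phi> lam * \<phi> mu) * (Z i lam * Z j mu))" for i j m n
    unfolding B_def sum_product pull ..
  have B_commute: "B i m * B i n = B i n * B i m" for i m n
  proof -
    have "Z i lam * Z i mu = Z i mu * Z i lam" if "is_partition lam" "is_partition mu" for lam mu
      using same[OF that] same[OF that(2,1)] by (simp add: add.commute hall_g_commute[of K _ lam mu])
    then show ?thesis
      unfolding prod by (subst sum.swap) (auto intro!: sum.cong simp: partitions_of_def mult.commute)
  qed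
  have comm: "B 0 m * B 1 n - B 1 n * B 0 m = (if m = n then sc (of_nat n / (?q ^ n - 1)) else 0)"
    if m: "0 < m" and n: "0 < n" for m n
  proof -
    define PA where "PA = (\<Union>i\<le>n. partitions_of i)"
    define PB where "PB = (\<Union>j\<le>m. partitions_of j)"
    define c where "c = (if m = n then of_nat n / (?q ^ n - 1) else 0)"
    have fin: "finite PA" "finite PB" by (auto simp: PA_def PB_def)
    have PA: "al \<in> PA \<longleftrightarrow> is_partition al \<and> sum_list al \<le> n" for al
      by (auto simp: PA_def partitions_of_def)
    have PB: "be \<in> PB \<longleftrightarrow> is_partition be \<and> sum_list be \<le> m" for be
      by (auto simp: PB_def partitions_of_def)
    have P: "l \<in> partitions_of k \<longleftrightarrow> is_partition l \<and> sum_list l = k" for l k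
      by (simp add: partitions_of_def)
    have nil: "is_partition []" by (simp add: is_partition_def)
    have "B 0 m * B 1 n = (\<Sum>lam\<in>partitions_of m. \<Sum>mu\<in>partitions_of n. \<Sum>al\<in>PA. \<Sum>be\<in>PB.
        sc (\<phi> lam * \<phi> mu * of_real (hall_gamma K lam mu al be)) * (Z 1 al * Z 0 be))"
      unfolding prod
    proof (intro sum.cong refl)
      fix lam mu assume lm: "lam \<in> partitions_of m" "mu \<in> partitions_of n"
      have "Z 0 lam * Z 1 mu = (\<Sum>al\<in>PA. \<Sum>be\<in>PB. sc (of_real (hall_gamma K lam mu al be)) * (Z 1 al * Z 0 be))"
        using adjacent[of lam mu] lm by (simp add: partitions_of_def PA_def PB_def)
      then show "sc (\<phi> lam * \<phi> mu) * (Z 0 lam * Z 1 mu) = (\<Sum>al\<in>PA. \<Sum>be\<in>PB.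
          sc (\<phi> lam * \<phi> mu * of_real (hall_gamma K lam mu al be)) * (Z 1 al * Z 0 be))"
        by (simp add: sum_distrib_left sc_mult mult.assoc)
    qed
    also have "\<dots> = (\<Sum>al\<in>PA. \<Sum>be\<in>PB. \<Sum>lam\<in>partitions_of m. \<Sum>mu\<in>partitions_of n.
        sc (\<phi> lam * \<phi> mu * of_real (hall_gamma K lam mu al be)) * (Z 1 al * Z 0 be))"
    proof -
      \<comment> \<open>Pairing the indices reduces the exchange of four sums to a single swap over
        two products.\<close>
      have sw: "(\<Sum>l\<in>A. \<Sum>u\<in>B. \<Sum>a\<in>C. \<Sum>b\<in>D. f l u a b) = (\<Sum>a\<in>C. \<Sum>b\<in>D. \<Sum>l\<in>A. \<Sum>u\<in>B. f l u a b)"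
        for f :: "nat list \<Rightarrow> nat list \<Rightarrow> nat list \<Rightarrow> nat list \<Rightarrow> 'a" and A B C D
      proof -
        have "(\<Sum>l\<in>A. \<Sum>u\<in>B. \<Sum>a\<in>C. \<Sum>b\<in>D. f l u a b)
            = (\<Sum>x\<in>A \<times> B. \<Sum>y\<in>C \<times> D. f (fst x) (snd x) (fst y) (snd y))"
          by (simp add: sum.cartesian_product')
        also have "\<dots> = (\<Sum>y\<in>C \<times> D. \<Sum>x\<in>A \<times> B. f (fst x) (snd x) (fst y) (snd y))"
          by (rule sum.swap)
        finally show ?thesis by (simp add: sum.cartesian_product')
      qed
      show ?thesis by (rule sw)
    qed
    also have "\<dots> = (\<Sum>al\<in>PA. \<Sum>be\<in>PB. (sc (if al = [] \<and> be = [] then c else 0)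
        + sc (if sum_list al = n \<and> sum_list be = m then \<phi> al * \<phi> be else 0)) * (Z 1 al * Z 0 be))"
    proof (intro sum.cong refl)
      fix al be assume "al \<in> PA" "be \<in> PB"
      then have "is_partition al" "sum_list al \<le> n" "is_partition be" "sum_list be \<le> m"
        by (simp_all add: PA PB)
      then have "(\<Sum>lam\<in>partitions_of m. \<Sum>mu\<in>partitions_of n. \<phi> lam * \<phi> mu * of_real (hall_gamma K lam mu al be))
          = (if al = [] \<and> be = [] then c else 0) + (if sum_list al = n \<and> sum_list be = m then \<phi> al * \<phi> be else 0)"
        unfolding \<phi>_def c_def by (rule commutator_coefficient[OF m n])
      from arg_cong[OF this, of sc] have eq: "(\<Sum>lam\<in>partitions_of m. \<Sum>mu\<in>partitions_of n.
            sc (\<phi> lam * \<phi> mu * of_real (hall_gamma K lam mu al be)))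
          = sc (if al = [] \<and> be = [] then c else 0)
            + sc (if sum_list al = n \<and> sum_list be = m then \<phi> al * \<phi> be else 0)"
        by (simp only: sc_sum sc_add)
      show "(\<Sum>lam\<in>partitions_of m. \<Sum>mu\<in>partitions_of n.
            sc (\<phi> lam * \<phi> mu * of_real (hall_gamma K lam mu al be)) * (Z 1 al * Z 0 be))
          = (sc (if al = [] \<and> be = [] then c else 0)
            + sc (if sum_list al = n \<and> sum_list be = m then \<phi> al * \<phi> be else 0)) * (Z 1 al * Z 0 be)"
        unfolding sum_distrib_right[symmetric] eq ..
    qed
    also have "\<dots> = (\<Sum>al\<in>PA. \<Sum>be\<in>PB. sc (if al = [] \<and> be = [] then c else 0) * (Z 1 al * Z 0 be))
        + (\<Sum>al\<in>PA. \<Sum>be\<in>PB. sc (if sum_list al = n \<and> sum_list be = m then \<phi> al * \<phi> be else 0) * (Z 1 al * Z 0 be))"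
      by (simp only: distrib_right sum.distrib)
    \<comment> \<open>Both generators at the empty partition are 1, so this part is the scalar
      c.\<close>
    also have "(\<Sum>al\<in>PA. \<Sum>be\<in>PB. sc (if al = [] \<and> be = [] then c else 0) * (Z 1 al * Z 0 be)) = sc c"
    proof -
      have "(\<Sum>al\<in>PA. \<Sum>be\<in>PB. sc (if al = [] \<and> be = [] then c else 0) * (Z 1 al * Z 0 be))
          = (\<Sum>al\<in>PA. \<Sum>be\<in>PB. if be = [] then (if al = [] then sc c else 0) else 0)"
        by (intro sum.cong refl) (auto simp: sc_0 Z_Nil)
      also have "\<dots> = sc c" using fin nil by (simp add: PA PB)
      finally show ?thesis .
    qed
    \<comment> \<open>The condition on sizes cuts both ranges down to partitions of n and m, and the
      remaining sum is the expansion of the product in opposite order.\<close>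
    also have "(\<Sum>al\<in>PA. \<Sum>be\<in>PB. sc (if sum_list al = n \<and> sum_list be = m then \<phi> al * \<phi> be else 0) * (Z 1 al * Z 0 be))
        = B 1 n * B 0 m"
    proof -
      have "(\<Sum>al\<in>PA. \<Sum>be\<in>PB. sc (if sum_list al = n \<and> sum_list be = m then \<phi> al * \<phi> be else 0) * (Z 1 al * Z 0 be))
          = (\<Sum>al\<in>PA. \<Sum>be\<in>partitions_of m. sc (if sum_list al = n then \<phi> al * \<phi> be else 0) * (Z 1 al * Z 0 be))"
        using fin by (intro sum.cong refl sum.mono_neutral_cong_right) (auto simp: PB sc_0 P)
      also have "\<dots> = (\<Sum>al\<in>partitions_of n. \<Sum>be\<in>partitions_of m. sc (\<phi> al * \<phi> be) * (Z 1 al * Z 0 be))"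
        using fin by (intro sum.mono_neutral_cong_right) (auto simp: PA sc_0 P)
      finally show ?thesis unfolding prod .
    qed
    finally show ?thesis by (simp add: c_def sc_0)
  qed
  have b_pos: "b_elt K sc Z n = B 0 (nat n)" if "0 < n" for n
    using that by (simp add: b_elt_def B_def \<phi>_def)
  have b_neg: "b_elt K sc Z n = B 1 (nat (- n))" if "n < 0" for n
    using that by (simp add: b_elt_def B_def \<phi>_def)
  have b_0: "b_elt K sc Z 0 = 1" by (simp add: b_elt_def)
  show ?thesis
  proof (intro conjI allI impI)
    fix m n :: int assume "0 < m" "0 < n"
    then show "b_elt K sc Z m * b_elt K sc Z (- n) - b_elt K sc Z (- n) * b_elt K sc Z m =
            (if m = n then sc (of_int n / (of_nat (card (UNIV :: 'k set)) ^ nat n - 1)) else 0)"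
      using comm[of "nat m" "nat n"] by (auto simp: b_pos b_neg)
  next
    fix m n :: int assume "0 \<le> m * n"
    then consider "0 < m" "0 < n" | "m < 0" "n < 0" | "m = 0" | "n = 0"
      unfolding zero_le_mult_iff by linarith
    then show "b_elt K sc Z m * b_elt K sc Z n = b_elt K sc Z n * b_elt K sc Z m"
      by cases (simp_all add: b_pos b_neg b_0 B_commute)
  qed
qed

end
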